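(* Let $\alpha\in(0,1)$, and consider the constant regression model with an arbitrary triangular array of design points $0\le t_{n1}\le\dots\le t_{nn}\le 1$, $n\in\mathbb N$. Let $\vec e^{\,n}=(e_{n2},\dots,e_{nn})^\top$ be the vector of the $n-1$ recursive least squares residuals. Then an asymptotic size $\alpha$ test of the null hypothesis $H_0$: "$g$ is constant on $[0,1]$, i.e. $g(t)=\beta$ for all $t\in[0,1]$ with an unknown constant $\beta\in\mathbb R$" is given by $$\text{reject } H_0 \iff \exists\, t\in[0,1]:\ \frac{1}{\sqrt{n-1}}\,T_{n-1}(\vec e^{\,n})(t)<\Phi^{-1}\!\left(\frac{\alpha}{2}\right),$$ where $\Phi^{-1}(\alpha/2)$ is the $\alpha/2$-quantile of the standard normal distribution. That is, if $H_0$ is true, then $$\lim_{n\to\infty}P\Big(\exists\, t\in[0,1]:\ \tfrac{1}{\sqrt{n-1}}T_{n-1}(\vec e^{\,n})(t)<\Phi^{-1}(\alpha/2)\Big)=\alpha .$$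
   Context: Observations: for a function $g:[0,1]\to\mathbb R$ and a triangular array of design points $0\le t_{n1}\le t_{n2}\le\dots\le t_{nn}\le 1$, $n\in\mathbb N$, one observes $Y_{nj}=g(t_{nj})+\varepsilon_{nj}$, $1\le j\le n$, where $\varepsilon_{n1},\dots,\varepsilon_{nn}$, $n\in\mathbb N$, is a triangular array of real random variables such that, for each $n\in\mathbb N$, $\varepsilon_{n1},\dots,\varepsilon_{nn}$ are iid with $E(\varepsilon_{ni})=0$ and $\mathrm{Var}(\varepsilon_{ni})=1$. Constant regression model: the linear model $g=\beta\mathbf 1_{[0,1]}$, i.e. the linear regression model with $d=1$ known regression function $f=\mathbf 1_{[0,1]}$ (identically $1$ on $[0,1]$). Recursive residuals: in general, with regression functions $f=(f_1,\dots,f_d)^\top$, $X^n_i=(f(t_{n1}),\dots,f(t_{ni}))^\top$, and $\hat\beta^n_i$ the least squares estimate of $\beta$ from the first $i$ observations, $$e_{ni}=\frac{Y_{ni}-f(t_{ni})^\top\hat\beta^n_{i-1}}{\big(1+f(t_{ni})^\top((X^n_{i-1})^\top X^n_{i-1})^{-1}f(t_{ni})\big)^{1/2}},\quad i=d+1,\dots,n.$$ For the constant regression model ($d=1$, $f\equiv1$) this reads $$e_{ni}=\frac{Y_{ni}-\frac1{i-1}\sum_{j=1}^{i-1}Y_{nj}}{\left(1+\frac1{i-1}\right)^{1/2}},\quad i=2,\dots,n.$$ Partial sum operator: for $m\in\mathbb N$, $T_m:\mathbb R^m\to C[0,1]$ maps $\mathbf a=(a_1,\dots,a_m)^\top$ to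 the function $$T_m(\mathbf a)(z)=\sum_{i=1}^{[mz]}a_i+(mz-[mz])\,a_{[mz]+1},\quad z\in[0,1],$$ where $[s]=\max\{k\in\mathbb N_0: k\le s\}$ and $\sum_{i=1}^0a_i=0$ (at $z=1$ the second summand is $0$).
   Formalization: Lindeberg's condition on the error array is added: with row laws varying in n the claim fails (errors ±n with probability 1/(2n²) each, else 0, give rejection probability tending to 0). It holds automatically when the error law is the same for all n. *)

theory Defs
  imports "HOL-Probability.Probability"
begin

text \<open>All rows of triangular arrays, observation vectors etc. are functions on \<open>nat\<close>
  of which only the entries with index \<open>1, \<dots>, n\<close> matter.\<close>

definition design_points :: "(nat \<Rightarrow> nat \<Rightarrow> real) \<Rightarrow> bool" where
  "design_points t \<longleftrightarrow>
     (\<forall>n. (\<forall>i\<in>{1..n}. t n i \<in> {0..1}) \<and> (\<forall>i\<in>{1..n}. \<forall>j\<in>{1..n}. i \<le> j \<longrightarrow> t n i \<le> t n j))"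

definition error_array :: "'a measure \<Rightarrow> (nat \<Rightarrow> nat \<Rightarrow> 'a \<Rightarrow> real) \<Rightarrow> bool" where
  "error_array M \<epsilon> \<longleftrightarrow> (\<forall>n.
     prob_space.indep_vars M (\<lambda>_. borel) (\<epsilon> n) {1..n} \<and>
     (\<forall>i\<in>{1..n}. \<forall>j\<in>{1..n}. distr M borel (\<epsilon> n i) = distr M borel (\<epsilon> n j)) \<and>
     (\<forall>i\<in>{1..n}. integrable M (\<epsilon> n i) \<and>
        prob_space.expectation M (\<epsilon> n i) = 0 \<and> prob_space.variance M (\<epsilon> n i) = 1))"

text \<open>Lindeberg's condition for the array. It holds automatically when the law of the
  errors does not depend on the row (lemma \<open>lindeberg_common_law\<close>); for rows whose law varies
  with \<open>n\<close>, mean 0 and variance 1 alone do not yield a central limit theorem.\<close>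

definition lindeberg :: "'a measure \<Rightarrow> (nat \<Rightarrow> nat \<Rightarrow> 'a \<Rightarrow> real) \<Rightarrow> bool" where
  "lindeberg M \<epsilon> \<longleftrightarrow> (\<forall>\<delta>>0.
     (\<lambda>n. let s = sqrt (\<Sum>i=1..n. prob_space.variance M (\<epsilon> n i)) in
        (\<Sum>i=1..n. prob_space.expectation M
           (\<lambda>\<omega>. (\<epsilon> n i \<omega>)\<^sup>2 * indicator {\<omega>. \<bar>\<epsilon> n i \<omega>\<bar> > \<delta> * s} \<omega>)) / s\<^sup>2)
     \<longlonglongrightarrow> 0)"

text \<open>Least squares estimate of \<open>\<beta>\<close> from the first \<open>i\<close> observations \<open>y 1, \<dots>, y i\<close> at the
  design points \<open>s 1, \<dots>, s i\<close>, for the vector \<open>f\<close> of regression functions. If the design matrix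
  is rank deficient, this is an unspecified minimiser.\<close>

definition least_squares ::
  "(real \<Rightarrow> real ^ 'd) \<Rightarrow> (nat \<Rightarrow> real) \<Rightarrow> (nat \<Rightarrow> real) \<Rightarrow> nat \<Rightarrow> real ^ 'd" where
  "least_squares f s y i = arg_min (\<lambda>b. \<Sum>j=1..i. (y j - f (s j) \<bullet> b)\<^sup>2) (\<lambda>_. True)"

text \<open>The matrix \<open>X\<^sup>T X\<close> for the design matrix \<open>X\<close> with rows \<open>f (s 1), \<dots>, f (s i)\<close>.\<close>

definition gram :: "(real \<Rightarrow> real ^ 'd) \<Rightarrow> (nat \<Rightarrow> real) \<Rightarrow> nat \<Rightarrow> real ^ 'd ^ 'd" where
  "gram f s i = (\<chi> k l. \<Sum>j=1..i. f (s j) $ k * f (s j) $ l)"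

text \<open>Meaningful for \<open>i > CARD('d)\<close>.\<close>

definition recursive_residual ::
  "(real \<Rightarrow> real ^ 'd) \<Rightarrow> (nat \<Rightarrow> real) \<Rightarrow> (nat \<Rightarrow> real) \<Rightarrow> nat \<Rightarrow> real" where
  "recursive_residual f s y i =
     (y i - f (s i) \<bullet> least_squares f s y (i - 1)) /
     sqrt (1 + f (s i) \<bullet> (matrix_inv (gram f s (i - 1)) *v f (s i)))"

definition constant_regression :: "real \<Rightarrow> real ^ 1" where
  "constant_regression = (\<lambda>_. vec 1)"

definition partial_sum_op :: "nat \<Rightarrow> (nat \<Rightarrow> real) \<Rightarrow> real \<Rightarrow> real" where
  "partial_sum_op m a z =
     (let k = nat \<lfloor>real m * z\<rfloor> in (\<Sum>i=1..k. a i) + (real m * z - real k) * a (k + 1))"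

text \<open>Residual vector of length \<open>n - 1\<close>: its \<open>i\<close>-th component is the residual with index \<open>i + 1\<close>.\<close>

definition constant_residuals :: "(nat \<Rightarrow> real) \<Rightarrow> (nat \<Rightarrow> real) \<Rightarrow> nat \<Rightarrow> real" where
  "constant_residuals s y i = recursive_residual constant_regression s y (i + 1)"

definition std_normal_quantile :: "real \<Rightarrow> real" where
  "std_normal_quantile p = inv (cdf std_normal_distribution) p"

definition constant_on_unit :: "(real \<Rightarrow> real) \<Rightarrow> bool" where
  "constant_on_unit g \<longleftrightarrow> (\<exists>\<beta>. \<forall>x\<in>{0..1}. g x = \<beta>)"

definition rejects :: "real \<Rightarrow> nat \<Rightarrow> (nat \<Rightarrow> real) \<Rightarrow> (nat \<Rightarrow> real) \<Rightarrow> bool" where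
  "rejects \<alpha> n s y \<longleftrightarrow>
     (\<exists>z\<in>{0..1}. 1 / sqrt (real (n - 1)) * partial_sum_op (n - 1) (constant_residuals s y) z
        < std_normal_quantile (\<alpha> / 2))"

lemma least_squares_constant:
  assumes "i \<ge> 1"
  shows "least_squares constant_regression s y i $ 1 = (\<Sum>j=1..i. y j) / real i"
proof -
  define m where "m = (\<Sum>j=1..i. y j) / real i"
  define F :: "real ^ 1 \<Rightarrow> real"
    where "F = (\<lambda>b. \<Sum>j=1..i. (y j - constant_regression (s j) \<bullet> b)\<^sup>2)"
  have sm: "(\<Sum>j=1..i. y j) = real i * m"
    using assms by (simp add: m_def)
  have F: "F b = F (vec m) + real i * (b $ 1 - m)\<^sup>2" for b
  proof -
    have "F b - F (vec m) = (\<Sum>j=1..i. (m - b $ 1) * (2 * y j - m - b $ 1))"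
      unfolding F_def constant_regression_def
      by (simp add: inner_vec_def flip: sum_subtractf)
         (simp add: power2_eq_square algebra_simps)
    also have "\<dots> = (m - b $ 1) * (2 * (\<Sum>j=1..i. y j) - real i * m - real i * b $ 1)"
      by (simp add: sum_subtractf flip: sum_distrib_left)
    also have "\<dots> = real i * (b $ 1 - m)\<^sup>2"
      unfolding sm by (simp add: power2_eq_square algebra_simps)
    finally show ?thesis by simp
  qed
  have "F (vec m) \<le> F b" for b
    by (subst F[of b]) simp
  then have "is_arg_min F (\<lambda>_. True) (vec m)"
    by (simp add: is_arg_min_linorder)
  then have "is_arg_min F (\<lambda>_. True) (arg_min F (\<lambda>_. True))"
    unfolding arg_min_def by (rule someI)
  then have "F (arg_min F (\<lambda>_. True)) \<le> F (vec m)"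
    by (auto simp: is_arg_min_linorder)
  then have "real i * (arg_min F (\<lambda>_. True) $ 1 - m)\<^sup>2 \<le> 0"
    using F[of "arg_min F (\<lambda>_. True)"] by simp
  then have "arg_min F (\<lambda>_. True) $ 1 = m"
    using assms by (simp add: mult_le_0_iff)
  then show ?thesis
    by (simp add: least_squares_def F_def m_def)
qed

lemma recursive_residual_constant:
  assumes "i \<ge> 2"
  shows "recursive_residual constant_regression s y i =
    (y i - 1 / real (i - 1) * (\<Sum>j=1..i - 1. y j)) / sqrt (1 + 1 / real (i - 1))"
proof -
  have g: "gram constant_regression s (i - 1) = mat (real (i - 1))"
    by (simp add: gram_def constant_regression_def mat_def vec_eq_iff)
  define A B :: "real^1^1" where "A = mat (real (i - 1))" and "B = mat (1 / real (i - 1))"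
  have AB: "A ** B = mat 1" "B ** A = mat 1"
    using assms by (simp_all add: A_def B_def matrix_matrix_mult_def mat_def vec_eq_iff)
  then have "\<exists>A'. A ** A' = mat 1 \<and> A' ** A = mat 1" by blast
  then have "A ** matrix_inv A = mat 1"
    unfolding matrix_inv_def by (rule someI2_ex) simp
  then have "matrix_inv A = B"
    using AB by (metis matrix_mul_assoc matrix_mul_lid matrix_mul_rid)
  moreover have "gram constant_regression s (i - 1) = A"
    using g by (simp add: A_def)
  ultimately have "vec 1 \<bullet> (matrix_inv (gram constant_regression s (i - 1)) *v vec 1)
      = 1 / real (i - 1)"
    by (simp add: B_def inner_vec_def matrix_vector_mult_def mat_def)
  moreover have "vec 1 \<bullet> least_squares constant_regression s y (i - 1)
      = 1 / real (i - 1) * (\<Sum>j=1..i - 1. y j)"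
    using assms least_squares_constant[of "i - 1" s y] by (simp add: inner_vec_def)
  moreover have "constant_regression x = vec 1" for x
    by (simp add: constant_regression_def)
  ultimately show ?thesis
    unfolding recursive_residual_def by (simp only:)
qed

lemma lindeberg_common_law:
  assumes "prob_space M" and "error_array M \<epsilon>"
    and law: "\<And>n i. i \<in> {1..n} \<Longrightarrow> distr M borel (\<epsilon> n i) = \<mu>"
  shows "lindeberg M \<epsilon>"
proof -
  interpret prob_space M by fact
  have rv: "\<epsilon> n i \<in> borel_measurable M" if "i \<in> {1..n}" for n i
    using assms(2) that unfolding error_array_def indep_vars_def2 by auto
  have m0: "expectation (\<epsilon> n i) = 0" and var: "variance (\<epsilon> n i) = 1" if "i \<in> {1..n}" for n i
    using assms(2) that unfolding error_array_def by blast+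
  have borel_law: "sets \<mu> = sets borel"
    using law[of 1 1] by auto
  have tr: "expectation (\<lambda>\<omega>. h (\<epsilon> n i \<omega>)) = (\<integral>x. h x \<partial>\<mu>)"
    if "i \<in> {1..n}" "h \<in> borel_measurable borel" for n i and h :: "real \<Rightarrow> real"
    unfolding law[OF that(1), symmetric] by (rule integral_distr[symmetric, OF rv[OF that(1)] that(2)])
  have sq: "(\<integral>x. x\<^sup>2 \<partial>\<mu>) = 1"
    using tr[of 1 1 "\<lambda>x. x\<^sup>2"] var[of 1 1] m0[of 1 1] by simp
  then have int: "integrable \<mu> (\<lambda>x. x\<^sup>2)"
    using not_integrable_integral_eq by fastforce
  show ?thesis
    unfolding lindeberg_def
  proof (intro allI impI)
    fix \<delta> :: real assume \<delta>: "\<delta> > 0"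
    define L where "L n = (\<integral>x. x\<^sup>2 * indicator {x. \<bar>x\<bar> > \<delta> * sqrt (real n)} x \<partial>\<mu>)" for n :: nat
    have "L \<longlonglongrightarrow> (\<integral>x. 0 \<partial>\<mu>)"
      unfolding L_def
    proof (rule integral_dominated_convergence[where w = "\<lambda>x. x\<^sup>2"])
      show "AE x in \<mu>. (\<lambda>n. x\<^sup>2 * indicator {x. \<bar>x\<bar> > \<delta> * sqrt (real n)} x) \<longlonglongrightarrow> (0 :: real)"
      proof (intro always_eventually allI)
        fix x :: real
        have "filterlim (\<lambda>n. \<delta> * sqrt (real n)) at_top sequentially"
          by (intro filterlim_tendsto_pos_mult_at_top[OF tendsto_const \<delta>]
              filterlim_compose[OF sqrt_at_top] filterlim_real_sequentially)
        then have "eventually (\<lambda>n. \<delta> * sqrt (real n) \<ge> \<bar>x\<bar>) sequentially"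
          by (simp add: filterlim_at_top)
        then have "eventually (\<lambda>n. x\<^sup>2 * indicator {x. \<bar>x\<bar> > \<delta> * sqrt (real n)} x = (0 :: real)) sequentially"
          by eventually_elim auto
        then show "(\<lambda>n. x\<^sup>2 * indicator {x. \<bar>x\<bar> > \<delta> * sqrt (real n)} x) \<longlonglongrightarrow> (0 :: real)"
          by (rule tendsto_eventually)
      qed
    qed (use int in \<open>auto simp: indicator_def measurable_cong_sets[OF borel_law refl]\<close>)
    then have "L \<longlonglongrightarrow> 0" by simp
    moreover have "eventually (\<lambda>n. L n =
        (let s = sqrt (\<Sum>i=1..n. variance (\<epsilon> n i)) in
        (\<Sum>i=1..n. expectation (\<lambda>\<omega>. (\<epsilon> n i \<omega>)\<^sup>2 * indicator {\<omega>. \<bar>\<epsilon> n i \<omega>\<bar> > \<delta> * s} \<omega>)) / s\<^sup>2))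
        sequentially"
      using eventually_gt_at_top[of 0]
    proof eventually_elim
      case (elim n)
      have "expectation (\<lambda>\<omega>. (\<epsilon> n i \<omega>)\<^sup>2 * indicator {\<omega>. \<bar>\<epsilon> n i \<omega>\<bar> > \<delta> * sqrt (real n)} \<omega>) = L n"
        if "i \<in> {1..n}" for i
        using tr[OF that, of "\<lambda>x. x\<^sup>2 * indicator {x. \<bar>x\<bar> > \<delta> * sqrt (real n)} x"]
        by (simp add: L_def indicator_def)
      then show ?case using elim var by (simp add: Let_def)
    qed
    ultimately show "(\<lambda>n. let s = sqrt (\<Sum>i=1..n. variance (\<epsilon> n i)) in
        (\<Sum>i=1..n. expectation (\<lambda>\<omega>. (\<epsilon> n i \<omega>)\<^sup>2 * indicator {\<omega>. \<bar>\<epsilon> n i \<omega>\<bar> > \<delta> * s} \<omega>)) / s\<^sup>2) \<longlonglongrightarrow> 0"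
      by (rule Lim_transform_eventually)
  qed
qed

lemma std_normal_quantile:
  assumes "p \<in> {0<..<1}"
  shows "cdf std_normal_distribution (std_normal_quantile p) = p"
proof -
  interpret real_distribution std_normal_distribution by (rule real_dist_normal_dist)
  have "isCont (cdf std_normal_distribution) x" for x
    unfolding isCont_cdf by (simp add: measure_def emeasure_density nn_integral_null_set)
  moreover have "eventually (\<lambda>x. cdf std_normal_distribution x > p) at_top"
    using cdf_lim_at_top_prob assms by (auto dest: order_tendstoD)
  then obtain b where "cdf std_normal_distribution b > p"
    by (auto dest: eventually_happens)
  moreover have "eventually (\<lambda>x. cdf std_normal_distribution x < p) at_bot"
    using cdf_lim_at_bot assms by (auto dest: order_tendstoD)
  then obtain a where "cdf std_normal_distribution a < p"
    by (auto dest: eventually_happens)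
  ultimately have "\<exists>x. cdf std_normal_distribution x = p"
    using IVT[of "cdf std_normal_distribution" a p b] cdf_nondecreasing[of b a]
    by (metis less_eq_real_def linorder_le_cases order_less_trans not_less)
  then show ?thesis
    unfolding std_normal_quantile_def by (metis f_inv_into_f rangeI)
qed

end

theory Submission
  imports Defs
begin

text \<open>Up to the factor \<open>1 / sqrt (n - 1)\<close> and a sign, the residual partial sums \<open>W\<close> form a linear
  image of the errors with coefficients of order \<open>(1 + log (n / i)) / sqrt n\<close>. Lindeberg's
  replacement method therefore allows Gaussian errors to be substituted as far as the values of
  \<open>W\<close> on a fixed grid of \<open>m\<close> points are concerned. For Gaussian errors the residuals are again
  iid Gaussian (Helmert's transformation), so Levy's reflection inequalities give
  \<open>P (max W > b)\<close> on the grid as \<open>2 (1 - \<Phi> b)\<close> up to an error vanishing as \<open>m \<rightarrow> \<infinity>\<close>. The maximum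
  over all times dominates the maximum over the grid, and the reverse comparison is Ottaviani's
  stopping argument: an increment of \<open>W\<close> within a block splits into an independent sum and a
  drift made of running means, and second moments control both.\<close>

section \<open>Recursive residuals of Gaussian errors\<close>

text \<open>For non-Gaussian errors the residuals are uncorrelated but in general dependent, so no
  invariance principle for independent summands applies to \<open>W\<close> itself. The errors do
  stay independent, which is why they are exchanged one at a time. The cost of an exchange is
  exponential in the number of grid points, so the grid must stay fixed while n grows, and the
  passage to all times needs a bound uniform in n. Plain Ottaviani is blocked there: an increment
  after time k still depends on the past through the running means. The drift is therefore kept out
  of the stopping argument and bounded by absolute values over a whole block. Some coefficients
  exceed the usual order n^(-1/2) by a logarithm, but their squares sum to O(1) and their cubes to
  O(n^(-1/2)), as for an ordinary partial sum, and a third-order Taylor expansion needs nothing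
  more. The sign of \<open>W\<close> turns the lower crossing of the test into an upper crossing of
  the level b > 0 with \<Phi>(-b) = \<alpha>/2, for which 2 (1 - \<Phi> b) = \<alpha>.\<close>

lemma nn_integral_lborel_shear:
  fixes h :: "real \<times> real \<Rightarrow> ennreal"
  assumes [measurable]: "h \<in> borel_measurable (borel \<Otimes>\<^sub>M borel)"
  shows "(\<integral>\<^sup>+y. \<integral>\<^sup>+z. h (z + a * y, y) \<partial>lborel \<partial>lborel) = (\<integral>\<^sup>+y. \<integral>\<^sup>+z. h (z, y) \<partial>lborel \<partial>lborel)"
proof (rule nn_integral_cong)
  fix y
  have "(\<integral>\<^sup>+z. h (z, y) \<partial>lborel) = (\<integral>\<^sup>+z. h (a * y + 1 * z, y) \<partial>lborel)"
    by (subst nn_integral_real_affine[where c = 1 and t = "a * y"]) simp_all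
  then show "(\<integral>\<^sup>+z. h (z + a * y, y) \<partial>lborel) = (\<integral>\<^sup>+z. h (z, y) \<partial>lborel)"
    by (simp add: add.commute)
qed

lemma nn_integral_lborel_shear':
  fixes h :: "real \<times> real \<Rightarrow> ennreal"
  assumes [measurable]: "h \<in> borel_measurable (borel \<Otimes>\<^sub>M borel)"
  shows "(\<integral>\<^sup>+y. \<integral>\<^sup>+z. h (z, y + a * z) \<partial>lborel \<partial>lborel) = (\<integral>\<^sup>+y. \<integral>\<^sup>+z. h (z, y) \<partial>lborel \<partial>lborel)"
proof -
  have sw: "(\<integral>\<^sup>+y. \<integral>\<^sup>+z. k (z, y) \<partial>lborel \<partial>lborel) = (\<integral>\<^sup>+z. \<integral>\<^sup>+y. k (z, y) \<partial>lborel \<partial>lborel)"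
    if [measurable]: "k \<in> borel_measurable (borel \<Otimes>\<^sub>M borel)" for k :: "real \<times> real \<Rightarrow> ennreal"
    by (rule lborel_pair.Fubini') simp
  have "(\<integral>\<^sup>+z. \<integral>\<^sup>+y. h (z, y + a * z) \<partial>lborel \<partial>lborel) = (\<integral>\<^sup>+z. \<integral>\<^sup>+y. h (z, y) \<partial>lborel \<partial>lborel)"
    using nn_integral_lborel_shear[of "\<lambda>(z, y). h (y, z)" a] by simp
  then show ?thesis
    using sw[of h] sw[of "\<lambda>(z, y). h (z, y + a * z)"] by simp
qed

text \<open>A rotation is a product of three shears.\<close>

lemma nn_integral_lborel_rotation:
  fixes h :: "real \<times> real \<Rightarrow> ennreal"
  assumes [measurable]: "h \<in> borel_measurable (borel \<Otimes>\<^sub>M borel)"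
    and "c\<^sup>2 + s\<^sup>2 = 1" "s \<noteq> 0"
  shows "(\<integral>\<^sup>+y. \<integral>\<^sup>+z. h (c * z + s * y, c * y - s * z) \<partial>lborel \<partial>lborel)
    = (\<integral>\<^sup>+y. \<integral>\<^sup>+z. h (z, y) \<partial>lborel \<partial>lborel)"
proof -
  \<comment> \<open>\<open>a\<close> is the tangent of half the rotation angle. The two outer shears
    have slope \<open>a\<close>, the middle one has slope \<open>-s\<close>.\<close>
  define a where "a = (1 - c) / s"
  have c: "c = 1 - a * s" using assms by (simp add: a_def)
  have s: "s = a * (1 - a * s) + a"
    using assms by (simp add: a_def field_simps power2_eq_square)
  define h1 where "h1 = (\<lambda>(z, y). h (z + a * y, y))"
  define h2 where "h2 = (\<lambda>(z, y). h1 (z, y + (- s) * z))"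
  have [measurable]: "h1 \<in> borel_measurable (borel \<Otimes>\<^sub>M borel)" "h2 \<in> borel_measurable (borel \<Otimes>\<^sub>M borel)"
    unfolding h1_def h2_def by measurable
  have "h (c * z + s * y, c * y - s * z) = h2 (z + a * y, y)" for z y
  proof -
    have 1: "y + (- s) * (z + a * y) = c * y - s * z"
      unfolding c by (simp add: algebra_simps)
    have "z + a * y + a * (c * y - s * z) = c * z + (a * (1 - a * s) + a) * y"
      unfolding c by (simp add: algebra_simps)
    then have 2: "z + a * y + a * (c * y - s * z) = c * z + s * y"
      using s by simp
    show ?thesis by (simp add: h1_def h2_def 1[simplified] 2)
  qed
  then show ?thesis
    using nn_integral_lborel_shear[of h2 a] nn_integral_lborel_shear'[of h1 "-s"]
      nn_integral_lborel_shear[of h a] by (simp add: h1_def h2_def)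
qed

text \<open>The product density depends only on the sum of the squares of its arguments, and
  rotations preserve Lebesgue measure. Iterated integrals are used because the induction for the
  Helmert vector peels off single coordinates.\<close>

lemma std_normal_rotation:
  fixes h :: "real \<times> real \<Rightarrow> ennreal"
  assumes [measurable]: "h \<in> borel_measurable (borel \<Otimes>\<^sub>M borel)"
    and cs: "c\<^sup>2 + s\<^sup>2 = 1" "s \<noteq> 0"
  shows "(\<integral>\<^sup>+y. \<integral>\<^sup>+z. h (c * z + s * y, c * y - s * z)
      \<partial>std_normal_distribution \<partial>std_normal_distribution)
    = (\<integral>\<^sup>+y. \<integral>\<^sup>+z. h (z, y) \<partial>std_normal_distribution \<partial>std_normal_distribution)"
proof -
  define d where "d = (\<lambda>(z, y). ennreal (std_normal_density z * std_normal_density y))"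
  have d: "d (c * z + s * y, c * y - s * z) = d (z, y)" for z y
  proof -
    have "(c * z + s * y)\<^sup>2 + (c * y - s * z)\<^sup>2 = (c\<^sup>2 + s\<^sup>2) * (z\<^sup>2 + y\<^sup>2)"
      by (simp add: power2_eq_square algebra_simps)
    then have "- (c * z + s * y)\<^sup>2 / 2 + - (c * y - s * z)\<^sup>2 / 2 = - z\<^sup>2 / 2 + - y\<^sup>2 / 2"
      using cs by (simp add: field_simps)
    then show ?thesis
      unfolding d_def std_normal_density_def by (simp add: mult_exp_exp)
  qed
  have [measurable]: "d \<in> borel_measurable (borel \<Otimes>\<^sub>M borel)"
    unfolding d_def by measurable
  have eq: "(\<integral>\<^sup>+y. \<integral>\<^sup>+z. k (z, y) \<partial>std_normal_distribution \<partial>std_normal_distribution)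
    = (\<integral>\<^sup>+y. \<integral>\<^sup>+z. d (z, y) * k (z, y) \<partial>lborel \<partial>lborel)"
    if [measurable]: "k \<in> borel_measurable (borel \<Otimes>\<^sub>M borel)" for k :: "real \<times> real \<Rightarrow> ennreal"
  proof -
    have "(\<integral>\<^sup>+y. \<integral>\<^sup>+z. k (z, y) \<partial>std_normal_distribution \<partial>std_normal_distribution)
      = (\<integral>\<^sup>+y. std_normal_density y * (\<integral>\<^sup>+z. std_normal_density z * k (z, y) \<partial>lborel) \<partial>lborel)"
      by (subst nn_integral_density; simp add: nn_integral_density)
    also have "\<dots> = (\<integral>\<^sup>+y. \<integral>\<^sup>+z. d (z, y) * k (z, y) \<partial>lborel \<partial>lborel)"
      by (simp add: d_def nn_integral_cmult[symmetric] ennreal_mult mult_ac)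
    finally show ?thesis .
  qed
  show ?thesis
    using eq[of "\<lambda>(z, y). h (c * z + s * y, c * y - s * z)"] eq[of h]
      nn_integral_lborel_rotation[of "\<lambda>p. d p * h p", OF _ cs] by (simp add: d)
qed

section \<open>Helmert's transformation\<close>

text \<open>\<open>std_residual x i\<close> is the recursive residual with index \<open>i + 1\<close>.\<close>

definition std_residual :: "(nat \<Rightarrow> real) \<Rightarrow> nat \<Rightarrow> real" where
  "std_residual x i = sqrt (real i / real (i + 1)) * (x (i + 1) - (\<Sum>j=1..i. x j) / real i)"

text \<open>Carrying the normalised sum as entry 0, one more variable only rotates this entry against
  the new one.\<close>

definition helmert :: "nat \<Rightarrow> (nat \<Rightarrow> real) \<Rightarrow> nat \<Rightarrow> real" where
  "helmert n x = (\<lambda>i\<in>{0..n}. if i = 0 then (\<Sum>j=1..n + 1. x j) / sqrt (real (n + 1)) else std_residual x i)"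

abbreviation std_normal_PiM :: "nat set \<Rightarrow> (nat \<Rightarrow> real) measure" where
  "std_normal_PiM I \<equiv> PiM I (\<lambda>_. std_normal_distribution)"

lemma prob_space_std_normal: "prob_space std_normal_distribution"
  by (rule prob_space_normal_density) simp

lemma measurable_std_residual [measurable]:
  assumes "i + 1 \<in> I" "{1..i} \<subseteq> I" "\<And>j. sets (N j) = sets borel"
  shows "(\<lambda>x. std_residual x i) \<in> borel_measurable (PiM I N)"
proof -
  have [measurable]: "(\<lambda>x. x j) \<in> borel_measurable (PiM I N)" if "j \<in> I" for j
    using measurable_component_singleton[OF that, of N] assms(3) measurable_cong_sets by blast
  show ?thesis unfolding std_residual_def
    using assms by (intro borel_measurable_times borel_measurable_diff borel_measurable_divide
        borel_measurable_sum borel_measurable_const) auto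
qed

lemma measurable_helmert:
  "helmert n \<in> measurable (std_normal_PiM {1..n + 1}) (std_normal_PiM {0..n})"
proof -
  have "(\<lambda>x. \<lambda>i\<in>{0..n}. if i = 0 then (\<Sum>j=1..n + 1. x j) / sqrt (real (n + 1)) else std_residual x i)
      \<in> measurable (std_normal_PiM {1..n + 1}) (std_normal_PiM {0..n})"
  proof (rule measurable_restrict)
    fix i assume "i \<in> {0..n}"
    have m: "(\<lambda>x. x j) \<in> borel_measurable (std_normal_PiM {1..n + 1})" if "j \<in> {1..n + 1}" for j
      using measurable_component_singleton[OF that, of "\<lambda>_. std_normal_distribution"] by simp
    show "(\<lambda>x. if i = 0 then (\<Sum>j=1..n + 1. x j) / sqrt (real (n + 1)) else std_residual x i)
        \<in> std_normal_PiM {1..n + 1} \<rightarrow>\<^sub>M std_normal_distribution"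
      using \<open>i \<in> {0..n}\<close> m by (cases "i = 0")
        (auto intro!: borel_measurable_divide borel_measurable_sum measurable_std_residual)
  qed
  then show ?thesis unfolding helmert_def[abs_def] .
qed

lemma std_residual_upd: "j > i + 1 \<Longrightarrow> std_residual (x(j := y)) i = std_residual x i"
  by (simp add: std_residual_def)

text \<open>Here c^2 + s^2 = 1, and the normalising factor in \<open>std_residual\<close> is exactly
  the one for which the new residual is the second row of the rotation whose first row updates the
  normalised sum.\<close>

lemma helmert_Suc:
  fixes n :: nat
  defines "c \<equiv> sqrt (real (n + 1) / real (n + 2))" and "s \<equiv> 1 / sqrt (real (n + 2))"
  defines "z \<equiv> (\<lambda>x. helmert n x 0)"
  shows "helmert (n + 1) (x(n + 2 := y))
    = (helmert n x)(0 := c * z x + s * y, n + 1 := c * y - s * z x)"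
proof
  fix i
  have S: "(\<Sum>j=1..n + 1. (x(n + 2 := y)) j) = (\<Sum>j=1..n + 1. x j)"
    by (rule sum.cong) auto
  have z: "z x = (\<Sum>j=1..n + 1. x j) / sqrt (real (n + 1))"
    by (simp add: z_def helmert_def)
  consider "i = 0" | "i = n + 1" | "i \<noteq> 0" "i \<noteq> n + 1" by blast
  then show "helmert (n + 1) (x(n + 2 := y)) i
      = ((helmert n x)(0 := c * z x + s * y, n + 1 := c * y - s * z x)) i"
  proof cases
    case 1
    have "(\<Sum>j=1..n + 2. (x(n + 2 := y)) j) = (\<Sum>j=1..n + 1. x j) + y"
      using S by simp
    moreover have "c * z x = (\<Sum>j=1..n + 1. x j) / sqrt (real (n + 2))"
      by (simp add: c_def z real_sqrt_divide)
    ultimately show ?thesis using 1 by (simp add: helmert_def s_def add_divide_distrib)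
  next
    case 2
    have "c * ((\<Sum>j=1..n + 1. x j) / real (n + 1)) = s * z x"
    proof -
      define q where "q = sqrt (real (n + 1))"
      have "real (n + 1) = q * q" "q > 0" by (simp_all add: q_def)
      then show ?thesis
        unfolding c_def s_def z real_sqrt_divide q_def[symmetric] by simp
    qed
    then show ?thesis using 2 S
      by (simp add: helmert_def std_residual_def c_def algebra_simps)
  next
    case 3
    then show ?thesis by (auto simp: helmert_def std_residual_upd)
  qed
qed

text \<open>The newest variable is integrated outermost. For each of its values the induction
  hypothesis, which is needed for varying \<open>f\<close>, turns the older variables into a
  Gaussian Helmert vector; what then remains is a planar rotation of entry 0 against the new
  variable.\<close>

lemma nn_integral_helmert:
  assumes "f \<in> borel_measurable (std_normal_PiM {0..n})"
  shows "(\<integral>\<^sup>+x. f (helmert n x) \<partial>std_normal_PiM {1..n + 1}) = (\<integral>\<^sup>+x. f x \<partial>std_normal_PiM {0..n})"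
  using assms
proof (induction n arbitrary: f)
  case 0
  interpret product_sigma_finite "\<lambda>_::nat. std_normal_distribution"
    by (intro product_sigma_finite.intro prob_space_imp_sigma_finite prob_space_std_normal)
  define g where "g y = f (\<lambda>i\<in>{0}. y)" for y
  have [measurable]: "(\<lambda>y. \<lambda>i\<in>{0::nat}. y) \<in> measurable borel (std_normal_PiM {0})"
    by (rule measurable_restrict) simp
  have f[measurable]: "f \<in> borel_measurable (std_normal_PiM {0})"
    using 0 by simp
  have g[measurable]: "g \<in> borel_measurable borel"
    unfolding g_def by measurable
  have "(\<integral>\<^sup>+x. f (helmert 0 x) \<partial>std_normal_PiM {1..0 + 1}) = (\<integral>\<^sup>+x. g (x 1) \<partial>std_normal_PiM {1})"
    by (simp add: g_def helmert_def cong: restrict_cong)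
  also have "\<dots> = (\<integral>\<^sup>+y. g y \<partial>std_normal_distribution)"
    by (rule product_nn_integral_singleton) simp
  also have "\<dots> = (\<integral>\<^sup>+x. g (x 0) \<partial>std_normal_PiM {0})"
    by (rule product_nn_integral_singleton[symmetric]) simp
  also have "\<dots> = (\<integral>\<^sup>+x. f x \<partial>std_normal_PiM {0})"
  proof (rule nn_integral_cong)
    fix x assume "x \<in> space (std_normal_PiM {0::nat})"
    then have "x = (\<lambda>i\<in>{0}. x 0)"
      by (auto simp: space_PiM PiE_def extensional_def restrict_def)
    then show "g (x 0) = f x" unfolding g_def by simp
  qed
  finally show ?case by simp
next
  case (Suc n)
  interpret product_sigma_finite "\<lambda>_::nat. std_normal_distribution"
    by (intro product_sigma_finite.intro prob_space_imp_sigma_finite prob_space_std_normal)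
  let ?\<nu> = "std_normal_distribution"
  define c s where "c = sqrt (real (n + 1) / real (n + 2))" and "s = 1 / sqrt (real (n + 2))"
  have cs: "c\<^sup>2 + s\<^sup>2 = 1" "s \<noteq> 0"
    by (simp_all add: c_def s_def power_divide divide_simps)
  have sets: "{1..n + 2} = insert (n + 2) {1..n + 1}" "{0..n} = insert 0 {1..n}"
    "{0..n + 1} = insert (n + 1) (insert 0 {1..n})" by auto
  have f[measurable]: "f \<in> borel_measurable (std_normal_PiM {0..n + 1})"
    using Suc.prems by simp
  have upd: "(\<lambda>(x, y). x(i := y)) \<in> measurable (std_normal_PiM I \<Otimes>\<^sub>M ?\<nu>) (std_normal_PiM (insert i I))"
    for i I by (rule measurable_add_dim)
  \<comment> \<open>The integrand as a function of the old Helmert vector \<open>w\<close>, with the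
    newest variable frozen at \<open>y\<close>; the induction hypothesis is applied to
    \<open>K y\<close>.\<close>
  define K where "K y w = f (w(0 := c * w 0 + s * y, n + 1 := c * y - s * w 0))" for y w
  have K: "K y \<in> borel_measurable (std_normal_PiM {0..n})" for y
  proof -
    have w0[measurable]: "(\<lambda>w. w 0) \<in> borel_measurable (std_normal_PiM {0..n})"
      using measurable_component_singleton[of 0 "{0..n}" "\<lambda>_. ?\<nu>"] by simp
    have "(\<lambda>w. w(0 := c * w 0 + s * y)) \<in> measurable (std_normal_PiM {0..n}) (std_normal_PiM {0..n})"
      by (rule measurable_fun_upd[where J = "{0..n}"]) auto
    then have "(\<lambda>w. w(0 := c * w 0 + s * y, n + 1 := c * y - s * w 0))
        \<in> measurable (std_normal_PiM {0..n}) (std_normal_PiM {0..n + 1})"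
      by (rule measurable_fun_upd[rotated]) auto
    then show ?thesis using f unfolding K_def by (rule measurable_compose)
  qed
  \<comment> \<open>With the entries 1 to n integrated out, only the two coordinates that the
    rotation mixes are left.\<close>
  define g where "g = (\<lambda>(z, y). \<integral>\<^sup>+w. f (w(0 := z, n + 1 := y)) \<partial>std_normal_PiM {1..n})"
  have m2: "(\<lambda>((z, y), w). w(0 := z, n + 1 := y))
      \<in> measurable ((borel \<Otimes>\<^sub>M borel) \<Otimes>\<^sub>M std_normal_PiM {1..n}) (std_normal_PiM {0..n + 1})"
  proof -
    have "(\<lambda>p. (snd p)(0 := fst (fst p)))
      \<in> measurable ((borel \<Otimes>\<^sub>M borel) \<Otimes>\<^sub>M std_normal_PiM {1..n}) (std_normal_PiM (insert 0 {1..n}))"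
      by (rule measurable_fun_upd[where J = "{1..n}"]) auto
    then have "(\<lambda>p. ((snd p)(0 := fst (fst p)))(n + 1 := snd (fst p)))
      \<in> measurable ((borel \<Otimes>\<^sub>M borel) \<Otimes>\<^sub>M std_normal_PiM {1..n}) (std_normal_PiM {0..n + 1})"
      by (rule measurable_fun_upd[rotated]) (measurable, auto)
    then show ?thesis by (simp add: split_beta')
  qed
  have fin: "sigma_finite_measure (std_normal_PiM {1..n})"
    by (rule sigma_finite) simp
  have g[measurable]: "g \<in> borel_measurable (borel \<Otimes>\<^sub>M borel)"
    unfolding g_def case_prod_beta'
    apply (rule sigma_finite_measure.borel_measurable_nn_integral[OF fin])
    using measurable_compose[OF m2 f] by (simp add: split_beta')
  have H: "(\<lambda>x. f (helmert (n + 1) x)) \<in> borel_measurable (std_normal_PiM {1..n + 2})"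
    using measurable_compose[OF measurable_helmert[of "n + 1"] f] by simp
  have "(\<integral>\<^sup>+x. f (helmert (n + 1) x) \<partial>std_normal_PiM {1..n + 2})
    = (\<integral>\<^sup>+y. \<integral>\<^sup>+x. f (helmert (n + 1) (x(n + 2 := y))) \<partial>std_normal_PiM {1..n + 1} \<partial>?\<nu>)"
    unfolding sets(1) by (rule product_nn_integral_insert_rev[OF _ _ H[unfolded sets(1)]]) simp_all
  also have "\<dots> = (\<integral>\<^sup>+y. \<integral>\<^sup>+w. K y w \<partial>std_normal_PiM {0..n} \<partial>?\<nu>)"
  proof (rule nn_integral_cong)
    fix y
    have "(\<integral>\<^sup>+x. f (helmert (n + 1) (x(n + 2 := y))) \<partial>std_normal_PiM {1..n + 1})
      = (\<integral>\<^sup>+x. K y (helmert n x) \<partial>std_normal_PiM {1..n + 1})"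
      unfolding c_def s_def helmert_Suc K_def ..
    also have "\<dots> = (\<integral>\<^sup>+w. K y w \<partial>std_normal_PiM {0..n})"
      by (rule Suc.IH) (rule K)
    finally show "(\<integral>\<^sup>+x. f (helmert (n + 1) (x(n + 2 := y))) \<partial>std_normal_PiM {1..n + 1}) = \<dots>" .
  qed
  also have "\<dots> = (\<integral>\<^sup>+y. \<integral>\<^sup>+z. g (c * z + s * y, c * y - s * z) \<partial>?\<nu> \<partial>?\<nu>)"
  proof (rule nn_integral_cong)
    fix y
    have "(\<integral>\<^sup>+w. K y w \<partial>std_normal_PiM {0..n}) = (\<integral>\<^sup>+z. \<integral>\<^sup>+w. K y (w(0 := z)) \<partial>std_normal_PiM {1..n} \<partial>?\<nu>)"
      unfolding sets(2) by (rule product_nn_integral_insert_rev) (use K[of y] in \<open>auto simp: sets(2)\<close>)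
    then show "(\<integral>\<^sup>+w. K y w \<partial>std_normal_PiM {0..n}) = (\<integral>\<^sup>+z. g (c * z + s * y, c * y - s * z) \<partial>?\<nu>)"
      by (simp add: K_def g_def)
  qed
  also have "\<dots> = (\<integral>\<^sup>+y. \<integral>\<^sup>+z. g (z, y) \<partial>?\<nu> \<partial>?\<nu>)"
    by (rule std_normal_rotation[OF g cs])
  also have "\<dots> = (\<integral>\<^sup>+y. \<integral>\<^sup>+w. f (w(n + 1 := y)) \<partial>std_normal_PiM {0..n} \<partial>?\<nu>)"
  proof (rule nn_integral_cong)
    fix y
    have "(\<lambda>w. w(n + 1 := y)) \<in> measurable (std_normal_PiM {0..n}) (std_normal_PiM {0..n + 1})"
      by (rule measurable_fun_upd[where J = "{0..n}"]) auto
    then have m: "(\<lambda>w. f (w(n + 1 := y))) \<in> borel_measurable (std_normal_PiM (insert 0 {1..n}))"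
      using f unfolding sets(2)[symmetric] by (rule measurable_compose)
    show "(\<integral>\<^sup>+z. g (z, y) \<partial>?\<nu>) = (\<integral>\<^sup>+w. f (w(n + 1 := y)) \<partial>std_normal_PiM {0..n})"
      unfolding sets(2) by (subst product_nn_integral_insert_rev[OF _ _ m]) (simp_all add: g_def)
  qed
  also have "\<dots> = (\<integral>\<^sup>+w. f w \<partial>std_normal_PiM {0..n + 1})"
    using product_nn_integral_insert_rev[of "{0..n}" "n + 1" f] f
    unfolding sets(3) sets(2)[symmetric] by simp
  finally show ?case by simp
qed


lemma helmert_law:
  "distr (std_normal_PiM {1..n + 1}) (std_normal_PiM {0..n}) (helmert n) = std_normal_PiM {0..n}"
proof (rule measure_eqI)
  fix A assume "A \<in> sets (distr (std_normal_PiM {1..n + 1}) (std_normal_PiM {0..n}) (helmert n))"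
  then have A[measurable]: "A \<in> sets (std_normal_PiM {0..n})" by simp
  have "(\<integral>\<^sup>+x. indicator A (helmert n x) \<partial>std_normal_PiM {1..n + 1})
      = (\<integral>\<^sup>+x. indicator A x \<partial>std_normal_PiM {0..n})"
    by (rule nn_integral_helmert) measurable
  also have "(\<integral>\<^sup>+x. indicator A (helmert n x) \<partial>std_normal_PiM {1..n + 1})
      = (\<integral>\<^sup>+x. indicator A x \<partial>distr (std_normal_PiM {1..n + 1}) (std_normal_PiM {0..n}) (helmert n))"
    by (subst nn_integral_distr[OF measurable_helmert]) simp_all
  finally show "emeasure (distr (std_normal_PiM {1..n + 1}) (std_normal_PiM {0..n}) (helmert n)) A
      = emeasure (std_normal_PiM {0..n}) A" by simp
qed simp

lemma prob_space_std_normal_PiM: "prob_space (std_normal_PiM I)"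
  by (intro prob_space_PiM prob_space_std_normal)

text \<open>Entry 0 is dropped from the Helmert vector, whose law is a product of standard normal
  laws. Since the first observation has no residual, n + 1 errors give n residuals.\<close>

lemma std_residual_std_normal:
  fixes n :: nat
  defines "P \<equiv> std_normal_PiM {1..n + 1}"
  shows "prob_space.indep_vars P (\<lambda>_. borel) (\<lambda>i x. std_residual x i) {1..n}"
    and "i \<in> {1..n} \<Longrightarrow> distributed P lborel (\<lambda>x. std_residual x i) std_normal_density"
proof -
  interpret prob_space P unfolding P_def by (rule prob_space_std_normal_PiM)
  have m: "(\<lambda>x. helmert n x i) \<in> borel_measurable P" if "i \<in> {0..n}" for i
    using measurable_compose[OF measurable_helmert[of n] measurable_component_singleton[OF that]]
    unfolding P_def by simp
  have marg: "distr P borel (\<lambda>x. helmert n x i) = std_normal_distribution" if "i \<in> {0..n}" for i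
  proof -
    have "distr P std_normal_distribution (\<lambda>x. helmert n x i)
      = distr (distr P (std_normal_PiM {0..n}) (helmert n)) std_normal_distribution (\<lambda>x. x i)"
      using measurable_helmert[of n] that unfolding P_def by (subst distr_distr) (simp_all add: comp_def)
    also have "\<dots> = std_normal_distribution"
      unfolding P_def helmert_law
      using that by (intro distr_PiM_component prob_space_std_normal) simp_all
    finally show ?thesis by (simp cong: distr_cong)
  qed
  have "restrict (helmert n x) {0..n} = helmert n x" for x
    by (auto simp: helmert_def fun_eq_iff)
  then have "distr P (PiM {0..n} (\<lambda>_. borel)) (\<lambda>x. \<lambda>i\<in>{0..n}. helmert n x i)
      = distr P (std_normal_PiM {0..n}) (helmert n)"
    by (intro distr_cong refl) (auto intro!: sets_PiM_cong)
  also have "\<dots> = PiM {0..n} (\<lambda>i. distr P borel (\<lambda>x. helmert n x i))"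
    unfolding P_def helmert_law unfolding P_def[symmetric] by (rule PiM_cong) (simp_all add: marg)
  finally have "indep_vars (\<lambda>_. borel) (\<lambda>i x. helmert n x i) {0..n}"
    using m by (subst indep_vars_iff_distr_eq_PiM') auto
  then have "indep_vars (\<lambda>_. borel) (\<lambda>i x. helmert n x i) {1..n}"
    by (rule indep_vars_subset) auto
  moreover have h: "helmert n x i = std_residual x i" if "i \<in> {1..n}" for i x
    using that by (simp add: helmert_def)
  ultimately show "indep_vars (\<lambda>_. borel) (\<lambda>i x. std_residual x i) {1..n}"
    by (subst indep_vars_cong[OF refl _ refl]) (auto simp: h)
  show "distributed P lborel (\<lambda>x. std_residual x i) std_normal_density" if "i \<in> {1..n}"
    using marg[of i] m[of i] that unfolding distributed_def
    by (simp add: h cong: distr_cong)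
qed

section \<open>First passage and reflection inequalities\<close>

text \<open>Independence in the form used by the stopping arguments: \<open>P\<close> and
  \<open>Q\<close> are predicates on whole sequences, and \<open>PA\<close>, \<open>QB\<close> say
  that they read only the coordinates in \<open>A\<close> and \<open>B\<close>, so no restrictions
  appear in the conclusion.\<close>

lemma (in prob_space) indep_vars_prob_conj:
  fixes X :: "nat \<Rightarrow> 'a \<Rightarrow> real"
  assumes X: "indep_vars (\<lambda>_. borel) X I" and AB: "A \<inter> B = {}" "A \<subseteq> I" "B \<subseteq> I"
    and P: "Measurable.pred (PiM A (\<lambda>_. borel)) P" and Q: "Measurable.pred (PiM B (\<lambda>_. borel)) Q"
    and PA: "\<And>x. P (restrict x A) = P x" and QB: "\<And>x. Q (restrict x B) = Q x"
  shows "prob {\<omega> \<in> space M. P (\<lambda>i. X i \<omega>) \<and> Q (\<lambda>i. X i \<omega>)}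
    = prob {\<omega> \<in> space M. P (\<lambda>i. X i \<omega>)} * prob {\<omega> \<in> space M. Q (\<lambda>i. X i \<omega>)}"
proof -
  have sub: "(\<lambda>\<omega>. restrict (\<lambda>i. X i \<omega>) C) \<in> measurable M (PiM C (\<lambda>_. borel))" if "C \<subseteq> I" for C
    using X that by (intro measurable_restrict) (auto simp: indep_vars_def)
  let ?P = "{x \<in> space (PiM A (\<lambda>_. borel)). P x}" and ?Q = "{x \<in> space (PiM B (\<lambda>_. borel)). Q x}"
  have e: "(\<lambda>\<omega>. restrict (\<lambda>i. X i \<omega>) A) -` ?P \<inter> space M = {\<omega> \<in> space M. P (\<lambda>i. X i \<omega>)}"
    "(\<lambda>\<omega>. restrict (\<lambda>i. X i \<omega>) B) -` ?Q \<inter> space M = {\<omega> \<in> space M. Q (\<lambda>i. X i \<omega>)}"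
    using measurable_space[OF sub[OF AB(2)]] measurable_space[OF sub[OF AB(3)]] by (auto simp: PA QB)
  have "prob ((\<lambda>\<omega>. (restrict (\<lambda>i. X i \<omega>) A, restrict (\<lambda>i. X i \<omega>) B)) -` (?P \<times> ?Q) \<inter> space M)
    = prob ((\<lambda>\<omega>. restrict (\<lambda>i. X i \<omega>) A) -` ?P \<inter> space M) * prob ((\<lambda>\<omega>. restrict (\<lambda>i. X i \<omega>) B) -` ?Q \<inter> space M)"
    using P Q by (intro indep_varD[OF indep_var_restrict[OF X AB]]) (auto simp: pred_def)
  also have "(\<lambda>\<omega>. (restrict (\<lambda>i. X i \<omega>) A, restrict (\<lambda>i. X i \<omega>) B)) -` (?P \<times> ?Q) \<inter> space M
    = ((\<lambda>\<omega>. restrict (\<lambda>i. X i \<omega>) A) -` ?P \<inter> space M) \<inter> ((\<lambda>\<omega>. restrict (\<lambda>i. X i \<omega>) B) -` ?Q \<inter> space M)"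
    by auto
  finally show ?thesis
    unfolding e by (simp add: Collect_conj_eq[symmetric] Int_def conj_ac cong: conj_cong)
qed

text \<open>A relation in \<open>k\<close> instead of a stopping time: its events for different k >=
  1 are disjoint, and each is decided by the path up to time \<open>k\<close>.\<close>

definition first_passage :: "(nat \<Rightarrow> real) \<Rightarrow> real \<Rightarrow> nat \<Rightarrow> bool" where
  "first_passage w b k \<longleftrightarrow> w k > b \<and> (\<forall>j\<in>{1..<k}. w j \<le> b)"

lemma ex_first_passage:
  "(\<exists>k\<in>{1..K}. w k > b) \<longleftrightarrow> (\<exists>k\<in>{1..K}. first_passage w b k)"
proof
  assume "\<exists>k\<in>{1..K}. w k > b"
  then obtain k where k: "k \<in> {1..K} \<and> w k > b" by blast
  define l where "l = (LEAST k. k \<in> {1..K} \<and> w k > b)"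
  have "l \<in> {1..K} \<and> w l > b"
    unfolding l_def by (rule LeastI[of "\<lambda>k. k \<in> {1..K} \<and> w k > b", OF k])
  moreover have "w j \<le> b" if "j \<in> {1..<l}" for j
    using not_less_Least[of j "\<lambda>k. k \<in> {1..K} \<and> w k > b", folded l_def] that calculation
    by auto
  ultimately show "\<exists>k\<in>{1..K}. first_passage w b k"
    by (auto simp: first_passage_def)
qed (auto simp: first_passage_def)

lemma first_passage_unique:
  "first_passage w b j \<Longrightarrow> first_passage w b k \<Longrightarrow> j \<ge> 1 \<Longrightarrow> k \<ge> 1 \<Longrightarrow> j = k"
  unfolding first_passage_def
  by (metis atLeastLessThan_iff linorder_neqE_nat not_less)

lemma measurable_first_passage [measurable]:
  assumes [measurable]: "\<And>j. j \<in> {1..k} \<Longrightarrow> (\<lambda>\<omega>. W j \<omega>) \<in> borel_measurable M" and "k \<ge> 1"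
  shows "Measurable.pred M (\<lambda>\<omega>. first_passage (\<lambda>j. W j \<omega>) b k)"
proof -
  have [measurable]: "W k \<in> borel_measurable M" using assms by simp
  have "Measurable.pred M (\<lambda>\<omega>. \<forall>j\<in>{1..<k}. W j \<omega> \<le> b)"
    by (intro pred_intros_finite) (auto intro!: borel_measurable_le assms simp: pred_def)
  then show ?thesis unfolding first_passage_def by measurable
qed

lemma (in prob_space) prob_ex_first_passage:
  assumes "\<And>j. j \<in> {1..K} \<Longrightarrow> W j \<in> borel_measurable M"
  shows "prob {\<omega> \<in> space M. \<exists>k\<in>{1..K}. W k \<omega> > b}
    = (\<Sum>k=1..K. prob {\<omega> \<in> space M. first_passage (\<lambda>j. W j \<omega>) b k})"
proof -
  have "{\<omega> \<in> space M. \<exists>k\<in>{1..K}. W k \<omega> > b}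
      = (\<Union>k\<in>{1..K}. {\<omega> \<in> space M. first_passage (\<lambda>j. W j \<omega>) b k})"
    using ex_first_passage[of K b "\<lambda>j. W j \<omega>" for \<omega>] by blast
  moreover have "disjoint_family_on (\<lambda>k. {\<omega> \<in> space M. first_passage (\<lambda>j. W j \<omega>) b k}) {1..K}"
    by (auto simp: disjoint_family_on_def dest: first_passage_unique)
  moreover have "{\<omega> \<in> space M. first_passage (\<lambda>j. W j \<omega>) b k} \<in> events" if "k \<in> {1..K}" for k
    using measurable_first_passage[where k = k and W = W] that assms by (auto simp: pred_def)
  ultimately show ?thesis
    by (simp add: finite_measure_finite_Union image_subset_iff)
qed

text \<open>Common core of the inequalities of Levy and Ottaviani: a first passage at
  \<open>k\<close> followed by an independent favourable event \<open>B k\<close> leads into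
  \<open>C\<close>, and summing over the disjoint passages factors out \<open>p\<close>. The bound
  \<open>p\<close> may be negative, as it is only multiplied by probabilities.\<close>

lemma (in prob_space) prob_first_passage_le:
  assumes W: "\<And>j. j \<in> {1..K} \<Longrightarrow> W j \<in> borel_measurable M"
    and B: "\<And>k. k \<in> {1..K} \<Longrightarrow> Measurable.pred M (B k)"
    and C: "C \<in> events"
    and ind: "\<And>k. k \<in> {1..K} \<Longrightarrow> prob {\<omega> \<in> space M. first_passage (\<lambda>j. W j \<omega>) b k \<and> B k \<omega>}
        = prob {\<omega> \<in> space M. first_passage (\<lambda>j. W j \<omega>) b k} * prob {\<omega> \<in> space M. B k \<omega>}"
    and p: "\<And>k. k \<in> {1..K} \<Longrightarrow> p \<le> prob {\<omega> \<in> space M. B k \<omega>}"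
    and sub: "\<And>k \<omega>. k \<in> {1..K} \<Longrightarrow> \<omega> \<in> space M \<Longrightarrow> first_passage (\<lambda>j. W j \<omega>) b k \<Longrightarrow> B k \<omega> \<Longrightarrow> \<omega> \<in> C"
  shows "p * prob {\<omega> \<in> space M. \<exists>k\<in>{1..K}. W k \<omega> > b} \<le> prob C"
proof -
  have F: "Measurable.pred M (\<lambda>\<omega>. first_passage (\<lambda>j. W j \<omega>) b k)" if "k \<in> {1..K}" for k
    using measurable_first_passage[where k = k and W = W] that W by auto
  have "p * prob {\<omega> \<in> space M. \<exists>k\<in>{1..K}. W k \<omega> > b}
      = (\<Sum>k=1..K. prob {\<omega> \<in> space M. first_passage (\<lambda>j. W j \<omega>) b k} * p)"
    using prob_ex_first_passage[of K W b] W by (simp add: sum_distrib_left mult.commute)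
  also have "\<dots> \<le> (\<Sum>k=1..K. prob {\<omega> \<in> space M. first_passage (\<lambda>j. W j \<omega>) b k \<and> B k \<omega>})"
    using p by (intro sum_mono) (auto simp: ind intro!: mult_left_mono)
  also have "\<dots> = prob (\<Union>k\<in>{1..K}. {\<omega> \<in> space M. first_passage (\<lambda>j. W j \<omega>) b k \<and> B k \<omega>})"
  proof (rule finite_measure_finite_Union[symmetric])
    show "(\<lambda>k. {\<omega> \<in> space M. first_passage (\<lambda>j. W j \<omega>) b k \<and> B k \<omega>}) ` {1..K} \<subseteq> events"
      using F B by (auto simp: pred_def)
  qed (auto simp: disjoint_family_on_def dest: first_passage_unique)
  also have "\<dots> \<le> prob C"
    using sub C by (intro finite_measure_mono) auto
  finally show ?thesis .
qed

section \<open>Levy's inequalities for maxima of partial sums\<close>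

context prob_space
begin

context
  fixes g :: "nat \<Rightarrow> 'a \<Rightarrow> real" and m :: nat
  assumes g: "indep_vars (\<lambda>_. borel) g {1..m}"
begin

lemma levy_indep:
  assumes "k \<in> {1..m}" and [measurable]: "Measurable.pred borel Q"
  shows "prob {\<omega> \<in> space M. first_passage (\<lambda>j. \<Sum>i=1..j. g i \<omega>) b k \<and> Q (\<Sum>i=k + 1..m. g i \<omega>)}
    = prob {\<omega> \<in> space M. first_passage (\<lambda>j. \<Sum>i=1..j. g i \<omega>) b k}
      * prob {\<omega> \<in> space M. Q (\<Sum>i=k + 1..m. g i \<omega>)}"
proof (rule indep_vars_prob_conj[OF g, of "{1..k}" "{k + 1..m}"
      "\<lambda>x. first_passage (\<lambda>j. \<Sum>i=1..j. x i) b k" "\<lambda>x. Q (\<Sum>i=k + 1..m. x i)"])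
  show "Measurable.pred (Pi\<^sub>M {1..k} (\<lambda>_. borel)) (\<lambda>x. first_passage (\<lambda>j. \<Sum>i=1..j. x i) b k)"
    using assms(1) by (intro measurable_first_passage borel_measurable_sum) (auto intro!: measurable_component_singleton)
  show "Measurable.pred (Pi\<^sub>M {k + 1..m} (\<lambda>_. borel)) (\<lambda>x. Q (\<Sum>i=k + 1..m. x i))"
    by measurable
  show "first_passage (\<lambda>j. \<Sum>i=1..j. restrict x {1..k} i) b k = first_passage (\<lambda>j. \<Sum>i=1..j. x i) b k" for x :: "nat \<Rightarrow> real"
  proof -
    have "(\<Sum>i=1..j. restrict x {1..k} i) = (\<Sum>i=1..j. x i)" if "j \<le> k" for j
      using that by (intro sum.cong) auto
    then show ?thesis by (simp add: first_passage_def)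
  qed
  have "(\<Sum>i=k + 1..m. restrict x {k + 1..m} i) = (\<Sum>i=k + 1..m. x i)" for x :: "nat \<Rightarrow> real"
    by (intro sum.cong) auto
  then show "Q (\<Sum>i=k + 1..m. restrict x {k + 1..m} i) = Q (\<Sum>i=k + 1..m. x i)" for x :: "nat \<Rightarrow> real"
    by (simp only:)
qed (use assms in auto)

lemma levy_measurable [measurable]: "A \<subseteq> {1..m} \<Longrightarrow> (\<lambda>\<omega>. \<Sum>i\<in>A. g i \<omega>) \<in> borel_measurable M"
  using g by (auto simp: indep_vars_def intro!: borel_measurable_sum)

text \<open>After the first passage the remaining increment is nonnegative with probability at least
  1/2, and then the end value is still above \<open>b\<close>. For k = m this increment is the empty
  sum 0, which is why the symmetry hypothesis is not strict.\<close>

lemma levy_upper: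
  assumes "m \<ge> 1" and sym: "\<And>k. k \<in> {1..m} \<Longrightarrow> prob {\<omega> \<in> space M. (\<Sum>i=k + 1..m. g i \<omega>) \<ge> 0} \<ge> 1 / 2"
  shows "prob {\<omega> \<in> space M. \<exists>k\<in>{1..m}. (\<Sum>i=1..k. g i \<omega>) > b}
    \<le> 2 * prob {\<omega> \<in> space M. (\<Sum>i=1..m. g i \<omega>) > b}"
proof -
  have "1 / 2 * prob {\<omega> \<in> space M. \<exists>k\<in>{1..m}. (\<Sum>i=1..k. g i \<omega>) > b}
    \<le> prob {\<omega> \<in> space M. (\<Sum>i=1..m. g i \<omega>) > b}"
  proof (rule prob_first_passage_le[where B = "\<lambda>k \<omega>. (\<Sum>i=k + 1..m. g i \<omega>) \<ge> 0"])
    fix k \<omega> assume k: "k \<in> {1..m}" and "\<omega> \<in> space M"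
      and F: "first_passage (\<lambda>j. \<Sum>i=1..j. g i \<omega>) b k" and B: "0 \<le> (\<Sum>i=k + 1..m. g i \<omega>)"
    have "(\<Sum>i=1..m. g i \<omega>) = (\<Sum>i=1..k. g i \<omega>) + (\<Sum>i=k + 1..m. g i \<omega>)"
      using k sum.ub_add_nat[of 1 k "\<lambda>i. g i \<omega>" "m - k"] by simp
    then show "\<omega> \<in> {\<omega> \<in> space M. b < (\<Sum>i=1..m. g i \<omega>)}"
      using F B \<open>\<omega> \<in> space M\<close> by (simp add: first_passage_def)
  next
    fix k assume k: "k \<in> {1..m}"
    show "prob {\<omega> \<in> space M. first_passage (\<lambda>j. \<Sum>i=1..j. g i \<omega>) b k \<and> 0 \<le> (\<Sum>i=k + 1..m. g i \<omega>)}
      = prob {\<omega> \<in> space M. first_passage (\<lambda>j. \<Sum>i=1..j. g i \<omega>) b k} * prob {\<omega> \<in> space M. 0 \<le> (\<Sum>i=k + 1..m. g i \<omega>)}"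
      using k by (rule levy_indep) measurable
  qed (use sym in \<open>auto intro!: levy_measurable\<close>)
  then show ?thesis by simp
qed

text \<open>The reverse direction has to control the overshoot. If no single step exceeds
  \<open>d\<close>, the walk is at most b + d at its first passage, so an end value above b + d
  forces a strictly positive remainder, of probability at most 1/2. Steps larger than
  \<open>d\<close> are paid for by a union bound.\<close>

lemma levy_lower:
  assumes "m \<ge> 1" "b \<ge> 0"
    and sym: "\<And>k. k \<in> {1..m} \<Longrightarrow> prob {\<omega> \<in> space M. (\<Sum>i=k + 1..m. g i \<omega>) > 0} \<le> 1 / 2"
  shows "2 * prob {\<omega> \<in> space M. (\<Sum>i=1..m. g i \<omega>) > b + d}
    \<le> prob {\<omega> \<in> space M. \<exists>k\<in>{1..m}. (\<Sum>i=1..k. g i \<omega>) > b}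
      + 2 * (\<Sum>k=1..m. prob {\<omega> \<in> space M. g k \<omega> > d})"
proof -
  define F where "F k = {\<omega> \<in> space M. first_passage (\<lambda>j. \<Sum>i=1..j. g i \<omega>) b k}" for k
  define FD where "FD k = {\<omega> \<in> space M. first_passage (\<lambda>j. \<Sum>i=1..j. g i \<omega>) b k \<and> (\<Sum>i=k + 1..m. g i \<omega>) > 0}" for k
  define L where "L k = {\<omega> \<in> space M. g k \<omega> > d}" for k
  have gm: "g k \<in> borel_measurable M" if "k \<in> {1..m}" for k
    using g that by (auto simp: indep_vars_def)
  have Lm: "L k \<in> events" if "k \<in> {1..m}" for k
    using gm[OF that] unfolding L_def by measurable
  have FDm: "FD k \<in> events" if k: "k \<in> {1..m}" for k
  proof -
    have [measurable]: "Measurable.pred M (\<lambda>\<omega>. first_passage (\<lambda>j. \<Sum>i=1..j. g i \<omega>) b k)"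
      using k by (intro measurable_first_passage levy_measurable) auto
    have [measurable]: "(\<lambda>\<omega>. \<Sum>i=k + 1..m. g i \<omega>) \<in> borel_measurable M"
      using k by (intro levy_measurable) auto
    show ?thesis unfolding FD_def by measurable
  qed
  have sub: "{\<omega> \<in> space M. (\<Sum>i=1..m. g i \<omega>) > b + d} \<subseteq> (\<Union>k\<in>{1..m}. FD k) \<union> (\<Union>k\<in>{1..m}. L k)"
    (is "?S \<subseteq> _")
  proof
    fix \<omega> assume w: "\<omega> \<in> ?S"
    show "\<omega> \<in> (\<Union>k\<in>{1..m}. FD k) \<union> (\<Union>k\<in>{1..m}. L k)"
    proof (cases "\<exists>k\<in>{1..m}. g k \<omega> > d")
      case False
      show ?thesis
      proof (cases "d \<ge> 0")
        case True
        have "\<exists>k\<in>{1..m}. (\<Sum>i=1..k. g i \<omega>) > b"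
          using w True \<open>m \<ge> 1\<close> by (intro bexI[of _ m]) auto
        then obtain k where k: "k \<in> {1..m}" and f: "first_passage (\<lambda>j. \<Sum>i=1..j. g i \<omega>) b k"
          using ex_first_passage[of m b "\<lambda>j. \<Sum>i=1..j. g i \<omega>"] by blast
        \<comment> \<open>For k = 1 the preceding sum is empty and lies below the level because
          \<open>b\<close> is nonnegative.\<close>
        have "(\<Sum>i=1..k - 1. g i \<omega>) \<le> b"
          using f k \<open>b \<ge> 0\<close> by (cases "k = 1") (auto simp: first_passage_def)
        moreover have "(\<Sum>i=1..k. g i \<omega>) = (\<Sum>i=1..k - 1. g i \<omega>) + g k \<omega>"
          using k by (cases k) auto
        moreover have "g k \<omega> \<le> d" using False k by force
        moreover have "(\<Sum>i=1..m. g i \<omega>) = (\<Sum>i=1..k. g i \<omega>) + (\<Sum>i=k + 1..m. g i \<omega>)"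
          using k sum.ub_add_nat[of 1 k "\<lambda>i. g i \<omega>" "m - k"] by simp
        ultimately have "(\<Sum>i=k + 1..m. g i \<omega>) > 0" using w by simp
        then show ?thesis using w k f unfolding FD_def by auto
      next
        \<comment> \<open>For negative \<open>d\<close>, steps that all stay below \<open>d\<close>
          would keep the end value below \<open>d\<close>, hence below b + d.\<close>
        case neg: False
        have "(\<Sum>i=1..m. g i \<omega>) \<le> (\<Sum>i=1..m. d)"
          using False by (intro sum_mono) force
        also have "\<dots> \<le> d" using neg \<open>m \<ge> 1\<close>
          by (simp add: mult_le_cancel_right1)
        finally show ?thesis using w \<open>b \<ge> 0\<close> by simp
      qed
    qed (use w in \<open>auto simp: L_def\<close>)
  qed
  have "prob ?S \<le> prob (\<Union>k\<in>{1..m}. FD k) + prob (\<Union>k\<in>{1..m}. L k)"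
    using sub FDm Lm by (intro order_trans[OF finite_measure_mono measure_Un_le]) auto
  also have "\<dots> \<le> (\<Sum>k=1..m. prob (FD k)) + (\<Sum>k=1..m. prob (L k))"
    using FDm Lm by (intro add_mono finite_measure_subadditive_finite) auto
  also have "(\<Sum>k=1..m. prob (FD k)) \<le> (\<Sum>k=1..m. prob (F k) * (1 / 2))"
  proof (rule sum_mono)
    fix k assume k: "k \<in> {1..m}"
    have "prob (FD k) = prob (F k) * prob {\<omega> \<in> space M. (\<Sum>i=k + 1..m. g i \<omega>) > 0}"
      unfolding FD_def F_def using k by (rule levy_indep) measurable
    then show "prob (FD k) \<le> prob (F k) * (1 / 2)"
      using sym[OF k] by (simp only:) (rule mult_left_mono, simp_all)
  qed
  also have "(\<Sum>k=1..m. prob (F k) * (1 / 2)) = prob {\<omega> \<in> space M. \<exists>k\<in>{1..m}. (\<Sum>i=1..k. g i \<omega>) > b} / 2"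
    unfolding F_def by (subst prob_ex_first_passage) (auto intro!: levy_measurable simp: sum_divide_distrib)
  finally show ?thesis unfolding L_def by simp
qed

end

end

section \<open>Lindeberg replacement\<close>

text \<open>\<open>A\<close> is the size of the coefficient with which the variable enters: each derivative gains
  one factor \<open>A\<close>.\<close>

definition C3_bound :: "real \<Rightarrow> real \<Rightarrow> (real \<Rightarrow> real) \<Rightarrow> bool" where
  "C3_bound A C h \<longleftrightarrow> (\<exists>h1 h2 h3. \<forall>s. (h has_real_derivative h1 s) (at s) \<and>
     (h1 has_real_derivative h2 s) (at s) \<and> (h2 has_real_derivative h3 s) (at s) \<and>
     \<bar>h s\<bar> \<le> C \<and> \<bar>h1 s\<bar> \<le> C * A \<and> \<bar>h2 s\<bar> \<le> C * A\<^sup>2 \<and> \<bar>h3 s\<bar> \<le> C * A ^ 3)"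

text \<open>The factor 8 is the sum 1 + 3 + 3 + 1 of the Leibniz coefficients of the third
  derivative; it covers the lower orders too.\<close>

lemma C3_bound_mult:
  assumes "C3_bound A C f" "C3_bound A D g" and "A \<ge> 0"
  shows "C3_bound A (8 * C * D) (\<lambda>s. f s * g s)"
proof -
  obtain f1 f2 f3 where f: "\<And>s. (f has_real_derivative f1 s) (at s)"
    "\<And>s. (f1 has_real_derivative f2 s) (at s)" "\<And>s. (f2 has_real_derivative f3 s) (at s)"
    and fb: "\<And>s. \<bar>f s\<bar> \<le> C" "\<And>s. \<bar>f1 s\<bar> \<le> C * A" "\<And>s. \<bar>f2 s\<bar> \<le> C * A\<^sup>2" "\<And>s. \<bar>f3 s\<bar> \<le> C * A ^ 3"
    using assms(1) unfolding C3_bound_def by blast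
  obtain g1 g2 g3 where g: "\<And>s. (g has_real_derivative g1 s) (at s)"
    "\<And>s. (g1 has_real_derivative g2 s) (at s)" "\<And>s. (g2 has_real_derivative g3 s) (at s)"
    and gb: "\<And>s. \<bar>g s\<bar> \<le> D" "\<And>s. \<bar>g1 s\<bar> \<le> D * A" "\<And>s. \<bar>g2 s\<bar> \<le> D * A\<^sup>2" "\<And>s. \<bar>g3 s\<bar> \<le> D * A ^ 3"
    using assms(2) unfolding C3_bound_def by blast
  have CD: "C \<ge> 0" "D \<ge> 0"
    using order_trans[OF abs_ge_zero fb(1)[of 0]] order_trans[OF abs_ge_zero gb(1)[of 0]] by auto
  have m: "\<bar>u * v\<bar> \<le> a * b" if "\<bar>u\<bar> \<le> a" "\<bar>v\<bar> \<le> b" for u v a b :: real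
    using that by (simp add: abs_mult mult_mono')
  define q where "q = C * D"
  have q: "q \<ge> 0" "q * A \<ge> 0" "q * A\<^sup>2 \<ge> 0" "q * A ^ 3 \<ge> 0"
    using CD \<open>A \<ge> 0\<close> by (simp_all add: q_def)
  show ?thesis
    unfolding C3_bound_def
  proof (intro exI allI conjI)
    fix s
    show "((\<lambda>s. f s * g s) has_real_derivative f1 s * g s + f s * g1 s) (at s)"
      by (auto intro!: derivative_eq_intros f g)
    show "((\<lambda>s. f1 s * g s + f s * g1 s) has_real_derivative f2 s * g s + 2 * (f1 s * g1 s) + f s * g2 s) (at s)"
      by (auto intro!: derivative_eq_intros f g)
    show "((\<lambda>s. f2 s * g s + 2 * (f1 s * g1 s) + f s * g2 s) has_real_derivative
        f3 s * g s + 3 * (f2 s * g1 s) + 3 * (f1 s * g2 s) + f s * g3 s) (at s)"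
      by (auto intro!: derivative_eq_intros f g)
    show "\<bar>f s * g s\<bar> \<le> 8 * C * D"
      using m[OF fb(1) gb(1), of s s] q by (simp add: q_def)
    show "\<bar>f1 s * g s + f s * g1 s\<bar> \<le> 8 * C * D * A"
    proof -
      have "\<bar>f1 s * g s\<bar> \<le> q * A" "\<bar>f s * g1 s\<bar> \<le> q * A"
        using m[OF fb(2) gb(1), of s s] m[OF fb(1) gb(2), of s s] by (simp_all add: q_def mult_ac)
      then show ?thesis using q unfolding mult.assoc[of 8 C D] q_def[symmetric] by linarith
    qed
    show "\<bar>f2 s * g s + 2 * (f1 s * g1 s) + f s * g2 s\<bar> \<le> 8 * C * D * A\<^sup>2"
    proof -
      have "\<bar>f2 s * g s\<bar> \<le> q * A\<^sup>2" "\<bar>f1 s * g1 s\<bar> \<le> q * A\<^sup>2" "\<bar>f s * g2 s\<bar> \<le> q * A\<^sup>2"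
        using m[OF fb(3) gb(1), of s s] m[OF fb(2) gb(2), of s s] m[OF fb(1) gb(3), of s s]
        by (simp_all add: q_def mult_ac power2_eq_square)
      then show ?thesis using q unfolding mult.assoc[of 8 C D] q_def[symmetric] by linarith
    qed
    show "\<bar>f3 s * g s + 3 * (f2 s * g1 s) + 3 * (f1 s * g2 s) + f s * g3 s\<bar> \<le> 8 * C * D * A ^ 3"
    proof -
      have "\<bar>f3 s * g s\<bar> \<le> q * A ^ 3" "\<bar>f2 s * g1 s\<bar> \<le> q * A ^ 3" "\<bar>f1 s * g2 s\<bar> \<le> q * A ^ 3" "\<bar>f s * g3 s\<bar> \<le> q * A ^ 3"
        using m[OF fb(4) gb(1), of s s] m[OF fb(3) gb(2), of s s] m[OF fb(2) gb(3), of s s] m[OF fb(1) gb(4), of s s]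
        by (simp_all add: q_def mult_ac power2_eq_square power3_eq_cube)
      then show ?thesis using q unfolding mult.assoc[of 8 C D] q_def[symmetric] by linarith
    qed
  qed
qed

lemma C3_bound_prod:
  assumes "finite J" "\<And>j. j \<in> J \<Longrightarrow> C3_bound A C (f j)" and "A \<ge> 0"
  shows "C3_bound A ((8 * C) ^ card J) (\<lambda>s. \<Prod>j\<in>J. f j s)"
  using assms(1,2)
proof (induction J rule: finite_induct)
  case empty
  show ?case unfolding C3_bound_def using \<open>A \<ge> 0\<close>
    by (intro exI[of _ "\<lambda>_. 0"]) simp
next
  case (insert j J)
  then show ?case
    using C3_bound_mult[of A C "f j" "(8 * C) ^ card J" "\<lambda>s. \<Prod>j\<in>J. f j s"] \<open>A \<ge> 0\<close>
    by (simp add: mult_ac)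
qed

text \<open>A smooth substitute for the indicator of the negative half line; its derivatives are
  polynomials in tanh, hence bounded.\<close>

definition soft_step :: "real \<Rightarrow> real \<Rightarrow> real" where
  "soft_step \<beta> x = (1 - tanh (\<beta> * x)) / 2"

lemma soft_step_bounds: "0 \<le> soft_step \<beta> x" "soft_step \<beta> x \<le> 1"
  using tanh_real_bounds[of "\<beta> * x"] by (auto simp: soft_step_def)

text \<open>With T the tanh term and q = \<beta> a, the derivatives are -q (1 - T^2)/2, q^2 T (1 -
  T^2) and q^3 (1 - T^2)(1 - 3 T^2). The 2 in the constant bounds |1 - 3 T^2|, and \<beta> \<ge> 1
  lets the third power dominate the lower ones.\<close>

lemma C3_bound_soft_step:
  assumes "\<beta> \<ge> 1" "\<bar>a\<bar> \<le> A"
  shows "C3_bound A (2 * \<beta> ^ 3) (\<lambda>s. soft_step \<beta> (c + a * s))"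
proof -
  define T where "T s = tanh (\<beta> * (c + a * s))" for s
  define q where "q = \<beta> * a"
  have T: "(T has_real_derivative q * (1 - (T s)\<^sup>2)) (at s)" for s
  proof -
    have "cosh (\<beta> * (c + a * s)) \<noteq> 0" by (metis cosh_real_nonzero)
    then show ?thesis
      unfolding T_def q_def by (auto intro!: derivative_eq_intros)
  qed
  have T1: "\<bar>T s\<bar> \<le> 1" for s
    using tanh_real_bounds[of "\<beta> * (c + a * s)"] by (auto simp: T_def)
  then have T2: "0 \<le> (T s)\<^sup>2" "(T s)\<^sup>2 \<le> 1" for s
    using power_mono[of "\<bar>T s\<bar>" 1 2] by simp_all
  have A: "A \<ge> 0" using assms by simp
  have q: "\<bar>q\<bar> \<le> \<beta> * A"
    using assms by (simp add: q_def abs_mult mult_left_mono)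
  have b: "1 \<le> \<beta> ^ 3" "\<beta> \<le> \<beta> ^ 3" "\<beta>\<^sup>2 \<le> \<beta> ^ 3"
    using assms(1) power_increasing[of 1 3 \<beta>] power_increasing[of 2 3 \<beta>] by (simp_all add: one_le_power)
  have q1: "\<bar>q\<bar> \<le> \<beta> ^ 3 * A"
    using q mult_right_mono[OF b(2) A] by linarith
  have q2: "\<bar>q\<bar>\<^sup>2 \<le> \<beta> ^ 3 * A\<^sup>2"
    using power_mono[OF q, of 2] mult_right_mono[OF b(3), of "A\<^sup>2"] by (simp add: power_mult_distrib)
  have q2': "q\<^sup>2 \<le> 2 * \<beta> ^ 3 * A\<^sup>2"
    using q2 zero_le_power2[of q] unfolding power2_abs by linarith
  have q3: "\<bar>q\<bar> ^ 3 \<le> \<beta> ^ 3 * A ^ 3"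
    using power_mono[OF q, of 3] by (simp add: power_mult_distrib)
  have E: "\<bar>x * y\<bar> \<le> z" if "\<bar>x\<bar> \<le> z" "\<bar>y\<bar> \<le> 1" for x y z :: real
    using mult_mono[OF that] that by (simp add: abs_mult)
  show ?thesis
    unfolding C3_bound_def
  proof (intro exI allI conjI)
    fix s
    have eq: "(\<lambda>s. soft_step \<beta> (c + a * s)) = (\<lambda>s. (1 - T s) / 2)"
      by (simp add: soft_step_def T_def)
    show "((\<lambda>s. soft_step \<beta> (c + a * s)) has_real_derivative - q * ((1 - (T s)\<^sup>2) / 2)) (at s)"
      unfolding eq by (auto intro!: derivative_eq_intros T)
    show "((\<lambda>s. - q * ((1 - (T s)\<^sup>2) / 2)) has_real_derivative q\<^sup>2 * (T s * (1 - (T s)\<^sup>2))) (at s)"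
      by (auto intro!: derivative_eq_intros T simp: power2_eq_square field_simps)
    show "((\<lambda>s. q\<^sup>2 * (T s * (1 - (T s)\<^sup>2))) has_real_derivative q ^ 3 * ((1 - (T s)\<^sup>2) * (1 - 3 * (T s)\<^sup>2))) (at s)"
      by (auto intro!: derivative_eq_intros T simp: power2_eq_square power3_eq_cube algebra_simps)
    show "\<bar>soft_step \<beta> (c + a * s)\<bar> \<le> 2 * \<beta> ^ 3"
      using soft_step_bounds[of \<beta> "c + a * s"] b(1) by simp
    show "\<bar>- q * ((1 - (T s)\<^sup>2) / 2)\<bar> \<le> 2 * \<beta> ^ 3 * A"
      using q1 T2[of s] order_trans[of "-1" 0 "(T s)\<^sup>2"] by (intro E) auto
    show "\<bar>q\<^sup>2 * (T s * (1 - (T s)\<^sup>2))\<bar> \<le> 2 * \<beta> ^ 3 * A\<^sup>2"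
    proof (rule E)
      show "\<bar>q\<^sup>2\<bar> \<le> 2 * \<beta> ^ 3 * A\<^sup>2" using q2' by simp
      have "\<bar>1 - (T s)\<^sup>2\<bar> \<le> 1" using T2[of s] by linarith
      then show "\<bar>T s * (1 - (T s)\<^sup>2)\<bar> \<le> 1" by (rule E[OF T1])
    qed
    have "\<bar>(1 - (T s)\<^sup>2) * (1 - 3 * (T s)\<^sup>2)\<bar> \<le> 2"
    proof -
      have "\<bar>1 - (T s)\<^sup>2\<bar> \<le> 1" "\<bar>1 - 3 * (T s)\<^sup>2\<bar> \<le> 2" using T2[of s] by linarith+
      then have "\<bar>1 - (T s)\<^sup>2\<bar> * \<bar>1 - 3 * (T s)\<^sup>2\<bar> \<le> 1 * 2" by (intro mult_mono) auto
      then show ?thesis by (simp add: abs_mult)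
    qed
    then show "\<bar>q ^ 3 * ((1 - (T s)\<^sup>2) * (1 - 3 * (T s)\<^sup>2))\<bar> \<le> 2 * \<beta> ^ 3 * A ^ 3"
      using mult_mono[OF q3, of "\<bar>(1 - (T s)\<^sup>2) * (1 - 3 * (T s)\<^sup>2)\<bar>" 2] assms A
      by (simp add: abs_mult power_abs mult_ac)
  qed
qed

text \<open>Two forms of the remainder are combined: the third-order one for small \<open>s\<close>,
  and for large \<open>s\<close> the second-order one, which is integrable under a finite variance
  alone.\<close>

lemma C3_bound_Taylor:
  assumes "C3_bound A C h" "A \<ge> 0"
  shows "\<exists>d1 d2. \<forall>s. \<bar>h s - h 0 - d1 * s - d2 * s\<^sup>2 / 2\<bar> \<le> C * A\<^sup>2 * (s\<^sup>2 * min 1 (A * \<bar>s\<bar>))"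
proof -
  obtain h1 h2 h3 where h: "\<And>s. (h has_real_derivative h1 s) (at s)"
    "\<And>s. (h1 has_real_derivative h2 s) (at s)" "\<And>s. (h2 has_real_derivative h3 s) (at s)"
    and hb: "\<And>s. \<bar>h s\<bar> \<le> C" "\<And>s. \<bar>h1 s\<bar> \<le> C * A" "\<And>s. \<bar>h2 s\<bar> \<le> C * A\<^sup>2" "\<And>s. \<bar>h3 s\<bar> \<le> C * A ^ 3"
    using assms(1) unfolding C3_bound_def by blast
  have C: "C \<ge> 0"
    using order_trans[OF abs_ge_zero hb(1)[of 0]] by auto
  define D where "D = (\<lambda>m. [h, h1, h2, h3] ! m)"
  have D: "D 0 = h" and DD: "m < 3 \<Longrightarrow> (D m has_real_derivative D (Suc m) t) (at t)" for m t
    using h by (auto simp: D_def less_Suc_eq numeral_3_eq_3)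
  show ?thesis
  proof (intro exI allI)
    fix s :: real
    obtain t where t: "h s = (\<Sum>m<3. D m 0 / fact m * s ^ m) + D 3 t / fact 3 * s ^ 3"
      using Maclaurin_bi_le[of D h 3 s] D DD by auto
    obtain u where u: "h s = (\<Sum>m<2. D m 0 / fact m * s ^ m) + D 2 u / fact 2 * s ^ 2"
      using Maclaurin_bi_le[of D h 2 s] D DD by auto
    let ?r = "h s - h 0 - h1 0 * s - h2 0 * s\<^sup>2 / 2"
    have "?r = h3 t * s ^ 3 / 6"
      unfolding t by (simp add: D_def numeral_3_eq_3 numeral_2_eq_2)
    moreover have "\<bar>h3 t * s ^ 3\<bar> \<le> C * A ^ 3 * \<bar>s\<bar> ^ 3"
      using mult_right_mono[OF hb(4)[of t], of "\<bar>s\<bar> ^ 3"] by (simp add: abs_mult power_abs)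
    moreover have "0 \<le> C * A ^ 3 * \<bar>s\<bar> ^ 3" using C assms by simp
    ultimately have 1: "\<bar>?r\<bar> \<le> C * A ^ 3 * \<bar>s\<bar> ^ 3" by linarith
    have "?r = h2 u * s\<^sup>2 / 2 - h2 0 * s\<^sup>2 / 2"
      unfolding u by (simp add: D_def numeral_2_eq_2)
    moreover have "\<bar>h2 v * s\<^sup>2\<bar> \<le> C * A\<^sup>2 * s\<^sup>2" for v
      using mult_right_mono[OF hb(3)[of v], of "s\<^sup>2"] by (simp add: abs_mult)
    ultimately have 2: "\<bar>?r\<bar> \<le> C * A\<^sup>2 * s\<^sup>2"
      using \<open>\<And>v. \<bar>h2 v * s\<^sup>2\<bar> \<le> C * A\<^sup>2 * s\<^sup>2\<close>[of u] \<open>\<And>v. \<bar>h2 v * s\<^sup>2\<bar> \<le> C * A\<^sup>2 * s\<^sup>2\<close>[of 0] by linarith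
    have "C * A ^ 3 * \<bar>s\<bar> ^ 3 = C * A\<^sup>2 * (s\<^sup>2 * (A * \<bar>s\<bar>))"
      unfolding power2_abs[of s, symmetric] by (simp add: power3_eq_cube power2_eq_square)
    then show "\<bar>?r\<bar> \<le> C * A\<^sup>2 * (s\<^sup>2 * min 1 (A * \<bar>s\<bar>))"
      using 1 2 by (cases "A * \<bar>s\<bar> \<le> 1") (simp_all only: min_def if_True if_False mult_1_right, auto)
  qed
qed

section \<open>Exchanging laws with equal first and second moments\<close>

definition standardized :: "real measure \<Rightarrow> bool" where
  "standardized \<mu> \<longleftrightarrow> prob_space \<mu> \<and> sets \<mu> = sets borel \<and> integrable \<mu> (\<lambda>x. x) \<and>
     integrable \<mu> (\<lambda>x. x\<^sup>2) \<and> (\<integral>x. x \<partial>\<mu>) = 0 \<and> (\<integral>x. x\<^sup>2 \<partial>\<mu>) = 1"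

text \<open>The integrated Taylor remainder without its factor C A^2. It replaces the third absolute
  moment, which need not be finite.\<close>

definition taylor_error :: "real measure \<Rightarrow> real \<Rightarrow> real" where
  "taylor_error \<mu> A = (\<integral>x. x\<^sup>2 * min 1 (A * \<bar>x\<bar>) \<partial>\<mu>)"

lemma integrable_taylor_error:
  assumes "standardized \<mu>" "A \<ge> 0"
  shows "integrable \<mu> (\<lambda>x. x\<^sup>2 * min 1 (A * \<bar>x\<bar>))"
proof (rule Bochner_Integration.integrable_bound)
  have [measurable_cong]: "sets \<mu> = sets borel" using assms by (simp add: standardized_def)
  show "integrable \<mu> (\<lambda>x. x\<^sup>2)" using assms by (simp add: standardized_def)
  show "(\<lambda>x. x\<^sup>2 * min 1 (A * \<bar>x\<bar>)) \<in> borel_measurable \<mu>" by measurable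
  show "AE x in \<mu>. norm (x\<^sup>2 * min 1 (A * \<bar>x\<bar>)) \<le> norm (x\<^sup>2)"
  proof (intro always_eventually allI)
    fix x :: real
    show "norm (x\<^sup>2 * min 1 (A * \<bar>x\<bar>)) \<le> norm (x\<^sup>2)"
      using assms(2) mult_left_mono[of "min 1 (A * \<bar>x\<bar>)" 1 "x\<^sup>2"] by (simp add: abs_mult abs_of_nonneg)
  qed
qed

text \<open>Both laws give the quadratic Taylor polynomial at 0 the same integral, because their
  first two moments agree. Only the two remainders are left.\<close>

lemma standardized_integral_cong:
  assumes \<mu>: "standardized \<mu>" and \<nu>: "standardized \<nu>" and h: "C3_bound A C h" and "A \<ge> 0"
  shows "\<bar>(\<integral>x. h x \<partial>\<mu>) - (\<integral>x. h x \<partial>\<nu>)\<bar> \<le> C * A\<^sup>2 * (taylor_error \<mu> A + taylor_error \<nu> A)"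
proof -
  obtain d1 d2 where d: "\<And>s. \<bar>h s - h 0 - d1 * s - d2 * s\<^sup>2 / 2\<bar> \<le> C * A\<^sup>2 * (s\<^sup>2 * min 1 (A * \<bar>s\<bar>))"
    using C3_bound_Taylor[OF h \<open>A \<ge> 0\<close>] by blast
  have hm: "h \<in> borel_measurable borel" and hC: "\<bar>h s\<bar> \<le> C" for s
  proof -
    obtain h1 where h1: "\<And>s. (h has_real_derivative h1 s) (at s)" and "\<And>s. \<bar>h s\<bar> \<le> C"
      using h unfolding C3_bound_def by blast
    then show "\<bar>h s\<bar> \<le> C" by blast
    have "continuous_on UNIV h"
      using h1 by (intro DERIV_continuous_on) (auto intro: has_field_derivative_at_within)
    then show "h \<in> borel_measurable borel" by (rule borel_measurable_continuous_onI)
  qed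
  have 1: "\<bar>(\<integral>x. h x \<partial>\<mu>) - (h 0 + d2 / 2)\<bar> \<le> C * A\<^sup>2 * taylor_error \<mu> A" if \<mu>: "standardized \<mu>" for \<mu>
  proof -
    interpret prob_space \<mu> using \<mu> by (simp add: standardized_def)
    have s[measurable_cong]: "sets \<mu> = sets borel" using \<mu> by (simp add: standardized_def)
    have hi: "integrable \<mu> h"
      using hm hC by (intro integrable_const_bound[of _ C]) (auto simp: measurable_cong_sets[OF s refl])
    have i: "integrable \<mu> (\<lambda>x. x)" "integrable \<mu> (\<lambda>x. x\<^sup>2)" "(\<integral>x. x \<partial>\<mu>) = 0" "(\<integral>x. x\<^sup>2 \<partial>\<mu>) = 1"
      using \<mu> by (auto simp: standardized_def)
    have "(\<integral>x. h x \<partial>\<mu>) - (h 0 + d2 / 2) = (\<integral>x. h x - h 0 - d1 * x - d2 * x\<^sup>2 / 2 \<partial>\<mu>)"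
      using hi i by (simp add: prob_space)
    also have "\<bar>\<dots>\<bar> \<le> (\<integral>x. C * A\<^sup>2 * (x\<^sup>2 * min 1 (A * \<bar>x\<bar>)) \<partial>\<mu>)"
    proof (rule order_trans[OF integral_abs_bound integral_mono])
      show "integrable \<mu> (\<lambda>x. \<bar>h x - h 0 - d1 * x - d2 * x\<^sup>2 / 2\<bar>)"
        using hi i by simp
      show "integrable \<mu> (\<lambda>x. C * A\<^sup>2 * (x\<^sup>2 * min 1 (A * \<bar>x\<bar>)))"
        using integrable_taylor_error[OF \<mu> \<open>A \<ge> 0\<close>] by simp
    qed (rule d)
    finally show ?thesis by (simp add: taylor_error_def)
  qed
  show ?thesis using 1[OF \<mu>] 1[OF \<nu>] by (simp add: algebra_simps)
qed

text \<open>A smooth stand-in for the indicator that all the affine forms indexed by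
  \<open>J\<close> are at most 0. With \<open>c\<close> constantly equal to -b it smooths the event
  that the maximum of the linear forms is at most b.\<close>

definition soft_max_le :: "real \<Rightarrow> nat set \<Rightarrow> (nat \<Rightarrow> nat \<Rightarrow> real) \<Rightarrow> nat set \<Rightarrow> (nat \<Rightarrow> real) \<Rightarrow> (nat \<Rightarrow> real) \<Rightarrow> real" where
  "soft_max_le \<beta> J a I c x = (\<Prod>j\<in>J. soft_step \<beta> (c j + (\<Sum>i\<in>I. a j i * x i)))"

lemma soft_max_le_bounds: "0 \<le> soft_max_le \<beta> J a I c x" "soft_max_le \<beta> J a I c x \<le> 1"
  unfolding soft_max_le_def using soft_step_bounds by (auto intro!: prod_nonneg prod_le_1)

lemma soft_step_measurable [measurable]: "soft_step \<beta> \<in> borel_measurable borel"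
proof -
  have "continuous_on UNIV (soft_step \<beta>)"
    unfolding soft_step_def by (intro continuous_intros) auto
  then show ?thesis by (rule borel_measurable_continuous_onI)
qed

lemma soft_max_le_measurable:
  assumes "\<And>i. i \<in> I \<Longrightarrow> (\<lambda>\<omega>. x \<omega> i) \<in> borel_measurable M" "\<And>j. j \<in> J \<Longrightarrow> (\<lambda>\<omega>. c \<omega> j) \<in> borel_measurable M"
  shows "(\<lambda>\<omega>. soft_max_le \<beta> J a I (c \<omega>) (x \<omega>)) \<in> borel_measurable M"
  unfolding soft_max_le_def using assms
  by (intro borel_measurable_prod measurable_compose[OF _ soft_step_measurable] borel_measurable_add
      borel_measurable_sum borel_measurable_times borel_measurable_const) auto

text \<open>The offsets \<open>c\<close> absorb the variables already split off.\<close>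

lemma lindeberg_replacement:
  assumes \<mu>: "standardized \<mu>" and \<nu>: "standardized \<nu>"
    and "finite J" "\<beta> \<ge> 1" "finite I"
    and a: "\<And>i j. i \<in> I \<Longrightarrow> j \<in> J \<Longrightarrow> \<bar>a j i\<bar> \<le> A i" and A: "\<And>i. i \<in> I \<Longrightarrow> A i \<ge> 0"
  shows "\<bar>(\<integral>x. soft_max_le \<beta> J a I c x \<partial>PiM I (\<lambda>_. \<mu>)) - (\<integral>x. soft_max_le \<beta> J a I c x \<partial>PiM I (\<lambda>_. \<nu>))\<bar>
    \<le> (16 * \<beta> ^ 3) ^ card J * (\<Sum>i\<in>I. (A i)\<^sup>2 * (taylor_error \<mu> (A i) + taylor_error \<nu> (A i)))"
  using \<open>finite I\<close> a A
proof (induction I arbitrary: c rule: finite_induct)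
  case empty
  then show ?case by (simp add: PiM_empty lebesgue_integral_count_space_finite soft_max_le_def)
next
  case (insert i I)
  interpret \<mu>: prob_space \<mu> using \<mu> by (simp add: standardized_def)
  interpret \<nu>: prob_space \<nu> using \<nu> by (simp add: standardized_def)
  interpret P\<mu>: product_prob_space "\<lambda>_. \<mu>" by unfold_locales
  interpret P\<nu>: product_prob_space "\<lambda>_. \<nu>" by unfold_locales
  have s[measurable_cong]: "sets \<mu> = sets borel" "sets \<nu> = sets borel"
    using \<mu> \<nu> by (simp_all add: standardized_def)
  have sp: "space \<mu> = UNIV" "space \<nu> = UNIV"
    using s by (auto dest: sets_eq_imp_space_eq)
  let ?C = "(16 * \<beta> ^ 3) ^ card J"
  let ?e = "\<lambda>i. (A i)\<^sup>2 * (taylor_error \<mu> (A i) + taylor_error \<nu> (A i))"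
  \<comment> \<open>Freezing variable \<open>i\<close> at \<open>y\<close> only shifts the
    offsets.\<close>
  define d where "d y j = c j + a j i * y" for y j
  have upd: "soft_max_le \<beta> J a (insert i I) c (x(i := y)) = soft_max_le \<beta> J a I (d y) x" for x y
  proof -
    have "(\<Sum>k\<in>I. a j k * (x(i := y)) k) = (\<Sum>k\<in>I. a j k * x k)" for j
      using insert.hyps by (intro sum.cong) auto
    then show ?thesis using insert.hyps by (simp add: soft_max_le_def d_def add_ac)
  qed
  have comp: "(\<lambda>x. x k) \<in> borel_measurable (PiM K (\<lambda>_. \<mu>))" "(\<lambda>x. x k) \<in> borel_measurable (PiM K (\<lambda>_. \<nu>))" if "k \<in> K" for k K
    using measurable_component_singleton[OF that, of "\<lambda>_. \<mu>"] measurable_component_singleton[OF that, of "\<lambda>_. \<nu>"] s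
    by (simp_all add: measurable_cong_sets[OF refl s(1)] measurable_cong_sets[OF refl s(2)])
  have int: "integrable M f" if "prob_space M" "f \<in> borel_measurable M" "\<And>x. 0 \<le> f x" "\<And>x. f x \<le> 1" for M and f :: "'b \<Rightarrow> real"
    using that by (intro finite_measure.integrable_const_bound[of M f 1]) (auto simp: prob_space_def)
  have split: "(\<integral>x. soft_max_le \<beta> J a (insert i I) c x \<partial>PiM (insert i I) (\<lambda>_. \<rho>))
      = (\<integral>x. \<integral>y. soft_max_le \<beta> J a I (d y) x \<partial>\<rho> \<partial>PiM I (\<lambda>_. \<rho>))"
    if "\<rho> = \<mu> \<or> \<rho> = \<nu>" for \<rho>
  proof -
    have "integrable (PiM (insert i I) (\<lambda>_. \<rho>)) (soft_max_le \<beta> J a (insert i I) c)"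
      using that comp by (intro int soft_max_le_bounds soft_max_le_measurable prob_space_PiM)
        (auto intro: \<mu>.prob_space_axioms \<nu>.prob_space_axioms)
    then show ?thesis
      using that P\<mu>.product_integral_insert[OF insert.hyps, of "soft_max_le \<beta> J a (insert i I) c"]
       P\<nu>.product_integral_insert[OF insert.hyps, of "soft_max_le \<beta> J a (insert i I) c"] by (auto simp: upd)
  qed
  have Dpair: "(\<lambda>p. soft_max_le \<beta> J a I (d (snd p)) (fst p)) \<in> borel_measurable (PiM I (\<lambda>_. \<rho>) \<Otimes>\<^sub>M \<nu>)"
    if "\<rho> = \<mu> \<or> \<rho> = \<nu>" for \<rho>
    using that comp unfolding d_def
    by (intro soft_max_le_measurable) (auto intro: measurable_compose[OF measurable_fst])
  have Dx: "(\<lambda>x. soft_max_le \<beta> J a I (d y) x) \<in> borel_measurable (PiM I (\<lambda>_. \<rho>))"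
    if "\<rho> = \<mu> \<or> \<rho> = \<nu>" for \<rho> y
    using that comp by (intro soft_max_le_measurable) auto
  have Dy: "(\<lambda>y. soft_max_le \<beta> J a I (d y) x) \<in> borel_measurable \<rho>" if "\<rho> = \<mu> \<or> \<rho> = \<nu>" for \<rho> x
    using that unfolding d_def by (intro soft_max_le_measurable) auto
  have pP: "prob_space (PiM I (\<lambda>_. \<rho>))" if "\<rho> = \<mu> \<or> \<rho> = \<nu>" for \<rho>
    using that by (auto intro!: prob_space_PiM \<mu>.prob_space_axioms \<nu>.prob_space_axioms)
  have fub: "(\<integral>x. \<integral>y. soft_max_le \<beta> J a I (d y) x \<partial>\<nu> \<partial>PiM I (\<lambda>_. \<rho>))
     = (\<integral>y. \<integral>x. soft_max_le \<beta> J a I (d y) x \<partial>PiM I (\<lambda>_. \<rho>) \<partial>\<nu>)" if "\<rho> = \<mu> \<or> \<rho> = \<nu>" for \<rho>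
  proof -
    interpret R: prob_space "PiM I (\<lambda>_. \<rho>)" using that by (rule pP)
    interpret pair_prob_space "PiM I (\<lambda>_. \<rho>)" \<nu> ..
    show ?thesis
      by (rule Fubini_integral[symmetric])
        (use Dpair[OF that] in \<open>auto intro!: int soft_max_le_bounds prob_space_axioms simp: split_beta'\<close>)
  qed
  have mint: "(\<lambda>x. \<integral>y. soft_max_le \<beta> J a I (d y) x \<partial>\<rho>) \<in> borel_measurable (PiM I (\<lambda>_. \<mu>))" if "\<rho> = \<mu> \<or> \<rho> = \<nu>" for \<rho>
  proof -
    have "(\<lambda>p. soft_max_le \<beta> J a I (d (snd p)) (fst p)) \<in> borel_measurable (PiM I (\<lambda>_. \<mu>) \<Otimes>\<^sub>M \<rho>)"
      using that comp unfolding d_def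
      by (intro soft_max_le_measurable) (auto intro: measurable_compose[OF measurable_fst])
    then show ?thesis
      using that by (auto intro!: \<mu>.borel_measurable_lebesgue_integral \<nu>.borel_measurable_lebesgue_integral simp: split_beta')
  qed
  have b01: "0 \<le> (\<integral>y. soft_max_le \<beta> J a I (d y) x \<partial>\<rho>)" "(\<integral>y. soft_max_le \<beta> J a I (d y) x \<partial>\<rho>) \<le> 1" if "\<rho> = \<mu> \<or> \<rho> = \<nu>" for \<rho> x
  proof -
    have "prob_space \<rho>" using that by (auto intro: \<mu>.prob_space_axioms \<nu>.prob_space_axioms)
    then show "0 \<le> (\<integral>y. soft_max_le \<beta> J a I (d y) x \<partial>\<rho>)" "(\<integral>y. soft_max_le \<beta> J a I (d y) x \<partial>\<rho>) \<le> 1"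
      using soft_max_le_bounds int[OF _ Dy[OF that]]
      by (auto intro!: integral_nonneg_AE prob_space.integral_le_const)
  qed
  let ?M\<mu> = "PiM I (\<lambda>_. \<mu>)" and ?M\<nu> = "PiM I (\<lambda>_. \<nu>)"
  \<comment> \<open>First exchange: variable \<open>i\<close> passes from \<mu> to \<nu> while the
    others still have law \<mu>. The estimate is pointwise in those others, and the constant is 8
    times the 2 \<beta>^3 of the soft step, once per factor.\<close>
  have 1: "\<bar>(\<integral>x. \<integral>y. soft_max_le \<beta> J a I (d y) x \<partial>\<mu> \<partial>?M\<mu>) - (\<integral>x. \<integral>y. soft_max_le \<beta> J a I (d y) x \<partial>\<nu> \<partial>?M\<mu>)\<bar> \<le> ?C * ?e i"
  proof -
    interpret R: prob_space ?M\<mu> by (rule pP) simp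
    have i: "integrable ?M\<mu> (\<lambda>x. \<integral>y. soft_max_le \<beta> J a I (d y) x \<partial>\<rho>)" if "\<rho> = \<mu> \<or> \<rho> = \<nu>" for \<rho>
      using that mint b01 by (intro int pP) auto
    have pw: "\<bar>(\<integral>y. soft_max_le \<beta> J a I (d y) x \<partial>\<mu>) - (\<integral>y. soft_max_le \<beta> J a I (d y) x \<partial>\<nu>)\<bar> \<le> ?C * ?e i" for x
    proof -
      have "C3_bound (A i) ((8 * (2 * \<beta> ^ 3)) ^ card J) (\<lambda>y. \<Prod>j\<in>J. soft_step \<beta> ((c j + (\<Sum>k\<in>I. a j k * x k)) + a j i * y))"
        using insert.prems assms by (intro C3_bound_prod C3_bound_soft_step) auto
      also have "(\<lambda>y. \<Prod>j\<in>J. soft_step \<beta> ((c j + (\<Sum>k\<in>I. a j k * x k)) + a j i * y)) = (\<lambda>y. soft_max_le \<beta> J a I (d y) x)"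
        by (simp add: soft_max_le_def d_def add_ac)
      finally show ?thesis
        using standardized_integral_cong[OF \<mu> \<nu>, of "A i" "?C"] insert.prems(2) by (simp add: mult.assoc)
    qed
    have "\<bar>(\<integral>x. \<integral>y. soft_max_le \<beta> J a I (d y) x \<partial>\<mu> \<partial>?M\<mu>) - (\<integral>x. \<integral>y. soft_max_le \<beta> J a I (d y) x \<partial>\<nu> \<partial>?M\<mu>)\<bar>
      = \<bar>\<integral>x. (\<integral>y. soft_max_le \<beta> J a I (d y) x \<partial>\<mu>) - (\<integral>y. soft_max_le \<beta> J a I (d y) x \<partial>\<nu>) \<partial>?M\<mu>\<bar>"
      using i by simp
    also have "\<dots> \<le> (\<integral>x. ?C * ?e i \<partial>?M\<mu>)"
      using i pw by (intro order_trans[OF integral_abs_bound integral_mono]) auto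
    finally show ?thesis by (simp add: R.prob_space)
  qed
  \<comment> \<open>Variable \<open>i\<close> now has law \<nu> and, by Fubini, is integrated
    outermost; for each of its values the induction hypothesis with offsets \<open>d y\<close>
    exchanges all the others.\<close>
  have 2: "\<bar>(\<integral>y. \<integral>x. soft_max_le \<beta> J a I (d y) x \<partial>?M\<mu> \<partial>\<nu>) - (\<integral>y. \<integral>x. soft_max_le \<beta> J a I (d y) x \<partial>?M\<nu> \<partial>\<nu>)\<bar> \<le> ?C * (\<Sum>i\<in>I. ?e i)"
  proof -
    have mi: "(\<lambda>y. \<integral>x. soft_max_le \<beta> J a I (d y) x \<partial>PiM I (\<lambda>_. \<rho>)) \<in> borel_measurable \<nu>" if "\<rho> = \<mu> \<or> \<rho> = \<nu>" for \<rho>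
    proof -
      interpret R: prob_space "PiM I (\<lambda>_. \<rho>)" using that by (rule pP)
      have "(\<lambda>p. soft_max_le \<beta> J a I (d (fst p)) (snd p)) \<in> borel_measurable (\<nu> \<Otimes>\<^sub>M PiM I (\<lambda>_. \<rho>))"
        using that comp unfolding d_def
        by (intro soft_max_le_measurable) (auto intro: measurable_compose[OF measurable_snd])
      then show ?thesis by (auto intro!: R.borel_measurable_lebesgue_integral simp: split_beta')
    qed
    have bb: "0 \<le> (\<integral>x. soft_max_le \<beta> J a I (d y) x \<partial>PiM I (\<lambda>_. \<rho>))" "(\<integral>x. soft_max_le \<beta> J a I (d y) x \<partial>PiM I (\<lambda>_. \<rho>)) \<le> 1" if "\<rho> = \<mu> \<or> \<rho> = \<nu>" for \<rho> y
      using soft_max_le_bounds int[OF pP[OF that] Dx[OF that]] pP[OF that]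
      by (auto intro!: integral_nonneg_AE prob_space.integral_le_const)
    have i: "integrable \<nu> (\<lambda>y. \<integral>x. soft_max_le \<beta> J a I (d y) x \<partial>PiM I (\<lambda>_. \<rho>))" if "\<rho> = \<mu> \<or> \<rho> = \<nu>" for \<rho>
      using that mi bb by (intro int \<nu>.prob_space_axioms) auto
    have "\<bar>(\<integral>y. \<integral>x. soft_max_le \<beta> J a I (d y) x \<partial>?M\<mu> \<partial>\<nu>) - (\<integral>y. \<integral>x. soft_max_le \<beta> J a I (d y) x \<partial>?M\<nu> \<partial>\<nu>)\<bar>
      = \<bar>\<integral>y. (\<integral>x. soft_max_le \<beta> J a I (d y) x \<partial>?M\<mu>) - (\<integral>x. soft_max_le \<beta> J a I (d y) x \<partial>?M\<nu>) \<partial>\<nu>\<bar>"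
      using i by simp
    also have "\<dots> \<le> (\<integral>y. ?C * (\<Sum>i\<in>I. ?e i) \<partial>\<nu>)"
      using i insert.IH insert.prems by (intro order_trans[OF integral_abs_bound integral_mono]) auto
    finally show ?thesis by (simp add: \<nu>.prob_space)
  qed
  have "?C * (\<Sum>i\<in>insert i I. ?e i) = ?C * ?e i + ?C * (\<Sum>i\<in>I. ?e i)"
    using insert.hyps by (simp add: distrib_left)
  then show ?case
    using 1 2 unfolding split[of \<mu>, simplified] split[of \<nu>, simplified] fub[of \<mu>, simplified] fub[of \<nu>, simplified]
    by linarith
qed

section \<open>The residual walk on a grid\<close>

text \<open>The minus sign makes rejection an upward crossing. The value at time \<open>k\<close>
  involves the first k + 1 errors, an offset by one that recurs in all index sets below.\<close>

definition resid_walk :: "nat \<Rightarrow> (nat \<Rightarrow> real) \<Rightarrow> nat \<Rightarrow> real" where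
  "resid_walk N x k = - (\<Sum>i=1..k. std_residual x i) / sqrt (real N)"

text \<open>The weight of error \<open>i\<close> in minus the sum of the first \<open>k\<close>
  residuals. Each step brings in the newest error k + 2 and the mean of the k + 1 older
  ones.\<close>

primrec resid_coeff :: "nat \<Rightarrow> nat \<Rightarrow> real" where
  "resid_coeff 0 i = 0"
| "resid_coeff (Suc k) i = resid_coeff k i - sqrt (real (k + 1) / real (k + 2)) *
     (if i = k + 2 then 1 else if i \<le> k + 1 then - 1 / real (k + 1) else 0)"

lemma sum_resid_coeff:
  "k + 1 \<le> n \<Longrightarrow> (\<Sum>i=1..n. resid_coeff k i * x i) = - (\<Sum>i=1..k. std_residual x i)"
proof (induction k)
  case (Suc k)
  have "(\<Sum>i=1..n. (if i = k + 2 then 1 else if i \<le> k + 1 then - 1 / real (k + 1) else 0) * x i)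
      = (\<Sum>i=1..n. (if i = k + 2 then x i else 0)) + (\<Sum>i=1..n. (if i \<in> {1..k + 1} then - 1 / real (k + 1) * x i else 0))"
    unfolding sum.distrib[symmetric] by (rule sum.cong) auto
  also have "\<dots> = x (k + 2) + (\<Sum>i\<in>{1..n} \<inter> {1..k + 1}. - 1 / real (k + 1) * x i)"
    using Suc.prems by (simp only: sum.inter_restrict[OF finite_atLeastAtMost] sum.delta finite_atLeastAtMost) simp
  also have "{1..n} \<inter> {1..k + 1} = {1..k + 1}" using Suc.prems by auto
  finally have "(\<Sum>i=1..n. (if i = k + 2 then 1 else if i \<le> k + 1 then - 1 / real (k + 1) else 0) * x i)
      = x (k + 2) - (\<Sum>i=1..k + 1. x i) / real (k + 1)"
    by (simp only: sum_distrib_left[symmetric]) simp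
  then have "std_residual x (k + 1) = sqrt (real (k + 1) / real (k + 2)) *
      (\<Sum>i=1..n. (if i = k + 2 then 1 else if i \<le> k + 1 then - 1 / real (k + 1) else 0) * x i)"
    by (simp add: std_residual_def)
  then show ?case
    using Suc by (simp add: left_diff_distrib sum_subtractf sum_distrib_left mult.assoc)
qed simp

section \<open>Power sums of the coefficient bounds\<close>

definition harm_tail :: "nat \<Rightarrow> nat \<Rightarrow> real" where
  "harm_tail N i = 1 + (\<Sum>l=i..N. 1 / real l)"

lemma harm_tail_ge_1: "harm_tail N i \<ge> 1"
  unfolding harm_tail_def by (simp add: sum_nonneg)

text \<open>An error enters with weight at most 1 when it is the newest observation, and afterwards
  with weight at most 1/l through each mean of l \<ge> i observations. These are the 1 and the
  harmonic sum in \<open>harm_tail\<close>.\<close>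

lemma abs_resid_coeff_le:
  assumes "i \<ge> 1"
  shows "\<bar>resid_coeff k i\<bar> \<le> (if i \<le> k + 1 then harm_tail k i else 0)"
proof (induction k)
  case 0
  show ?case using harm_tail_ge_1[of 0 i] by simp
next
  case (Suc k)
  let ?r = "sqrt (real (k + 1) / real (k + 2))"
  have r: "0 \<le> ?r" "?r \<le> 1" by (simp_all)
  consider "i \<le> k + 1" | "i = k + 2" | "i > k + 2" by linarith
  then show ?case
  proof cases
    case 1
    then have "harm_tail (Suc k) i = harm_tail k i + 1 / real (k + 1)"
      using assms by (simp add: harm_tail_def)
    moreover have "?r * (1 / real (k + 1)) \<le> 1 / real (k + 1)"
      using r mult_right_mono[of ?r 1 "1 / real (k + 1)"] by simp
    moreover have "0 \<le> ?r * (1 / real (k + 1))" by simp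
    moreover have "resid_coeff (Suc k) i = resid_coeff k i + ?r * (1 / real (k + 1))"
      using 1 by simp
    moreover have "\<bar>resid_coeff k i\<bar> \<le> harm_tail k i" using Suc 1 by simp
    moreover have "i \<le> Suc k + 1" using 1 by simp
    ultimately show ?thesis by (simp only: if_True)
  next
    case 2
    then have "\<bar>resid_coeff (Suc k) i\<bar> = ?r" using Suc by simp
    also have "\<dots> \<le> harm_tail (Suc k) i"
      using r(2) harm_tail_ge_1[of "Suc k" i] by (rule order_trans)
    finally show ?thesis using 2 by simp
  next
    case 3
    then show ?thesis using Suc by simp
  qed
qed

lemma abs_resid_coeff_le':
  assumes "i \<ge> 1" "k \<le> N"
  shows "\<bar>resid_coeff k i\<bar> \<le> harm_tail N i"
proof -
  have "harm_tail k i \<le> harm_tail N i"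
    using assms unfolding harm_tail_def by (intro add_left_mono sum_mono2) auto
  moreover have "0 \<le> harm_tail N i" using harm_tail_ge_1[of N i] by simp
  ultimately show ?thesis
    using abs_resid_coeff_le[OF assms(1), of k] by (auto split: if_splits)
qed

lemma sum_harm_tail_Suc:
  "(\<Sum>i=1..N + 2. f (harm_tail (N + 1) i)) = (\<Sum>i=1..N + 1. f (harm_tail N i + 1 / real (N + 1))) + f 1"
proof -
  have "harm_tail (N + 1) i = harm_tail N i + 1 / real (N + 1)" if "i \<in> {1..N + 1}" for i
    using that by (simp add: harm_tail_def)
  moreover have "harm_tail (N + 1) (N + 2) = 1" by (simp add: harm_tail_def)
  ultimately show ?thesis by simp
qed

lemma sum_add_square:
  fixes u :: real
  shows "(\<Sum>i\<in>A. (h i + u) ^ 2) = (\<Sum>i\<in>A. h i ^ 2) + 2 * (u * (\<Sum>i\<in>A. h i)) + u * (u * real (card A))"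
proof -
  have "(\<Sum>i\<in>A. (h i + u) ^ 2) = (\<Sum>i\<in>A. h i ^ 2 + 2 * (u * h i) + u * u)"
    by (intro sum.cong) (simp_all add: power2_eq_square algebra_simps)
  then show ?thesis by (simp add: sum.distrib sum_distrib_left mult_ac)
qed

lemma sum_add_cube:
  fixes u :: real
  shows "(\<Sum>i\<in>A. (h i + u) ^ 3) = (\<Sum>i\<in>A. h i ^ 3) + 3 * (u * (\<Sum>i\<in>A. h i ^ 2))
    + 3 * (u * (u * (\<Sum>i\<in>A. h i))) + u * (u * (u * real (card A)))"
proof -
  have "(\<Sum>i\<in>A. (h i + u) ^ 3) = (\<Sum>i\<in>A. h i ^ 3 + 3 * (u * h i ^ 2) + 3 * (u * (u * h i)) + u * (u * u))"
    by (intro sum.cong) (simp_all add: power2_eq_square power3_eq_cube algebra_simps)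
  then show ?thesis by (simp add: sum.distrib sum_distrib_left mult_ac)
qed

text \<open>Passing from N to N + 1 raises each of the N + 1 terms by 1/(N + 1) and appends a term
  1. Expanding the powers gives constants that reproduce themselves: 2 = 1 + 1, 6 = 2*2 + 1 + 1 and
  26 = 3*6 + 3*2 + 1 + 1. Each power uses the bounds for the lower ones, hence the joint
  induction.\<close>

lemma sum_harm_tail_powers:
  "(\<Sum>i=1..N + 1. harm_tail N i) \<le> 2 * real (N + 1)"
  "(\<Sum>i=1..N + 1. harm_tail N i ^ 2) \<le> 6 * real (N + 1)"
  "(\<Sum>i=1..N + 1. harm_tail N i ^ 3) \<le> 26 * real (N + 1)"
proof (induction N)
  case 0
  { case 1 show ?case by (simp add: harm_tail_def) }
  { case 2 show ?case by (simp add: harm_tail_def) }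
  { case 3 show ?case by (simp add: harm_tail_def) }
next
  case (Suc N)
  define u where "u = 1 / real (N + 1)"
  have u: "0 \<le> u" "u \<le> 1" "u * real (N + 1) = 1" by (simp_all add: u_def)
  have u1: "u * (\<Sum>i=1..N + 1. harm_tail N i) \<le> 2" and u2: "u * (\<Sum>i=1..N + 1. harm_tail N i ^ 2) \<le> 6"
    using mult_left_mono[OF Suc.IH(1) u(1)] mult_left_mono[OF Suc.IH(2) u(1)]
    unfolding mult.left_commute[of u 2] mult.left_commute[of u 6] u(3) by simp_all
  { case 1
    have "(\<Sum>i=1..N + 1. harm_tail N i + u) = (\<Sum>i=1..N + 1. harm_tail N i) + 1"
      using u(3) by (simp add: sum.distrib mult.commute)
    then show ?case using sum_harm_tail_Suc[of "\<lambda>h. h" N] Suc.IH(1) by (simp add: u_def) }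
  { case 2
    have "(\<Sum>i=1..N + 1. (harm_tail N i + u) ^ 2)
       = (\<Sum>i=1..N + 1. harm_tail N i ^ 2) + 2 * (u * (\<Sum>i=1..N + 1. harm_tail N i)) + u * (u * real (N + 1))"
      using sum_add_square[where A = "{1..N + 1}"] by simp
    then have "(\<Sum>i=1..N + 1. (harm_tail N i + u) ^ 2) \<le> 6 * real (N + 1) + 2 * 2 + 1"
      using Suc.IH(2) u1 u by simp
    then show ?case using sum_harm_tail_Suc[of "\<lambda>h. h ^ 2" N] by (simp add: u_def) }
  { case 3
    have "(\<Sum>i=1..N + 1. (harm_tail N i + u) ^ 3)
       = (\<Sum>i=1..N + 1. harm_tail N i ^ 3) + 3 * (u * (\<Sum>i=1..N + 1. harm_tail N i ^ 2))
         + 3 * (u * (u * (\<Sum>i=1..N + 1. harm_tail N i))) + u * (u * (u * real (N + 1)))"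
      using sum_add_cube[where A = "{1..N + 1}"] by simp
    moreover have "u * (u * (\<Sum>i=1..N + 1. harm_tail N i)) \<le> 2"
      using mult_left_mono[OF u1 u(1)] u by simp
    moreover have "u * (u * (u * real (N + 1))) \<le> 1" using u mult_le_one[of u u] by simp
    ultimately have "(\<Sum>i=1..N + 1. (harm_tail N i + u) ^ 3) \<le> 26 * real (N + 1) + 3 * 6 + 3 * 2 + 1"
      using Suc.IH(3) u2 by linarith
    then show ?case using sum_harm_tail_Suc[of "\<lambda>h. h ^ 3" N] by (simp add: u_def) }
qed


text \<open>Beyond the truncation level \<open>t\<close> the minimum is bounded by 1, below it by A
  t, and the second moment is 1.\<close>

lemma taylor_error_le:
  assumes "standardized \<mu>" "A \<ge> 0" "t \<ge> 0"
  shows "taylor_error \<mu> A \<le> (\<integral>x. x\<^sup>2 * indicator {x. \<bar>x\<bar> > t} x \<partial>\<mu>) + A * t"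
proof -
  have s[measurable_cong]: "sets \<mu> = sets borel" and sq: "integrable \<mu> (\<lambda>x. x\<^sup>2)" "(\<integral>x. x\<^sup>2 \<partial>\<mu>) = 1"
    using assms by (simp_all add: standardized_def)
  have i: "integrable \<mu> (\<lambda>x. x\<^sup>2 * indicator {x. \<bar>x\<bar> > t} x)"
    by (rule Bochner_Integration.integrable_bound[OF sq(1)]) (auto simp: indicator_def)
  have "taylor_error \<mu> A \<le> (\<integral>x. x\<^sup>2 * indicator {x. \<bar>x\<bar> > t} x + A * t * x\<^sup>2 \<partial>\<mu>)"
    unfolding taylor_error_def
  proof (rule integral_mono[OF integrable_taylor_error[OF assms(1,2)]])
    show "integrable \<mu> (\<lambda>x. x\<^sup>2 * indicator {x. \<bar>x\<bar> > t} x + A * t * x\<^sup>2)" using i sq by simp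
    fix x :: real
    show "x\<^sup>2 * min 1 (A * \<bar>x\<bar>) \<le> x\<^sup>2 * indicator {x. \<bar>x\<bar> > t} x + A * t * x\<^sup>2"
    proof (cases "\<bar>x\<bar> > t")
      case True
      have "x\<^sup>2 * min 1 (A * \<bar>x\<bar>) \<le> x\<^sup>2 * 1" by (intro mult_left_mono) auto
      moreover have "0 \<le> A * t * x\<^sup>2" using assms by simp
      ultimately show ?thesis using True by simp
    next
      case False
      have "x\<^sup>2 * min 1 (A * \<bar>x\<bar>) \<le> x\<^sup>2 * (A * t)"
        using False assms by (intro mult_left_mono) (auto simp: min_le_iff_disj intro!: disjI2 mult_left_mono)
      then show ?thesis using False by (simp add: mult_ac)
    qed
  qed
  also have "\<dots> = (\<integral>x. x\<^sup>2 * indicator {x. \<bar>x\<bar> > t} x \<partial>\<mu>) + A * t"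
    using i sq by simp
  finally show ?thesis .
qed

text \<open>Truncating at the Lindeberg level \<delta> sqrt (N + 1), the same for all
  \<open>i\<close>, leaves the sums of squares and of cubes of the coefficients. Because N + 1 \<le>
  2 N and sqrt (N + 1) \<le> 2 sqrt N, the constants are 12 = 6*2 and 104 = 26*2*2.\<close>

lemma sum_taylor_error_le:
  assumes \<mu>: "standardized \<mu>" and "N \<ge> 1" "\<delta> > 0"
  defines "A \<equiv> \<lambda>i. harm_tail N i / sqrt (real N)"
  shows "(\<Sum>i=1..N + 1. (A i)\<^sup>2 * taylor_error \<mu> (A i))
    \<le> 12 * (\<integral>x. x\<^sup>2 * indicator {x. \<bar>x\<bar> > \<delta> * sqrt (real (N + 1))} x \<partial>\<mu>) + 104 * \<delta>"
proof -
  let ?L = "\<integral>x. x\<^sup>2 * indicator {x. \<bar>x\<bar> > \<delta> * sqrt (real (N + 1))} x \<partial>\<mu>"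
  define t where "t = \<delta> * sqrt (real (N + 1))"
  have N: "real N > 0" "real (N + 1) \<le> 2 * real N" using assms by simp_all
  have L: "?L \<ge> 0" by (intro integral_nonneg_AE) simp
  have A: "A i \<ge> 0" for i using harm_tail_ge_1[of N i] by (simp add: A_def)
  have "(\<Sum>i=1..N + 1. (A i)\<^sup>2 * taylor_error \<mu> (A i)) \<le> (\<Sum>i=1..N + 1. (A i)\<^sup>2 * (?L + A i * t))"
    using taylor_error_le[OF \<mu> A, of t] assms unfolding t_def by (intro sum_mono mult_left_mono) auto
  also have "\<dots> = (\<Sum>i=1..N + 1. (A i)\<^sup>2) * ?L + (\<Sum>i=1..N + 1. A i ^ 3) * t"
    by (simp only: distrib_left sum.distrib sum_distrib_right) (simp add: power2_eq_square power3_eq_cube mult_ac)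
  also have "(\<Sum>i=1..N + 1. (A i)\<^sup>2) * ?L \<le> 12 * ?L"
  proof (rule mult_right_mono[OF _ L])
    have "(\<Sum>i=1..N + 1. (A i)\<^sup>2) = (\<Sum>i=1..N + 1. harm_tail N i ^ 2) / real N"
      by (simp only: A_def power_divide sum_divide_distrib) simp
    also have "\<dots> \<le> 12"
      using sum_harm_tail_powers(2)[of N] N by (simp add: divide_le_eq)
    finally show "(\<Sum>i=1..N + 1. (A i)\<^sup>2) \<le> 12" .
  qed
  also have "(\<Sum>i=1..N + 1. A i ^ 3) * t \<le> 104 * \<delta>"
  proof -
    have s3: "sqrt (real N) ^ 3 = real N * sqrt (real N)" by (simp add: power3_eq_cube)
    have "(\<Sum>i=1..N + 1. A i ^ 3) = (\<Sum>i=1..N + 1. harm_tail N i ^ 3) / sqrt (real N) ^ 3"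
      by (simp only: A_def power_divide sum_divide_distrib)
    also have "\<dots> \<le> 52 * real N / (real N * sqrt (real N))"
      unfolding s3 using sum_harm_tail_powers(3)[of N] N by (intro divide_right_mono) auto
    also have "\<dots> = 52 / sqrt (real N)" using N by simp
    finally have "(\<Sum>i=1..N + 1. A i ^ 3) * t \<le> 52 / sqrt (real N) * t"
      using assms by (intro mult_right_mono) (auto simp: t_def)
    also have "\<dots> \<le> 52 / sqrt (real N) * (\<delta> * (2 * sqrt (real N)))"
    proof -
      have "sqrt (real (N + 1)) \<le> sqrt (4 * real N)" using N by (intro real_sqrt_le_mono) simp
      also have "\<dots> = 2 * sqrt (real N)" by (simp add: real_sqrt_mult)
      finally show ?thesis unfolding t_def using assms by (intro mult_left_mono) auto
    qed
    also have "\<dots> = 104 * \<delta>" using N by (simp add: field_simps)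
    finally show ?thesis .
  qed
  finally show ?thesis by simp
qed

section \<open>Sandwiching the distribution of a maximum between smooth functionals\<close>

lemma soft_step_minus: "soft_step \<beta> (- x) = 1 - soft_step \<beta> x"
  by (simp add: soft_step_def field_simps)

lemma soft_step_antimono: "\<beta> \<ge> 0 \<Longrightarrow> x \<le> y \<Longrightarrow> soft_step \<beta> y \<le> soft_step \<beta> x"
  by (auto simp: soft_step_def intro: mult_left_mono)

lemma soft_step_tendsto_0:
  assumes "d > 0"
  shows "((\<lambda>\<beta>. soft_step \<beta> d) \<longlongrightarrow> 0) at_top"
proof -
  have "filterlim (\<lambda>\<beta>. \<beta> * d) at_top at_top"
    using filterlim_tendsto_pos_mult_at_top[OF tendsto_const assms filterlim_ident] by (simp add: mult.commute)
  then have "((\<lambda>\<beta>. tanh (\<beta> * d)) \<longlongrightarrow> 1) at_top"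
    by (rule filterlim_compose[OF tanh_real_at_top])
  then have "((\<lambda>\<beta>. (1 - tanh (\<beta> * d)) / 2) \<longlongrightarrow> (1 - 1) / 2) at_top"
    by (intro tendsto_intros) auto
  then show ?thesis by (simp add: soft_step_def)
qed

text \<open>If some value exceeds b + d, a single factor already pushes the product below
  \<open>soft_step \<beta> d\<close>. If all values are at most b - d, every factor is at least one
  minus this quantity, and Bernoulli's inequality bounds the product from below.\<close>

lemma (in prob_space) prob_max_soft_step:
  fixes U :: "nat \<Rightarrow> 'a \<Rightarrow> real" and b :: real
  assumes [measurable]: "\<And>j. j \<in> J \<Longrightarrow> U j \<in> borel_measurable M" and J: "finite J" and "\<beta> \<ge> 0" "d \<ge> 0"
  defines "F \<equiv> expectation (\<lambda>\<omega>. \<Prod>j\<in>J. soft_step \<beta> (U j \<omega> - b))"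
  shows "prob {\<omega> \<in> space M. \<exists>j\<in>J. U j \<omega> > b + d} \<le> 1 - F + soft_step \<beta> d"
    and "1 - real (card J) * soft_step \<beta> d - prob {\<omega> \<in> space M. \<exists>j\<in>J. U j \<omega> > b - d} \<le> F"
proof -
  let ?f = "\<lambda>\<omega>. \<Prod>j\<in>J. soft_step \<beta> (U j \<omega> - b)"
  have ev: "{\<omega> \<in> space M. \<exists>j\<in>J. U j \<omega> > c} \<in> events" for c
    using J by (intro sets.sets_Collect_finite_Ex) auto
  have f01: "0 \<le> ?f \<omega>" "?f \<omega> \<le> 1" for \<omega>
    using soft_step_bounds by (auto intro!: prod_nonneg prod_le_1)
  have "?f \<in> borel_measurable M"
    by (intro borel_measurable_prod measurable_compose[OF _ soft_step_measurable]) auto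
  then have fi: "integrable M ?f"
    using f01 by (intro integrable_const_bound[of _ 1]) auto
  have ind: "integrable M (indicator {\<omega> \<in> space M. \<exists>j\<in>J. U j \<omega> > c} :: 'a \<Rightarrow> real)" for c
    using ev[of c] by (intro integrable_real_indicator) (auto simp: less_top[symmetric])
  have e: "soft_step \<beta> d \<ge> 0" "soft_step \<beta> d \<le> 1" using soft_step_bounds by auto
  have "F \<le> expectation (\<lambda>\<omega>. 1 + soft_step \<beta> d - indicator {\<omega> \<in> space M. \<exists>j\<in>J. U j \<omega> > b + d} \<omega>)"
    unfolding F_def
  proof (rule integral_mono[OF fi])
    fix \<omega> assume "\<omega> \<in> space M"
    show "?f \<omega> \<le> 1 + soft_step \<beta> d - indicator {\<omega> \<in> space M. \<exists>j\<in>J. U j \<omega> > b + d} \<omega>"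
    proof (cases "\<exists>j\<in>J. U j \<omega> > b + d")
      case True
      then obtain j where j: "j \<in> J" "U j \<omega> > b + d" by blast
      have "?f \<omega> = soft_step \<beta> (U j \<omega> - b) * (\<Prod>j\<in>J - {j}. soft_step \<beta> (U j \<omega> - b))"
        using J j by (simp add: prod.remove)
      also have "\<dots> \<le> soft_step \<beta> d * 1"
        using soft_step_bounds j \<open>\<beta> \<ge> 0\<close>
        by (intro mult_mono soft_step_antimono prod_le_1 prod_nonneg) auto
      finally show ?thesis using True \<open>\<omega> \<in> space M\<close> by simp
    next
      case False
      then show ?thesis using f01[of \<omega>] e by simp
    qed
  qed (use ind in \<open>auto intro!: Bochner_Integration.integrable_diff\<close>)
  also have "\<dots> = 1 + soft_step \<beta> d - prob {\<omega> \<in> space M. \<exists>j\<in>J. U j \<omega> > b + d}"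
    using ev[of "b + d"] ind[of "b + d"] by (simp add: prob_space)
  finally show "prob {\<omega> \<in> space M. \<exists>j\<in>J. U j \<omega> > b + d} \<le> 1 - F + soft_step \<beta> d" by simp
  have "1 - real (card J) * soft_step \<beta> d - prob {\<omega> \<in> space M. \<exists>j\<in>J. U j \<omega> > b - d}
      = expectation (\<lambda>\<omega>. 1 - real (card J) * soft_step \<beta> d - indicator {\<omega> \<in> space M. \<exists>j\<in>J. U j \<omega> > b - d} \<omega>)"
    using ev[of "b - d"] ind[of "b - d"] by (simp add: prob_space)
  also have "\<dots> \<le> F"
    unfolding F_def
  proof (rule integral_mono[OF _ fi])
    fix \<omega> assume "\<omega> \<in> space M"
    show "1 - real (card J) * soft_step \<beta> d - indicator {\<omega> \<in> space M. \<exists>j\<in>J. U j \<omega> > b - d} \<omega> \<le> ?f \<omega>"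
    proof (cases "\<exists>j\<in>J. U j \<omega> > b - d")
      case True
      have "0 \<le> real (card J) * soft_step \<beta> d" using e by simp
      then show ?thesis using True \<open>\<omega> \<in> space M\<close> f01[of \<omega>] by simp
    next
      case False
      have "1 - real (card J) * soft_step \<beta> d \<le> (1 - soft_step \<beta> d) ^ card J"
        using Bernoulli_inequality[of "- soft_step \<beta> d" "card J"] e by simp
      also have "\<dots> = (\<Prod>j\<in>J. 1 - soft_step \<beta> d)" by simp
      also have "\<dots> \<le> ?f \<omega>"
      proof (intro prod_mono conjI)
        fix j assume "j \<in> J"
        then have "U j \<omega> - b \<le> - d" using False by force
        then show "1 - soft_step \<beta> d \<le> soft_step \<beta> (U j \<omega> - b)"
          using soft_step_antimono[OF \<open>\<beta> \<ge> 0\<close>] by (simp flip: soft_step_minus)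
      qed (use e in simp)
      finally show ?thesis using False by simp
    qed
  qed (use ind in \<open>auto intro!: Bochner_Integration.integrable_diff\<close>)
  finally show "1 - real (card J) * soft_step \<beta> d - prob {\<omega> \<in> space M. \<exists>j\<in>J. U j \<omega> > b - d} \<le> F" .
qed

text \<open>Lindeberg's condition for rows of identically distributed variables with variance 1,
  expressed by the common law of each row: the n equal summands cancel against s^2 = n.\<close>

definition lindeberg_laws :: "(nat \<Rightarrow> real measure) \<Rightarrow> bool" where
  "lindeberg_laws \<mu> \<longleftrightarrow> (\<forall>\<delta>>0. (\<lambda>n. \<integral>x. x\<^sup>2 * indicator {x. \<bar>x\<bar> > \<delta> * sqrt (real n)} x \<partial>\<mu> n) \<longlonglongrightarrow> 0)"

lemma resid_walk_eq_sum:
  assumes "k + 1 \<le> n"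
  shows "resid_walk N x k = (\<Sum>i=1..n. resid_coeff k i / sqrt (real N) * x i)"
  unfolding resid_walk_def sum_resid_coeff[OF assms, symmetric] by (simp add: sum_divide_distrib)

lemma resid_walk_measurable:
  assumes "k + 1 \<le> n" "sets \<mu> = sets borel"
  shows "(\<lambda>x. resid_walk N x k) \<in> borel_measurable (PiM {1..n} (\<lambda>_. \<mu>))"
  unfolding resid_walk_eq_sum[OF assms(1)]
proof (intro borel_measurable_sum borel_measurable_times borel_measurable_const)
  fix i assume "i \<in> {1..n}"
  then show "(\<lambda>x. x i) \<in> borel_measurable (PiM {1..n} (\<lambda>_. \<mu>))"
    using measurable_component_singleton[of i "{1..n}" "\<lambda>_. \<mu>"] by (simp add: measurable_cong_sets[OF refl assms(2)])
qed

text \<open>The smoothing parameter \<beta> is fixed by \<open>d\<close>, \<eta> and the size of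
  \<open>J\<close> alone; afterwards n may grow until the replacement error is small. The times
  \<kappa> may move with n, since the coefficient bounds hold uniformly over them. The hypotheses
  are symmetric in the two laws, so both directions are available.\<close>

lemma grid_comparison:
  fixes \<kappa> :: "nat \<Rightarrow> nat \<Rightarrow> nat"
  assumes \<mu>: "\<And>n. n \<ge> 1 \<Longrightarrow> standardized (\<mu> n)" and \<nu>: "\<And>n. n \<ge> 1 \<Longrightarrow> standardized (\<nu> n)"
    and L\<mu>: "lindeberg_laws \<mu>" and L\<nu>: "lindeberg_laws \<nu>" and J: "finite J"
    and \<kappa>: "\<And>n j. j \<in> J \<Longrightarrow> \<kappa> n j \<le> n - 1" and "d > 0" "\<eta> > 0"
  shows "\<forall>\<^sub>F n in sequentially.
    measure (PiM {1..n} (\<lambda>_. \<mu> n)) {x \<in> space (PiM {1..n} (\<lambda>_. \<mu> n)). \<exists>j\<in>J. resid_walk (n - 1) x (\<kappa> n j) > b}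
    \<le> measure (PiM {1..n} (\<lambda>_. \<nu> n)) {x \<in> space (PiM {1..n} (\<lambda>_. \<nu> n)). \<exists>j\<in>J. resid_walk (n - 1) x (\<kappa> n j) > b - d} + \<eta>"
proof -
  \<comment> \<open>One smoothing error comes from the upper half of the sandwich and
    \<open>card J\<close> of them from the lower half.\<close>
  define m where "m = real (card J) + 1"
  have m: "m \<ge> 1" by (simp add: m_def)
  have "\<forall>\<^sub>F \<beta> in at_top. soft_step \<beta> (d / 2) < \<eta> / (2 * m)"
    using \<open>d > 0\<close> \<open>\<eta> > 0\<close> m by (intro order_tendstoD(2)[OF soft_step_tendsto_0]) auto
  then have "\<forall>\<^sub>F \<beta> in at_top. soft_step \<beta> (d / 2) < \<eta> / (2 * m) \<and> \<beta> \<ge> 1"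
    using eventually_ge_at_top by (rule eventually_conj)
  then obtain \<beta> where \<beta>: "soft_step \<beta> (d / 2) < \<eta> / (2 * m)" "\<beta> \<ge> 1"
    by (auto dest: eventually_happens)
  define C where "C = (16 * \<beta> ^ 3) ^ card J"
  have C: "C > 0" using \<beta> by (simp add: C_def)
  \<comment> \<open>As 832 = 8 * 104 and 96 = 8 * 12, each of the four error terms, two for each
    law, amounts to at most \<eta>/8.\<close>
  define \<delta> where "\<delta> = \<eta> / (832 * C)"
  have \<delta>: "\<delta> > 0" using C \<open>\<eta> > 0\<close> by (simp add: \<delta>_def)
  let ?L = "\<lambda>\<rho> n. \<integral>x. x\<^sup>2 * indicator {x. \<bar>x\<bar> > \<delta> * sqrt (real n)} x \<partial>\<rho> n"
  have "\<forall>\<^sub>F n in sequentially. ?L \<rho> n < \<eta> / (96 * C)" if "lindeberg_laws \<rho>" for \<rho>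
  proof -
    have "?L \<rho> \<longlonglongrightarrow> 0" using that \<delta> unfolding lindeberg_laws_def by blast
    then show ?thesis by (rule order_tendstoD(2)) (use C \<open>\<eta> > 0\<close> in simp)
  qed
  from this[OF L\<mu>] this[OF L\<nu>] eventually_ge_at_top[of 2]
  show ?thesis
  proof eventually_elim
    case (elim n)
    define N where "N = n - 1"
    have N: "N \<ge> 1" "n = N + 1" using elim by (simp_all add: N_def)
    have std: "standardized (\<mu> n)" "standardized (\<nu> n)" using \<mu> \<nu> elim by auto
    define A where "A = (\<lambda>i. harm_tail N i / sqrt (real N))"
    define a where "a j i = resid_coeff (\<kappa> n j) i / sqrt (real N)" for j i
    \<comment> \<open>Centred halfway between the two levels, so that the sandwich of half-width d/2
      reaches exactly b and b - d.\<close>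
    define F where "F \<rho> = (\<integral>x. soft_max_le \<beta> J a {1..n} (\<lambda>_. - (b - d / 2)) x \<partial>PiM {1..n} (\<lambda>_. \<rho>))" for \<rho>
    have soft: "soft_max_le \<beta> J a {1..n} (\<lambda>_. - (b - d / 2)) x
        = (\<Prod>j\<in>J. soft_step \<beta> (resid_walk N x (\<kappa> n j) - (b - d / 2)))" for x
      unfolding soft_max_le_def
    proof (rule prod.cong[OF refl])
      fix j assume "j \<in> J"
      then have "\<kappa> n j + 1 \<le> n" using \<kappa>[of j n] N by simp
      then show "soft_step \<beta> (- (b - d / 2) + (\<Sum>i=1..n. a j i * x i)) = soft_step \<beta> (resid_walk N x (\<kappa> n j) - (b - d / 2))"
        using resid_walk_eq_sum[of "\<kappa> n j" n N x] by (simp add: a_def algebra_simps)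
    qed
    have F_eq: "F \<rho> = (\<integral>x. (\<Prod>j\<in>J. soft_step \<beta> (resid_walk N x (\<kappa> n j) - (b - d / 2))) \<partial>PiM {1..n} (\<lambda>_. \<rho>))" for \<rho>
      unfolding F_def by (intro Bochner_Integration.integral_cong refl soft)
    have "\<bar>F (\<mu> n) - F (\<nu> n)\<bar> \<le> C * (\<Sum>i=1..n. (A i)\<^sup>2 * (taylor_error (\<mu> n) (A i) + taylor_error (\<nu> n) (A i)))"
      unfolding F_def C_def
    proof (rule lindeberg_replacement[OF std J \<beta>(2)])
      fix i j assume "i \<in> {1..n}" "j \<in> J"
      then show "\<bar>a j i\<bar> \<le> A i"
        using abs_resid_coeff_le'[of i "\<kappa> n j" N] \<kappa>[of j n] by (simp add: a_def A_def N_def abs_divide divide_right_mono)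
    next
      fix i show "A i \<ge> 0" using harm_tail_ge_1[of N i] by (simp add: A_def)
    qed simp
    also have "\<dots> = C * (\<Sum>i=1..n. (A i)\<^sup>2 * taylor_error (\<mu> n) (A i)) + C * (\<Sum>i=1..n. (A i)\<^sup>2 * taylor_error (\<nu> n) (A i))"
      by (simp add: distrib_left sum.distrib)
    also have "\<dots> \<le> C * (12 * (\<eta> / (96 * C)) + 104 * \<delta>) + C * (12 * (\<eta> / (96 * C)) + 104 * \<delta>)"
      using sum_taylor_error_le[OF std(1) N(1) \<delta>] sum_taylor_error_le[OF std(2) N(1) \<delta>] elim C
      unfolding A_def N(2)[symmetric] by (intro add_mono mult_left_mono) auto
    also have "\<dots> = \<eta> / 2" using C by (simp add: \<delta>_def field_simps)
    finally have F: "\<bar>F (\<mu> n) - F (\<nu> n)\<bar> \<le> \<eta> / 2" .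
    have meas: "(\<lambda>x. resid_walk N x (\<kappa> n j)) \<in> borel_measurable (PiM {1..n} (\<lambda>_. \<rho>))"
      if "standardized \<rho>" "j \<in> J" for \<rho> j
      using \<kappa>[of j n] that N by (intro resid_walk_measurable) (auto simp: standardized_def)
    have P: "prob_space (PiM {1..n} (\<lambda>_. \<rho>))" if "standardized \<rho>" for \<rho>
      using that by (intro prob_space_PiM) (simp add: standardized_def)
    have "measure (PiM {1..n} (\<lambda>_. \<mu> n)) {x \<in> space (PiM {1..n} (\<lambda>_. \<mu> n)). \<exists>j\<in>J. resid_walk N x (\<kappa> n j) > b}
        \<le> 1 - F (\<mu> n) + soft_step \<beta> (d / 2)"
      using prob_space.prob_max_soft_step(1)[where U = "\<lambda>j x. resid_walk N x (\<kappa> n j)" and \<beta> = \<beta>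
          and d = "d / 2" and b = "b - d / 2", OF P[OF std(1)] meas[OF std(1)] J] \<beta> \<open>d > 0\<close>
      by (simp add: F_eq)
    moreover have "1 - real (card J) * soft_step \<beta> (d / 2)
       - measure (PiM {1..n} (\<lambda>_. \<nu> n)) {x \<in> space (PiM {1..n} (\<lambda>_. \<nu> n)). \<exists>j\<in>J. resid_walk N x (\<kappa> n j) > b - d} \<le> F (\<nu> n)"
      using prob_space.prob_max_soft_step(2)[where U = "\<lambda>j x. resid_walk N x (\<kappa> n j)" and \<beta> = \<beta>
          and d = "d / 2" and b = "b - d / 2", OF P[OF std(2)] meas[OF std(2)] J] \<beta> \<open>d > 0\<close>
      by (simp add: F_eq)
    moreover have "m * soft_step \<beta> (d / 2) \<le> \<eta> / 2"
      using \<beta>(1) m by (simp add: field_simps)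
    ultimately show ?case
      using F unfolding N_def[symmetric] m_def distrib_right by linarith
  qed
qed

section \<open>The Gaussian walk on a grid\<close>

definition grid :: "nat \<Rightarrow> nat \<Rightarrow> nat \<Rightarrow> nat" where
  "grid m N j = (j * N) div m"

lemma grid_0 [simp]: "grid m N 0 = 0"
  by (simp add: grid_def)

lemma grid_last: "m \<ge> 1 \<Longrightarrow> grid m N m = N"
  by (simp add: grid_def)

lemma grid_mono: "i \<le> j \<Longrightarrow> grid m N i \<le> grid m N j"
  unfolding grid_def by (intro div_le_mono mult_le_mono1)

lemma grid_le: "m \<ge> 1 \<Longrightarrow> j \<le> m \<Longrightarrow> grid m N j \<le> N"
  using grid_mono[of j m m N] grid_last[of m N] by simp

text \<open>Rounding costs less than 1, and N \<ge> m makes this at most N/m: it keeps the blocks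
  nonempty and doubles the bound on their length.\<close>

lemma grid_step:
  assumes "m \<ge> 1" "N \<ge> m"
  shows "grid m N j < grid m N (j + 1)"
    and "real (grid m N (j + 1) - grid m N j) \<le> 2 * real N / real m"
proof -
  have "(j * N) div m + 1 = (j * N + m) div m" using assms by simp
  also have "\<dots> \<le> ((j + 1) * N) div m" using assms by (intro div_le_mono) simp
  finally show "grid m N j < grid m N (j + 1)" by (simp add: grid_def)
  have "real (grid m N (j + 1)) \<le> real ((j + 1) * N) / real m"
    unfolding grid_def by (rule of_nat_div_le_of_nat)
  moreover have "real (j * N) / real m < real (grid m N j) + 1"
  proof -
    have "j * N < m + grid m N j * m"
      unfolding grid_def by (rule dividend_less_div_times) (use assms in simp)
    then have "real (j * N) < real (m + grid m N j * m)" by (simp only: of_nat_less_iff)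
    then have "real (j * N) < (real (grid m N j) + 1) * real m" by (simp add: algebra_simps)
    then show ?thesis using assms by (simp add: divide_less_eq)
  qed
  moreover have "1 \<le> real N / real m" using assms by simp
  moreover have "real (grid m N (j + 1) - grid m N j) = real (grid m N (j + 1)) - real (grid m N j)"
    by (intro of_nat_diff grid_mono) simp
  moreover have "real ((j + 1) * N) / real m = real (j * N) / real m + real N / real m"
    by (simp add: add_divide_distrib distrib_right)
  ultimately show "real (grid m N (j + 1) - grid m N j) \<le> 2 * real N / real m" by simp
qed

context prob_space
begin

lemma normal_prob_symmetric:
  assumes D: "distributed M lborel D (normal_density 0 \<sigma>)" and "\<sigma> > 0"
  shows "prob {\<omega> \<in> space M. D \<omega> > 0} \<le> 1 / 2" and "prob {\<omega> \<in> space M. D \<omega> \<ge> 0} \<ge> 1 / 2"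
proof -
  have m[measurable]: "D \<in> borel_measurable M"
    using distributed_measurable[OF D] by simp
  have D': "distributed M lborel (\<lambda>\<omega>. - D \<omega>) (normal_density 0 \<sigma>)"
    using normal_density_affine[OF D \<open>\<sigma> > 0\<close>, of "-1" 0] by simp
  have "prob {\<omega> \<in> space M. D \<omega> > 0} = measure (distr M lborel D) {0<..}"
    by (subst measure_distr) (auto simp: vimage_def Int_def conj_commute)
  also have "distr M lborel D = distr M lborel (\<lambda>\<omega>. - D \<omega>)"
    using D D' by (simp add: distributed_def)
  also have "measure \<dots> {0<..} = prob {\<omega> \<in> space M. D \<omega> < 0}"
    by (subst measure_distr) (auto simp: vimage_def Int_def conj_commute)
  finally have eq: "prob {\<omega> \<in> space M. D \<omega> > 0} = prob {\<omega> \<in> space M. D \<omega> < 0}" .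
  have "prob {\<omega> \<in> space M. D \<omega> \<ge> 0} = 1 - prob {\<omega> \<in> space M. D \<omega> < 0}"
    by (subst prob_compl[symmetric]) (auto intro!: arg_cong[where f = prob])
  moreover have "prob {\<omega> \<in> space M. D \<omega> > 0} \<le> prob {\<omega> \<in> space M. D \<omega> \<ge> 0}"
    by (intro finite_measure_mono) auto
  ultimately show "prob {\<omega> \<in> space M. D \<omega> > 0} \<le> 1 / 2" "prob {\<omega> \<in> space M. D \<omega> \<ge> 0} \<ge> 1 / 2"
    using eq by simp_all
qed

text \<open>The fourth moment is chosen for the sake of the union bound over \<open>m\<close>
  increments of variance O(1/m): it leaves O(1/m), whereas Chebyshev's inequality would leave
  O(1).\<close>

lemma normal_tail_le:
  assumes D: "distributed M lborel D (normal_density 0 \<sigma>)" and "\<sigma> > 0" "d > 0"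
  shows "prob {\<omega> \<in> space M. D \<omega> > d} \<le> 3 * \<sigma> ^ 4 / d ^ 4"
proof -
  have m[measurable]: "D \<in> borel_measurable M"
    using distributed_measurable[OF D] by simp
  have "has_bochner_integral lborel (\<lambda>x. normal_density 0 \<sigma> x * x ^ 4) (3 * \<sigma> ^ 4)"
    using normal_moment_even[OF \<open>\<sigma> > 0\<close>, of 0 2] \<open>\<sigma> > 0\<close> by (simp add: fact_numeral power_divide field_simps)
  then have i: "integrable lborel (\<lambda>x. normal_density 0 \<sigma> x * x ^ 4)"
    "(\<integral>x. normal_density 0 \<sigma> x * x ^ 4 \<partial>lborel) = 3 * \<sigma> ^ 4"
    by (auto simp: has_bochner_integral_iff)
  have "integrable M (\<lambda>\<omega>. D \<omega> ^ 4)"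
    using i(1) by (subst distributed_integrable[OF D, symmetric]) auto
  moreover have "expectation (\<lambda>\<omega>. D \<omega> ^ 4) = 3 * \<sigma> ^ 4"
    using i(2) by (subst distributed_integral[OF D, symmetric]) auto
  ultimately have "prob {\<omega> \<in> space M. D \<omega> ^ 4 \<ge> d ^ 4} \<le> 3 * \<sigma> ^ 4 / d ^ 4"
    using integral_Markov_inequality_measure[of M "\<lambda>\<omega>. D \<omega> ^ 4" "{}" "d ^ 4"] \<open>d > 0\<close> by simp
  moreover have "prob {\<omega> \<in> space M. D \<omega> > d} \<le> prob {\<omega> \<in> space M. D \<omega> ^ 4 \<ge> d ^ 4}"
    using \<open>d > 0\<close> by (intro finite_measure_mono) (auto intro!: power_mono)
  ultimately show ?thesis by simp
qed

end

lemma std_normal_sum_residual: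
  assumes "A \<subseteq> {1..N}" "A \<noteq> {}"
  shows "distributed (std_normal_PiM {1..N + 1}) lborel (\<lambda>x. - (\<Sum>i\<in>A. std_residual x i) / sqrt (real N))
    (normal_density 0 (sqrt (real (card A) / real N)))"
proof -
  interpret prob_space "std_normal_PiM {1..N + 1}" by (rule prob_space_std_normal_PiM)
  have N: "N \<ge> 1" using assms by (cases N) auto
  have A: "finite A" using assms(1) finite_subset by blast
  then have c: "card A > 0" using assms by (simp add: card_gt_0_iff)
  have "distributed (std_normal_PiM {1..N + 1}) lborel (\<lambda>x. \<Sum>i\<in>A. std_residual x i)
      (normal_density (\<Sum>i\<in>A. 0) (sqrt (\<Sum>i\<in>A. 1\<^sup>2)))"
    using assms std_residual_std_normal(2)[of _ N]
    by (intro sum_indep_normal A indep_vars_subset[OF std_residual_std_normal(1)]) auto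
  from normal_density_affine[OF this, of "- 1 / sqrt (real N)" 0]
  show ?thesis using c N by (simp add: real_sqrt_divide)
qed

lemma resid_walk_diff:
  assumes "k \<le> l"
  shows "resid_walk N x l - resid_walk N x k = - (\<Sum>i=k + 1..l. std_residual x i) / sqrt (real N)"
proof -
  have "(\<Sum>i=1..l. std_residual x i) = (\<Sum>i=1..k. std_residual x i) + (\<Sum>i=k + 1..l. std_residual x i)"
    using assms sum.ub_add_nat[of 1 k "std_residual x" "l - k"] by simp
  then show ?thesis by (simp add: resid_walk_def diff_divide_distrib)
qed

context
  fixes m N :: nat
  assumes m: "m \<ge> 1" and N: "N \<ge> m"
begin

interpretation prob_space "std_normal_PiM {1..N + 1}"
  by (rule prob_space_std_normal_PiM)

definition grid_incr :: "nat \<Rightarrow> (nat \<Rightarrow> real) \<Rightarrow> real" where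
  "grid_incr j x = - (\<Sum>i=grid m N (j - 1) + 1..grid m N j. std_residual x i) / sqrt (real N)"

lemma sum_grid_incr:
  assumes "k \<le> l"
  shows "(\<Sum>j=k + 1..l. grid_incr j x) = - (\<Sum>i=grid m N k + 1..grid m N l. std_residual x i) / sqrt (real N)"
proof -
  have "(\<Sum>j=k + 1..l. grid_incr j x) = (\<Sum>j=k + 1..l. resid_walk N x (grid m N j) - resid_walk N x (grid m N (j - 1)))"
    by (intro sum.cong) (simp_all add: grid_incr_def resid_walk_diff grid_mono)
  also have "\<dots> = resid_walk N x (grid m N l) - resid_walk N x (grid m N k)"
    using assms by (induction rule: dec_induct) simp_all
  finally show ?thesis using assms by (simp add: resid_walk_diff grid_mono)
qed

lemma sum_grid_incr_1: "(\<Sum>j=1..k. grid_incr j x) = resid_walk N x (grid m N k)"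
  using sum_grid_incr[of 0 k x] by (simp add: resid_walk_def)

lemma indep_grid_incr: "indep_vars (\<lambda>_. borel) grid_incr {1..m}"
proof -
  let ?K = "\<lambda>j. {grid m N (j - 1) + 1..grid m N j}"
  have "indep_vars (\<lambda>j. PiM (?K j) (\<lambda>_. borel)) (\<lambda>j x. restrict (std_residual x) (?K j)) {1..m}"
  proof (rule indep_vars_restrict[OF std_residual_std_normal(1)])
    fix j assume "j \<in> {1..m}"
    then show "?K j \<subseteq> {1..N}" using grid_le[OF m, of j N] by auto
  next
    have "?K i \<inter> ?K j = {}" if "i < j" for i j
      using grid_mono[of i "j - 1" m N] le_diff_conv2[of 1 j i] that by auto
    then show "disjoint_family_on ?K {1..m}"
      unfolding disjoint_family_on_def by (metis Int_commute linorder_neqE_nat)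
  qed
  then have "indep_vars (\<lambda>_. borel) (\<lambda>j x. (\<lambda>y. - (\<Sum>i\<in>?K j. y i) / sqrt (real N)) (restrict (std_residual x) (?K j))) {1..m}"
    by (rule indep_vars_compose2) (intro borel_measurable_divide borel_measurable_uminus borel_measurable_sum
        measurable_component_singleton borel_measurable_const)
  moreover have "(\<Sum>i\<in>K. restrict f K i) = (\<Sum>i\<in>K. f i)" for K :: "nat set" and f :: "nat \<Rightarrow> real"
    by (intro sum.cong) auto
  ultimately show ?thesis by (simp only: grid_incr_def[abs_def])
qed

lemma grid_tail_symmetric:
  assumes "k \<in> {1..m}"
  shows "prob {x \<in> space (std_normal_PiM {1..N + 1}). (\<Sum>i=k + 1..m. grid_incr i x) > 0} \<le> 1 / 2"
    and "prob {x \<in> space (std_normal_PiM {1..N + 1}). (\<Sum>i=k + 1..m. grid_incr i x) \<ge> 0} \<ge> 1 / 2"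
proof -
  show "prob {x \<in> space (std_normal_PiM {1..N + 1}). (\<Sum>i=k + 1..m. grid_incr i x) > 0} \<le> 1 / 2"
    and "prob {x \<in> space (std_normal_PiM {1..N + 1}). (\<Sum>i=k + 1..m. grid_incr i x) \<ge> 0} \<ge> 1 / 2"
  proof (atomize (full), cases "k = m")
    \<comment> \<open>The remainder is the empty sum 0, a degenerate case outside the normal
      densities.\<close>
    case True
    then show "prob {x \<in> space (std_normal_PiM {1..N + 1}). (\<Sum>i=k + 1..m. grid_incr i x) > 0} \<le> 1 / 2 \<and>
      1 / 2 \<le> prob {x \<in> space (std_normal_PiM {1..N + 1}). (\<Sum>i=k + 1..m. grid_incr i x) \<ge> 0}"
      using prob_space by simp
  next
    case False
    let ?A = "{grid m N k + 1..grid m N m}"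
    have "grid m N k < grid m N m"
      using grid_step(1)[OF m N, of k] grid_mono[of "k + 1" m m N] False assms by simp
    then have A: "?A \<subseteq> {1..N}" "?A \<noteq> {}" using grid_last[OF m, of N] by auto
    then have "card ?A > 0" by (simp add: card_gt_0_iff)
    then have s: "sqrt (real (card ?A) / real N) > 0" using m N by simp
    show "prob {x \<in> space (std_normal_PiM {1..N + 1}). (\<Sum>i=k + 1..m. grid_incr i x) > 0} \<le> 1 / 2 \<and>
      1 / 2 \<le> prob {x \<in> space (std_normal_PiM {1..N + 1}). (\<Sum>i=k + 1..m. grid_incr i x) \<ge> 0}"
      using normal_prob_symmetric[OF std_normal_sum_residual[OF A] s] sum_grid_incr[of k m] assms
      by (simp only: atLeastAtMost_iff)
  qed
qed

lemma resid_walk_end_prob: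
  "prob {x \<in> space (std_normal_PiM {1..N + 1}). resid_walk N x N > b} = 1 - cdf std_normal_distribution b"
proof -
  interpret s: prob_space std_normal_distribution by (rule prob_space_std_normal)
  have "distributed (std_normal_PiM {1..N + 1}) lborel (\<lambda>x. resid_walk N x N) std_normal_density"
    using std_normal_sum_residual[of "{1..N}" N] m N by (simp add: resid_walk_def)
  then have d: "distr (std_normal_PiM {1..N + 1}) lborel (\<lambda>x. resid_walk N x N) = std_normal_distribution"
    by (simp add: distributed_def)
  have W: "(\<lambda>x. resid_walk N x N) \<in> borel_measurable (std_normal_PiM {1..N + 1})"
    by (rule resid_walk_measurable) simp_all
  have "prob {x \<in> space (std_normal_PiM {1..N + 1}). resid_walk N x N > b}
      = measure (distr (std_normal_PiM {1..N + 1}) lborel (\<lambda>x. resid_walk N x N)) {b<..}"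
    by (subst measure_distr) (use W in \<open>auto simp: vimage_def Int_def conj_commute\<close>)
  also have "\<dots> = measure std_normal_distribution (space std_normal_distribution - {..b})"
    unfolding d by (rule arg_cong[where f = "measure std_normal_distribution"]) auto
  also have "\<dots> = 1 - cdf std_normal_distribution b"
    unfolding cdf_def by (subst s.prob_compl) auto
  finally show ?thesis .
qed

text \<open>Valid for every N \<ge> m and not merely in the limit: the end value of the Gaussian
  walk is exactly standard normal, and tails of the increments are symmetric.\<close>

lemma std_normal_grid_upper:
  "prob {x \<in> space (std_normal_PiM {1..N + 1}). \<exists>j\<in>{1..m}. resid_walk N x (grid m N j) > b}
    \<le> 2 * (1 - cdf std_normal_distribution b)"
  using levy_upper[OF indep_grid_incr m grid_tail_symmetric(2), of b]
  unfolding sum_grid_incr_1 grid_last[OF m] resid_walk_end_prob .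

text \<open>An increment has variance at most 2/m, so its fourth-moment tail bound is 3 (2/m)^2 /
  d^4 = 12/(m^2 d^4). Summing over \<open>m\<close> increments and the factor 2 of Levy's inequality
  give 24/(m d^4).\<close>

lemma std_normal_grid_lower:
  assumes "b \<ge> 0" "d > 0"
  shows "2 * (1 - cdf std_normal_distribution (b + d))
    \<le> prob {x \<in> space (std_normal_PiM {1..N + 1}). \<exists>j\<in>{1..m}. resid_walk N x (grid m N j) > b} + 24 / (real m * d ^ 4)"
proof -
  have "prob {x \<in> space (std_normal_PiM {1..N + 1}). grid_incr k x > d} \<le> 12 / ((real m)\<^sup>2 * d ^ 4)" if k: "k \<in> {1..m}" for k
  proof -
    let ?A = "{grid m N (k - 1) + 1..grid m N k}"
    have A: "?A \<subseteq> {1..N}" "?A \<noteq> {}"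
      using grid_le[OF m, of k N] grid_step(1)[OF m N, of "k - 1"] k by auto
    then have "card ?A > 0" by (simp add: card_gt_0_iff)
    then have s: "sqrt (real (card ?A) / real N) > 0" using m N by simp
    have "real (card ?A) \<le> 2 * real N / real m"
      using grid_step(2)[OF m N, of "k - 1"] k by simp
    then have q: "real (card ?A) / real N \<le> 2 / real m"
      using m N by (simp add: field_simps)
    have "prob {x \<in> space (std_normal_PiM {1..N + 1}). grid_incr k x > d} \<le> 3 * sqrt (real (card ?A) / real N) ^ 4 / d ^ 4"
      unfolding grid_incr_def by (rule normal_tail_le[OF std_normal_sum_residual[OF A] s \<open>d > 0\<close>])
    also have "sqrt (real (card ?A) / real N) ^ 4 = (real (card ?A) / real N)\<^sup>2"
      using power_mult[of "sqrt (real (card ?A) / real N)" 2 2] by simp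
    also have "\<dots> \<le> (2 / real m)\<^sup>2" using q by (intro power_mono) auto
    finally show ?thesis using \<open>d > 0\<close> by (simp add: power_divide divide_right_mono)
  qed
  then have "(\<Sum>k=1..m. prob {x \<in> space (std_normal_PiM {1..N + 1}). grid_incr k x > d}) \<le> (\<Sum>k=1..m. 12 / ((real m)\<^sup>2 * d ^ 4))"
    by (intro sum_mono) auto
  also have "\<dots> = 12 / (real m * d ^ 4)"
    using m \<open>d > 0\<close> by (simp add: power2_eq_square)
  finally have "2 * (\<Sum>k=1..m. prob {x \<in> space (std_normal_PiM {1..N + 1}). grid_incr k x > d}) \<le> 24 / (real m * d ^ 4)"
    by simp
  then show ?thesis
    using levy_lower[OF indep_grid_incr m \<open>b \<ge> 0\<close> grid_tail_symmetric(1), of d]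
    unfolding sum_grid_incr_1 grid_last[OF m] resid_walk_end_prob by linarith
qed

end

section \<open>From the grid to all times\<close>

lemma sum_inverse_sqrt_le:
  "a \<le> b \<Longrightarrow> (\<Sum>i=a + 1..b. 1 / sqrt (real i)) \<le> 2 * (sqrt (real b) - sqrt (real a))"
proof (induction b rule: dec_induct)
  case (step b)
  define p q where "p = sqrt (real b + 1)" and "q = sqrt (real b)"
  have "p > 0" "q \<le> p" by (simp_all add: p_def q_def)
  have "(p - q) * (p + q) = 1"
    by (simp add: p_def q_def algebra_simps)
  moreover have "(p - q) * (p + q) \<le> (p - q) * (2 * p)"
    using \<open>q \<le> p\<close> by (intro mult_left_mono) auto
  ultimately have "1 \<le> 2 * (p - q) * p" by (simp add: mult_ac)
  then have "1 / p \<le> 2 * (p - q)"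
    using \<open>p > 0\<close> by (simp only: pos_divide_le_eq)
  then show ?case using step by (simp add: p_def q_def add.commute)
qed simp

lemma sqrt_diff_le: "0 \<le> a \<Longrightarrow> a \<le> b \<Longrightarrow> sqrt b - sqrt a \<le> sqrt (b - a)"
  using sqrt_add_le_add_sqrt[of a "b - a"] by simp

lemma grid_cover:
  assumes "m \<ge> 1" "k \<in> {1..N}"
  obtains j where "j \<in> {1..m}" "grid m N (j - 1) < k" "k \<le> grid m N j"
proof -
  define j where "j = (LEAST j. k \<le> grid m N j)"
  have m: "k \<le> grid m N m" using assms grid_last[of m N] by simp
  then have "k \<le> grid m N j" unfolding j_def by (rule LeastI)
  moreover have "j \<le> m" unfolding j_def using m by (rule Least_le)
  moreover have "j \<noteq> 0" using \<open>k \<le> grid m N j\<close> assms by (auto intro: gr0I)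
  moreover have "\<not> k \<le> grid m N (j - 1)"
    using not_less_Least[of "j - 1" "\<lambda>j. k \<le> grid m N j", folded j_def] \<open>j \<noteq> 0\<close> by simp
  ultimately show ?thesis by (intro that[of j]) auto
qed

section \<open>Second moments of sums and of the drift of running means\<close>

context prob_space
begin

context
  fixes X :: "nat \<Rightarrow> 'a \<Rightarrow> real" and n :: nat
  assumes X: "indep_vars (\<lambda>_. borel) X {1..n}"
    and X2: "\<And>i. i \<in> {1..n} \<Longrightarrow> integrable M (\<lambda>\<omega>. (X i \<omega>)\<^sup>2)"
    and EX: "\<And>i. i \<in> {1..n} \<Longrightarrow> expectation (X i) = 0"
    and VX: "\<And>i. i \<in> {1..n} \<Longrightarrow> expectation (\<lambda>\<omega>. (X i \<omega>)\<^sup>2) = 1"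
begin

lemma X_measurable: "i \<in> {1..n} \<Longrightarrow> X i \<in> borel_measurable M"
  using X by (auto simp: indep_vars_def)

lemma X_integrable: "i \<in> {1..n} \<Longrightarrow> integrable M (X i)"
  by (rule square_integrable_imp_integrable[OF X_measurable X2])

text \<open>Independent centred variables of variance 1 are orthonormal in L2, so only the diagonal
  of the double sum survives.\<close>

lemma expectation_square_sum:
  assumes "A \<subseteq> {1..n}"
  shows "integrable M (\<lambda>\<omega>. (\<Sum>i\<in>A. a i * X i \<omega>)\<^sup>2)"
    and "expectation (\<lambda>\<omega>. (\<Sum>i\<in>A. a i * X i \<omega>)\<^sup>2) = (\<Sum>i\<in>A. (a i)\<^sup>2)"
proof -
  have fin: "finite A" using assms finite_subset by blast
  have sq: "(\<Sum>i\<in>A. a i * X i \<omega>)\<^sup>2 = (\<Sum>i\<in>A. \<Sum>j\<in>A. (a i * a j) * (X i \<omega> * X j \<omega>))" for \<omega>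
    by (simp add: power2_eq_square sum_product mult_ac)
  have E: "integrable M (\<lambda>\<omega>. X i \<omega> * X j \<omega>) \<and> expectation (\<lambda>\<omega>. X i \<omega> * X j \<omega>) = (if i = j then 1 else 0)"
    if "i \<in> A" "j \<in> A" for i j
  proof (cases "i = j")
    case True
    then show ?thesis using X2[of j] VX[of j] that assms by (auto simp: power2_eq_square)
  next
    case False
    have ij: "{i, j} \<subseteq> {1..n}" using that assms by auto
    have "indep_var borel (X i) borel (X j)"
      using indep_vars_sum[of "{j}" i X] indep_vars_subset[OF X ij] False by auto
    then show ?thesis
      using indep_var_lebesgue_integral[of "X i" "X j"] indep_var_integrable[of "X i" "X j"]
        X_integrable[of i] X_integrable[of j] EX[of i] ij False by simp
  qed
  show "integrable M (\<lambda>\<omega>. (\<Sum>i\<in>A. a i * X i \<omega>)\<^sup>2)"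
    unfolding sq using E by (intro Bochner_Integration.integrable_sum integrable_mult_right) auto
  have "expectation (\<lambda>\<omega>. (\<Sum>i\<in>A. a i * X i \<omega>)\<^sup>2) = (\<Sum>i\<in>A. \<Sum>j\<in>A. (a i * a j) * (if i = j then 1 else 0))"
    unfolding sq using E
    by (subst Bochner_Integration.integral_sum, intro Bochner_Integration.integrable_sum integrable_mult_right)
      (auto intro!: sum.cong simp: Bochner_Integration.integral_sum)
  also have "\<dots> = (\<Sum>i\<in>A. (a i)\<^sup>2)"
    using fin by (simp add: if_distrib[of "\<lambda>x. _ * x"] power2_eq_square cong: if_cong)
  finally show "expectation (\<lambda>\<omega>. (\<Sum>i\<in>A. a i * X i \<omega>)\<^sup>2) = (\<Sum>i\<in>A. (a i)\<^sup>2)" .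
qed

lemma prob_abs_sum_le:
  assumes "A \<subseteq> {1..n}" "\<delta> > 0"
  shows "prob {\<omega> \<in> space M. \<bar>\<Sum>i\<in>A. a i * X i \<omega>\<bar> \<le> \<delta>} \<ge> 1 - (\<Sum>i\<in>A. (a i)\<^sup>2) / \<delta>\<^sup>2"
proof -
  have [measurable]: "(\<lambda>\<omega>. \<Sum>i\<in>A. a i * X i \<omega>) \<in> borel_measurable M"
    using assms X_measurable by (intro borel_measurable_sum borel_measurable_times) auto
  have "prob {\<omega> \<in> space M. (\<Sum>i\<in>A. a i * X i \<omega>)\<^sup>2 \<ge> \<delta>\<^sup>2} \<le> (\<Sum>i\<in>A. (a i)\<^sup>2) / \<delta>\<^sup>2"
    using integral_Markov_inequality_measure[of M "\<lambda>\<omega>. (\<Sum>i\<in>A. a i * X i \<omega>)\<^sup>2" "{}" "\<delta>\<^sup>2"]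
      expectation_square_sum[OF assms(1), of a] assms(2) by simp
  moreover have "prob {\<omega> \<in> space M. \<bar>\<Sum>i\<in>A. a i * X i \<omega>\<bar> \<le> \<delta>} = 1 - prob {\<omega> \<in> space M. \<bar>\<Sum>i\<in>A. a i * X i \<omega>\<bar> > \<delta>}"
    by (subst prob_compl[symmetric]) (auto intro!: arg_cong[where f = prob])
  moreover have "prob {\<omega> \<in> space M. \<bar>\<Sum>i\<in>A. a i * X i \<omega>\<bar> > \<delta>} \<le> prob {\<omega> \<in> space M. (\<Sum>i\<in>A. a i * X i \<omega>)\<^sup>2 \<ge> \<delta>\<^sup>2}"
    using \<open>\<delta> > 0\<close> by (intro finite_measure_mono) (auto simp flip: abs_le_square_iff)
  ultimately show ?thesis by linarith
qed

text \<open>Cauchy-Schwarz with weights 1/sqrt i. Since the i-th partial sum has second moment i,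
  these weights make both factors equal to the sum of 1/sqrt i in expectation, which is what
  Minkowski's inequality would yield.\<close>

lemma drift_second_moment:
  assumes "a \<le> b" "b \<le> n"
  defines "G \<equiv> \<lambda>\<omega>. \<Sum>i=a + 1..b. \<bar>\<Sum>l=1..i. X l \<omega>\<bar> / real i"
  shows "integrable M (\<lambda>\<omega>. (G \<omega>)\<^sup>2)"
    and "expectation (\<lambda>\<omega>. (G \<omega>)\<^sup>2) \<le> 4 * (sqrt (real b) - sqrt (real a))\<^sup>2"
proof -
  let ?s = "\<lambda>i \<omega>. \<Sum>l=1..i. X l \<omega>"
  let ?w = "\<lambda>i. 1 / sqrt (real i)"
  let ?R = "\<lambda>\<omega>. (\<Sum>i=a + 1..b. ?w i) * (\<Sum>i=a + 1..b. ?w i / real i * (?s i \<omega>)\<^sup>2)"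
  have s: "integrable M (\<lambda>\<omega>. (?s i \<omega>)\<^sup>2)" "expectation (\<lambda>\<omega>. (?s i \<omega>)\<^sup>2) = real i" if "i \<in> {a + 1..b}" for i
    using expectation_square_sum[of "{1..i}" "\<lambda>_. 1"] that assms by auto
  have W: "0 \<le> (\<Sum>i=a + 1..b. ?w i)" by (intro sum_nonneg) auto
  have le: "(G \<omega>)\<^sup>2 \<le> ?R \<omega>" for \<omega>
  proof -
    have "(G \<omega>)\<^sup>2 = (\<Sum>i=a + 1..b. sqrt (?w i) * (sqrt (?w i) * (\<bar>?s i \<omega>\<bar> / sqrt (real i))))\<^sup>2"
    proof -
      have "\<bar>?s i \<omega>\<bar> / real i = sqrt (?w i) * (sqrt (?w i) * (\<bar>?s i \<omega>\<bar> / sqrt (real i)))" if "i \<in> {a + 1..b}" for i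
      proof -
        have "sqrt (?w i) * (sqrt (?w i) * (\<bar>?s i \<omega>\<bar> / sqrt (real i))) = (sqrt (?w i) * sqrt (?w i)) * (\<bar>?s i \<omega>\<bar> / sqrt (real i))"
          by (simp only: mult.assoc)
        also have "\<dots> = ?w i * (\<bar>?s i \<omega>\<bar> / sqrt (real i))" by simp
        finally show ?thesis using that by simp
      qed
      then show ?thesis unfolding G_def by (intro arg_cong[where f = "\<lambda>x. x\<^sup>2"] sum.cong) auto
    qed
    also have "\<dots> \<le> (\<Sum>i=a + 1..b. (sqrt (?w i))\<^sup>2) * (\<Sum>i=a + 1..b. (sqrt (?w i) * (\<bar>?s i \<omega>\<bar> / sqrt (real i)))\<^sup>2)"
      by (rule Cauchy_Schwarz_ineq_sum)
    also have "\<dots> = ?R \<omega>"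
      by (simp add: power_mult_distrib power_divide)
    finally show ?thesis .
  qed
  have R: "integrable M ?R"
    using s by (intro integrable_mult_right Bochner_Integration.integrable_sum) auto
  have G: "(\<lambda>\<omega>. (G \<omega>)\<^sup>2) \<in> borel_measurable M"
    unfolding G_def using assms X_measurable
    by (intro borel_measurable_power borel_measurable_sum borel_measurable_divide borel_measurable_abs) auto
  show i: "integrable M (\<lambda>\<omega>. (G \<omega>)\<^sup>2)"
    by (rule Bochner_Integration.integrable_bound[OF R G]) (use le in \<open>auto intro: order_trans[OF _ abs_ge_self]\<close>)
  have "expectation (\<lambda>\<omega>. (G \<omega>)\<^sup>2) \<le> expectation ?R"
    using i R le by (rule integral_mono)
  also have "\<dots> = (\<Sum>i=a + 1..b. ?w i) * (\<Sum>i=a + 1..b. ?w i / real i * real i)"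
    using s by (simp add: Bochner_Integration.integral_sum del: sum_divide_distrib)
  also have "\<dots> = (\<Sum>i=a + 1..b. ?w i)\<^sup>2"
    unfolding power2_eq_square by (intro arg_cong2[where f = "(*)"] sum.cong) auto
  also have "\<dots> \<le> (2 * (sqrt (real b) - sqrt (real a)))\<^sup>2"
    using W by (intro power_mono sum_inverse_sqrt_le assms)
  finally show "expectation (\<lambda>\<omega>. (G \<omega>)\<^sup>2) \<le> 4 * (sqrt (real b) - sqrt (real a))\<^sup>2"
    by (simp only: power_mult_distrib) simp
qed

text \<open>A union bound over \<open>m\<close> blocks survives because of telescoping. In the
  square of a difference of square roots one factor is bounded by the block length, of order sqrt
  (N/m), and the other is kept; the kept factors add up to sqrt N, so that order 1/sqrt m
  remains.\<close>

lemma prob_drift_le: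
  assumes m: "m \<ge> 1" and N: "N \<ge> m" "N + 1 \<le> n" and "\<delta> > 0"
  defines "G \<equiv> \<lambda>j \<omega>. (\<Sum>i=grid m N (j - 1) + 1..grid m N j. \<bar>\<Sum>l=1..i. X l \<omega>\<bar> / real i) / sqrt (real N)"
  shows "{\<omega> \<in> space M. \<exists>j\<in>{1..m}. G j \<omega> > \<delta>} \<in> events"
    and "prob {\<omega> \<in> space M. \<exists>j\<in>{1..m}. G j \<omega> > \<delta>} \<le> 4 * sqrt (2 / real m) / \<delta>\<^sup>2"
proof -
  let ?r = "\<lambda>j. sqrt (real (grid m N j))"
  have N0: "real N > 0" using m N by simp
  have G: "G j \<in> borel_measurable M" if "j \<in> {1..m}" for j
    unfolding G_def using X_measurable grid_le[OF m, of j N] that N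
    by (intro borel_measurable_sum borel_measurable_divide borel_measurable_abs borel_measurable_const) auto
  then have ev: "{\<omega> \<in> space M. G j \<omega> > \<delta>} \<in> events" if "j \<in> {1..m}" for j
    using that by measurable
  have eq: "{\<omega> \<in> space M. \<exists>j\<in>{1..m}. G j \<omega> > \<delta>} = (\<Union>j\<in>{1..m}. {\<omega> \<in> space M. G j \<omega> > \<delta>})"
    by auto
  then show "{\<omega> \<in> space M. \<exists>j\<in>{1..m}. G j \<omega> > \<delta>} \<in> events"
    using ev by (auto intro!: sets.finite_UN)
  have "prob {\<omega> \<in> space M. \<exists>j\<in>{1..m}. G j \<omega> > \<delta>} \<le> (\<Sum>j=1..m. prob {\<omega> \<in> space M. G j \<omega> > \<delta>})"
    unfolding eq using ev by (intro finite_measure_subadditive_finite) auto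
  also have "\<dots> \<le> (\<Sum>j=1..m. 4 * sqrt (2 / real m) / (\<delta>\<^sup>2 * sqrt (real N)) * (?r j - ?r (j - 1)))"
  proof (rule sum_mono)
    fix j assume j: "j \<in> {1..m}"
    let ?D = "\<lambda>\<omega>. \<Sum>i=grid m N (j - 1) + 1..grid m N j. \<bar>\<Sum>l=1..i. X l \<omega>\<bar> / real i"
    let ?d = "?r j - ?r (j - 1)"
    have g: "grid m N (j - 1) \<le> grid m N j" "grid m N j \<le> n"
      using grid_mono[of "j - 1" j m N] grid_le[OF m, of j N] j N by auto
    have d0: "?d \<ge> 0" using g by simp
    have G2: "(\<lambda>\<omega>. (G j \<omega>)\<^sup>2) = (\<lambda>\<omega>. (?D \<omega>)\<^sup>2 / real N)"
      by (simp add: G_def power_divide)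
    have "prob {\<omega> \<in> space M. G j \<omega> > \<delta>} \<le> prob {\<omega> \<in> space M. (G j \<omega>)\<^sup>2 \<ge> \<delta>\<^sup>2}"
      using \<open>\<delta> > 0\<close> G[OF j] by (intro finite_measure_mono) (auto intro!: power_mono)
    also have "\<dots> \<le> expectation (\<lambda>\<omega>. (G j \<omega>)\<^sup>2) / \<delta>\<^sup>2"
      using integral_Markov_inequality_measure[of M "\<lambda>\<omega>. (G j \<omega>)\<^sup>2" "{}" "\<delta>\<^sup>2"] drift_second_moment(1)[OF g] \<open>\<delta> > 0\<close>
      by (simp add: G2)
    also have "\<dots> \<le> (4 * ?d\<^sup>2 / real N) / \<delta>\<^sup>2"
      unfolding G2 using drift_second_moment(2)[OF g] N0
      by (intro divide_right_mono) (auto intro!: divide_right_mono)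
    \<comment> \<open>Bounding both factors by sqrt (2 N/m) would lose the telescoping and leave a
      sum over the blocks that does not vanish with growing \<open>m\<close>.\<close>
    also have "\<dots> \<le> (4 * (sqrt (2 * real N / real m) * ?d) / real N) / \<delta>\<^sup>2"
    proof -
      have "?d \<le> sqrt (real (grid m N j) - real (grid m N (j - 1)))"
        using g by (intro sqrt_diff_le) auto
      also have "\<dots> \<le> sqrt (2 * real N / real m)"
        using grid_step(2)[OF m N(1), of "j - 1"] j g by (intro real_sqrt_le_mono) (simp add: of_nat_diff)
      finally show ?thesis
        using d0 unfolding power2_eq_square[of ?d]
        by (intro divide_right_mono mult_left_mono mult_right_mono) auto
    qed
    also have "\<dots> = 4 * sqrt (2 / real m) / (\<delta>\<^sup>2 * sqrt (real N)) * ?d"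
    proof -
      define q where "q = sqrt (real N)"
      have q: "real N = q * q" "q > 0" using N0 by (simp_all add: q_def)
      have "sqrt (2 * real N / real m) = sqrt (2 / real m) * q"
        by (simp add: q_def real_sqrt_mult real_sqrt_divide)
      then show ?thesis using q \<open>\<delta> > 0\<close> unfolding q_def[symmetric] by (simp add: field_simps)
    qed
    finally show "prob {\<omega> \<in> space M. G j \<omega> > \<delta>} \<le> 4 * sqrt (2 / real m) / (\<delta>\<^sup>2 * sqrt (real N)) * ?d" .
  qed
  also have "\<dots> = 4 * sqrt (2 / real m) / (\<delta>\<^sup>2 * sqrt (real N)) * (?r m - ?r 0)"
  proof -
    have "(\<Sum>j=1..k. ?r j - ?r (j - 1)) = ?r k - ?r 0" for k by (induction k) simp_all
    then show ?thesis by (simp only: sum_distrib_left[symmetric])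
  qed
  also have "\<dots> = 4 * sqrt (2 / real m) / \<delta>\<^sup>2"
    using N0 by (simp add: grid_last[OF m])
  finally show "prob {\<omega> \<in> space M. \<exists>j\<in>{1..m}. G j \<omega> > \<delta>} \<le> 4 * sqrt (2 / real m) / \<delta>\<^sup>2" .
qed

text \<open>Ottaviani's argument: after the walk first exceeds the higher level, it still exceeds the
  lower level at the next grid point, unless either the independent part of the remaining increment
  or the drift due to the running means is large.\<close>

lemma prob_max_le_grid:
  assumes m: "m \<ge> 1" and N: "N \<ge> m" "n = N + 1" and \<delta>: "\<delta> > 0"
  defines "W \<equiv> \<lambda>k \<omega>. resid_walk N (\<lambda>i. X i \<omega>) k"
  shows "(1 - 2 / (real m * \<delta>\<^sup>2)) * prob {\<omega> \<in> space M. \<exists>k\<in>{1..N}. W k \<omega> > b + 2 * \<delta>}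
    \<le> prob {\<omega> \<in> space M. \<exists>j\<in>{1..m}. W (grid m N j) \<omega> > b} + 4 * sqrt (2 / real m) / \<delta>\<^sup>2"
proof -
  define G where "G = (\<lambda>j \<omega>. (\<Sum>i=grid m N (j - 1) + 1..grid m N j. \<bar>\<Sum>l=1..i. X l \<omega>\<bar> / real i) / sqrt (real N))"
  define D where "D = {\<omega> \<in> space M. \<exists>j\<in>{1..m}. G j \<omega> > \<delta>}"
  define V where "V = {\<omega> \<in> space M. \<exists>j\<in>{1..m}. W (grid m N j) \<omega> > b}"
  have N0: "real N > 0" using m N by simp
  have "N + 1 \<le> n" using N by simp
  from prob_drift_le[OF m N(1) this \<delta>]
  have D: "D \<in> events" "prob D \<le> 4 * sqrt (2 / real m) / \<delta>\<^sup>2"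
    unfolding D_def G_def by blast+
  have Wm: "W k \<in> borel_measurable M" if "k \<le> N" for k
    unfolding W_def using resid_walk_eq_sum[of k n N] X_measurable that N
    by (simp only: resid_walk_eq_sum[of k n N]) (intro borel_measurable_sum borel_measurable_times; simp)
  have V: "V \<in> events"
    unfolding V_def using Wm grid_le[OF m] by (intro sets.sets_Collect_finite_Ex) auto
  define nxt where "nxt k = (SOME j. j \<in> {1..m} \<and> grid m N (j - 1) < k \<and> k \<le> grid m N j)" for k
  have nxt: "nxt k \<in> {1..m}" "grid m N (nxt k - 1) < k" "k \<le> grid m N (nxt k)" if k: "k \<in> {1..N}" for k
  proof -
    have "\<exists>j. j \<in> {1..m} \<and> grid m N (j - 1) < k \<and> k \<le> grid m N j"
      using grid_cover[OF m k] by metis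
    from someI_ex[OF this] show "nxt k \<in> {1..m}" "grid m N (nxt k - 1) < k" "k \<le> grid m N (nxt k)"
      unfolding nxt_def by auto
  qed
  define r where "r i = sqrt (real i / real (i + 1))" for i
  \<comment> \<open>Error \<open>i\<close> enters as the newest observation in the residual numbered
    i - 1 by \<open>std_residual\<close>.\<close>
  define c where "c i = r (i - 1) / sqrt (real N)" for i
  \<comment> \<open>The walk up to time \<open>k\<close> reads the errors up to k + 1, and at the
    next grid point it reads one error more than the grid index; hence the shifts by 2 and by
    1.\<close>
  define A where "A k = {k + 2..grid m N (nxt k) + 1}" for k
  define B where "B k x \<longleftrightarrow> \<bar>\<Sum>i\<in>A k. c i * x i\<bar> \<le> \<delta>" for k and x :: "nat \<Rightarrow> real"
  have A: "A k \<subseteq> {k + 2..n}" "A k \<subseteq> {1..n}" if k: "k \<in> {1..N}" for k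
    using grid_le[OF m, of "nxt k" N] nxt[OF k] N unfolding A_def by auto
  have "(1 - 2 / (real m * \<delta>\<^sup>2)) * prob {\<omega> \<in> space M. \<exists>k\<in>{1..N}. W k \<omega> > b + 2 * \<delta>} \<le> prob (V \<union> D)"
  proof (rule prob_first_passage_le[where B = "\<lambda>k \<omega>. B k (\<lambda>i. X i \<omega>)"])
    fix k assume k: "k \<in> {1..N}"
    show "W k \<in> borel_measurable M" using Wm k by simp
    have "(\<lambda>\<omega>. \<Sum>i\<in>A k. c i * X i \<omega>) \<in> borel_measurable M"
      using A[OF k] X_measurable by (intro borel_measurable_sum borel_measurable_times) auto
    then show "Measurable.pred M (\<lambda>\<omega>. B k (\<lambda>i. X i \<omega>))"
      unfolding B_def by measurable
    show "prob {\<omega> \<in> space M. first_passage (\<lambda>j. W j \<omega>) (b + 2 * \<delta>) k \<and> B k (\<lambda>i. X i \<omega>)}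
      = prob {\<omega> \<in> space M. first_passage (\<lambda>j. W j \<omega>) (b + 2 * \<delta>) k} * prob {\<omega> \<in> space M. B k (\<lambda>i. X i \<omega>)}"
      unfolding W_def
    proof (rule indep_vars_prob_conj[OF X, of "{1..k + 1}" "A k" "\<lambda>x. first_passage (resid_walk N x) (b + 2 * \<delta>) k" "B k"])
      show "Measurable.pred (PiM {1..k + 1} (\<lambda>_. borel)) (\<lambda>x. first_passage (resid_walk N x) (b + 2 * \<delta>) k)"
        using k by (intro measurable_first_passage resid_walk_measurable) auto
      have "(\<lambda>x. \<Sum>i\<in>A k. c i * x i) \<in> borel_measurable (PiM (A k) (\<lambda>_. borel))"
        by (intro borel_measurable_sum borel_measurable_times measurable_component_singleton) auto
      then show "Measurable.pred (PiM (A k) (\<lambda>_. borel)) (B k)"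
        unfolding B_def[abs_def] by measurable
      show "first_passage (resid_walk N (restrict x {1..k + 1})) (b + 2 * \<delta>) k = first_passage (resid_walk N x) (b + 2 * \<delta>) k" for x
      proof -
        have "resid_walk N (restrict x {1..k + 1}) j = resid_walk N x j" if "j \<le> k" for j
          using that by (simp only: resid_walk_eq_sum[of j "k + 1" N]) (intro sum.cong, auto)
        then show ?thesis by (simp add: first_passage_def)
      qed
      show "B k (restrict x (A k)) = B k x" for x
        unfolding B_def by (simp cong: sum.cong)
    qed (use A[OF k] k N in auto)
    \<comment> \<open>Chebyshev's inequality over at most one block: at most 2 N/m errors, each with
      squared weight at most 1/N. For small \<open>m\<close> the left side is negative, which the
      first-passage bound tolerates.\<close>
    show "1 - 2 / (real m * \<delta>\<^sup>2) \<le> prob {\<omega> \<in> space M. B k (\<lambda>i. X i \<omega>)}"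
    proof -
      have "(r i)\<^sup>2 \<le> 1" for i by (simp add: r_def)
      then have "(\<Sum>i\<in>A k. (c i)\<^sup>2) \<le> (\<Sum>i\<in>A k. 1 / real N)"
        unfolding c_def power_divide by (intro sum_mono) (simp add: divide_right_mono)
      also have "\<dots> = real (card (A k)) / real N" by simp
      also have "\<dots> \<le> (2 * real N / real m) / real N"
      proof (rule divide_right_mono)
        have "card (A k) \<le> grid m N (nxt k) - grid m N (nxt k - 1)"
          using nxt[OF k] by (simp add: A_def)
        then have "real (card (A k)) \<le> real (grid m N (nxt k) - grid m N (nxt k - 1))"
          by (simp only: of_nat_le_iff)
        also have "\<dots> \<le> 2 * real N / real m"
          using grid_step(2)[OF m N(1), of "nxt k - 1"] nxt(1)[OF k] by simp
        finally show "real (card (A k)) \<le> 2 * real N / real m" .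
      qed simp
      also have "\<dots> = 2 / real m" using N0 by simp
      finally have "(\<Sum>i\<in>A k. (c i)\<^sup>2) / \<delta>\<^sup>2 \<le> 2 / real m / \<delta>\<^sup>2"
        by (intro divide_right_mono) auto
      then have "(\<Sum>i\<in>A k. (c i)\<^sup>2) / \<delta>\<^sup>2 \<le> 2 / (real m * \<delta>\<^sup>2)"
        by (simp only: divide_divide_eq_left)
      then show ?thesis
        using prob_abs_sum_le[OF A(2)[OF k] \<delta>, of c] unfolding B_def by linarith
    qed
    fix \<omega> assume \<omega>: "\<omega> \<in> space M" and F: "first_passage (\<lambda>j. W j \<omega>) (b + 2 * \<delta>) k" and Bk: "B k (\<lambda>i. X i \<omega>)"
    define l where "l = grid m N (nxt k)"
    let ?x = "\<lambda>i. X i \<omega>"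
    have res: "std_residual ?x i = r i * ?x (i + 1) - r i * ((\<Sum>j=1..i. ?x j) / real i)" for i
      by (simp add: std_residual_def r_def right_diff_distrib)
    have Z: "(\<Sum>i=k + 1..l. r i * ?x (i + 1)) / sqrt (real N) = (\<Sum>i\<in>A k. c i * ?x i)"
    proof -
      have "(\<Sum>i\<in>A k. c i * ?x i) = (\<Sum>i=Suc (k + 1)..Suc l. c i * ?x i)" by (simp add: A_def l_def)
      also have "\<dots> = (\<Sum>i=k + 1..l. c (Suc i) * ?x (Suc i))" by (rule sum.shift_bounds_cl_Suc_ivl)
      finally show ?thesis by (simp add: c_def sum_divide_distrib)
    qed
    have "W l \<omega> - W k \<omega> = - (\<Sum>i\<in>A k. c i * ?x i) + (\<Sum>i=k + 1..l. r i * ((\<Sum>j=1..i. ?x j) / real i)) / sqrt (real N)"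
      unfolding W_def resid_walk_diff[OF nxt(3)[OF k, folded l_def]] Z[symmetric] res sum_subtractf
      by (simp add: diff_divide_distrib)
    \<comment> \<open>The drift involves errors from before time \<open>k\<close>, so it cannot be
      part of the independent event \<open>B k\<close>. Its absolute values are summed over the
      whole block, which gives an exceptional event that does not depend on
      \<open>k\<close>.\<close>
    moreover have "(\<Sum>i=k + 1..l. r i * ((\<Sum>j=1..i. ?x j) / real i)) / sqrt (real N) \<ge> - G (nxt k) \<omega>"
    proof -
      have "- (\<Sum>i=grid m N (nxt k - 1) + 1..l. \<bar>\<Sum>j=1..i. ?x j\<bar> / real i) \<le> - (\<Sum>i=k + 1..l. \<bar>\<Sum>j=1..i. ?x j\<bar> / real i)"
        using nxt(2)[OF k] by (intro le_imp_neg_le sum_mono2) auto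
      also have "\<dots> = (\<Sum>i=k + 1..l. - (\<bar>\<Sum>j=1..i. ?x j\<bar> / real i))" by (rule sum_negf[symmetric])
      also have "\<dots> \<le> (\<Sum>i=k + 1..l. r i * ((\<Sum>j=1..i. ?x j) / real i))"
      proof (rule sum_mono)
        fix i
        have "0 \<le> r i" "r i \<le> 1" by (simp_all add: r_def)
        then have "\<bar>r i * ((\<Sum>j=1..i. ?x j) / real i)\<bar> \<le> 1 * \<bar>(\<Sum>j=1..i. ?x j) / real i\<bar>"
          unfolding abs_mult by (intro mult_right_mono) auto
        then show "- (\<bar>\<Sum>j=1..i. ?x j\<bar> / real i) \<le> r i * ((\<Sum>j=1..i. ?x j) / real i)"
          unfolding abs_divide by (simp only: abs_of_nat)
      qed
      finally show ?thesis
        using N0 unfolding G_def l_def[symmetric] minus_divide_left by (intro divide_right_mono) auto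
    qed
    moreover have "(\<Sum>i\<in>A k. c i * ?x i) \<le> \<delta>" using Bk unfolding B_def by linarith
    moreover have "W k \<omega> > b + 2 * \<delta>" using F by (simp add: first_passage_def)
    \<comment> \<open>From a height above b + 2 \<delta>, the independent part costs at most
      \<delta>; falling to \<open>b\<close> would need a drift larger than the other
      \<delta>.\<close>
    ultimately have "W l \<omega> > b \<or> G (nxt k) \<omega> > \<delta>" by linarith
    then show "\<omega> \<in> V \<union> D"
      using nxt(1)[OF k] \<omega> unfolding V_def D_def l_def by auto
  qed (use V D in auto)
  also have "\<dots> \<le> prob V + prob D" using V D by (intro measure_Un_le) auto
  finally show ?thesis using D(2) unfolding V_def by linarith
qed

end

end

section \<open>The test in terms of the residual walk\<close>

text \<open>The unknown level \<beta> cancels against the running mean, so under the null hypothesis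
  only the errors remain; 1 + 1/i = (i + 1)/i accounts for the normalisation.\<close>

lemma recursive_residual_std_residual:
  assumes "i \<ge> 1"
  shows "recursive_residual constant_regression s (\<lambda>j. \<beta> + x j) (i + 1) = std_residual x i"
proof -
  have a: "(1::real) + 1 / real i = real (i + 1) / real i" using assms by (simp add: field_simps)
  have b: "(\<beta> + x (i + 1)) - 1 / real i * (\<Sum>j=1..i. \<beta> + x j) = x (i + 1) - (\<Sum>j=1..i. x j) / real i"
    using assms by (simp add: sum.distrib field_simps)
  have "recursive_residual constant_regression s (\<lambda>j. \<beta> + x j) (i + 1)
      = ((\<beta> + x (i + 1)) - 1 / real i * (\<Sum>j=1..i. \<beta> + x j)) / sqrt (1 + 1 / real i)"
    using recursive_residual_constant[of "i + 1" s "\<lambda>j. \<beta> + x j"] assms by simp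
  also have "\<dots> = std_residual x i"
    unfolding a b std_residual_def by (simp add: real_sqrt_divide)
  finally show ?thesis .
qed

lemma recursive_residual_cong:
  assumes "i \<ge> 2" "\<And>j. j \<in> {1..i} \<Longrightarrow> y j = y' j"
  shows "recursive_residual constant_regression s y i = recursive_residual constant_regression s y' i"
proof -
  have "(\<Sum>j=1..i - 1. y j) = (\<Sum>j=1..i - 1. y' j)" using assms by (intro sum.cong) auto
  then show ?thesis using assms by (simp add: recursive_residual_constant)
qed

text \<open>The interpolated path is a convex combination of two neighbouring partial sums, so its
  minimum is attained at a grid point.\<close>

lemma partial_sum_op_less_iff:
  assumes "m \<ge> 1" "c \<le> 0"
  shows "(\<exists>z\<in>{0..1}. partial_sum_op m a z < c) \<longleftrightarrow> (\<exists>k\<in>{1..m}. (\<Sum>i=1..k. a i) < c)"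
proof
  assume "\<exists>z\<in>{0..1}. partial_sum_op m a z < c"
  then obtain z where z: "0 \<le> z" "z \<le> 1" and less: "partial_sum_op m a z < c" by auto
  define k where "k = nat \<lfloor>real m * z\<rfloor>"
  define f where "f = real m * z - real k"
  have k: "real k \<le> real m * z" "real m * z < real k + 1"
    using z unfolding k_def by auto
  have p: "partial_sum_op m a z = (1 - f) * (\<Sum>i=1..k. a i) + f * (\<Sum>i=1..k + 1. a i)"
    unfolding partial_sum_op_def Let_def k_def[symmetric] f_def by (simp add: algebra_simps)
  have f: "0 \<le> f" "f < 1" using k by (auto simp: f_def)
  have "real m * z \<le> real m * 1" using z by (intro mult_left_mono) auto
  then have km: "real k \<le> real m" using k by simp
  have ex: "\<exists>l\<in>{0..m}. (\<Sum>i=1..l. a i) < c"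
  proof (cases "k = m")
    \<comment> \<open>At z = 1 the interpolation weight vanishes, so the entry of index m + 1 beyond
      the vector has no effect.\<close>
    case True
    then have "f = 0" using \<open>real m * z \<le> real m * 1\<close> f by (simp add: f_def)
    then show ?thesis using less p True by auto
  next
    case False
    then have "k + 1 \<le> m" using km by simp
    moreover have "(\<Sum>i=1..k. a i) < c \<or> (\<Sum>i=1..k + 1. a i) < c"
    proof (rule ccontr)
      assume "\<not> ?thesis"
      then have "(1 - f) * c + f * c \<le> (1 - f) * (\<Sum>i=1..k. a i) + f * (\<Sum>i=1..k + 1. a i)"
        using f by (intro add_mono mult_left_mono) auto
      then show False using less p by (simp add: algebra_simps)
    qed
    ultimately show ?thesis by (metis add_leD1 atLeastAtMost_iff le0)
  qed
  then obtain l where "l \<le> m" "(\<Sum>i=1..l. a i) < c" by auto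
  \<comment> \<open>Index 0 is ruled out: the empty sum is not below a level \<open>c\<close> that
    is at most 0.\<close>
  then show "\<exists>k\<in>{1..m}. (\<Sum>i=1..k. a i) < c"
    using \<open>c \<le> 0\<close> by (cases "l = 0") auto
next
  assume "\<exists>k\<in>{1..m}. (\<Sum>i=1..k. a i) < c"
  then obtain k where k: "k \<in> {1..m}" "(\<Sum>i=1..k. a i) < c" by blast
  have "real m * (real k / real m) = real k" using assms by simp
  then have "partial_sum_op m a (real k / real m) = (\<Sum>i=1..k. a i)"
    by (simp add: partial_sum_op_def Let_def)
  moreover have "real k / real m \<in> {0..1}" using k by simp
  ultimately show "\<exists>z\<in>{0..1}. partial_sum_op m a z < c" using k by (intro bexI[of _ "real k / real m"]) auto
qed

lemma rejects_iff:
  assumes "n \<ge> 2" and c: "std_normal_quantile (\<alpha> / 2) \<le> 0" and y: "\<And>j. j \<in> {1..n} \<Longrightarrow> y j = \<beta> + x j"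
  shows "rejects \<alpha> n s y \<longleftrightarrow> (\<exists>k\<in>{1..n - 1}. resid_walk (n - 1) x k > - std_normal_quantile (\<alpha> / 2))"
proof -
  define q where "q = std_normal_quantile (\<alpha> / 2)"
  define N where "N = n - 1"
  have N: "N \<ge> 1" "n = N + 1" "sqrt (real N) > 0" using assms by (auto simp: N_def)
  have r: "constant_residuals s y i = std_residual x i" if "i \<in> {1..N}" for i
  proof -
    have "recursive_residual constant_regression s y (i + 1) = recursive_residual constant_regression s (\<lambda>j. \<beta> + x j) (i + 1)"
      using that N y by (intro recursive_residual_cong) auto
    then show ?thesis
      using that recursive_residual_std_residual[of i s \<beta> x] by (simp add: constant_residuals_def)
  qed
  have "rejects \<alpha> n s y \<longleftrightarrow> (\<exists>z\<in>{0..1}. partial_sum_op N (constant_residuals s y) z < q * sqrt (real N))"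
    unfolding rejects_def N_def[symmetric] q_def[symmetric] using N by (simp add: divide_less_eq)
  also have "\<dots> \<longleftrightarrow> (\<exists>k\<in>{1..N}. (\<Sum>i=1..k. constant_residuals s y i) < q * sqrt (real N))"
    using N c by (intro partial_sum_op_less_iff) (auto simp: q_def mult_le_0_iff)
  also have "\<dots> \<longleftrightarrow> (\<exists>k\<in>{1..N}. resid_walk N x k > - q)"
  proof (intro bex_cong refl)
    fix k assume "k \<in> {1..N}"
    then have "(\<Sum>i=1..k. constant_residuals s y i) = (\<Sum>i=1..k. std_residual x i)"
      using r by (intro sum.cong) auto
    moreover have "- q < resid_walk N x k \<longleftrightarrow> (\<Sum>i=1..k. std_residual x i) < q * sqrt (real N)"
      unfolding resid_walk_def using N(3) by (simp add: divide_less_eq)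
    ultimately show "((\<Sum>i=1..k. constant_residuals s y i) < q * sqrt (real N)) = (- q < resid_walk N x k)" by simp
  qed
  finally show ?thesis by (simp add: q_def N_def)
qed

section \<open>Symmetry of the normal distribution and the critical value\<close>

lemma std_normal_cdf_minus: "cdf std_normal_distribution (- x) = 1 - cdf std_normal_distribution x"
proof -
  interpret s: prob_space std_normal_distribution by (rule prob_space_std_normal)
  have d: "distributed std_normal_distribution lborel (\<lambda>x. x) std_normal_density"
    by (auto simp: distributed_def distr_id2)
  from s.normal_density_affine[OF d, of "-1" 0]
  have d': "distributed std_normal_distribution lborel (\<lambda>x. - x) std_normal_density" by simp
  then have "distr std_normal_distribution lborel (\<lambda>x. - x) = std_normal_distribution"
    by (simp add: distributed_def)
  then have "measure std_normal_distribution {..- x} = measure (distr std_normal_distribution lborel (\<lambda>x. - x)) {..- x}"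
    by simp
  also have "\<dots> = measure std_normal_distribution {x..}"
    by (subst measure_distr) (auto intro!: arg_cong[where f = "measure std_normal_distribution"])
  also have "\<dots> = measure std_normal_distribution {x<..}"
  proof -
    have "measure std_normal_distribution {x..} = measure std_normal_distribution ({x} \<union> {x<..})"
      by (rule arg_cong[where f = "measure std_normal_distribution"]) auto
    also have "\<dots> = measure std_normal_distribution {x} + measure std_normal_distribution {x<..}"
      by (rule s.finite_measure_Union) auto
    also have "measure std_normal_distribution {x} = 0"
      by (simp add: measure_def emeasure_density nn_integral_null_set)
    finally show ?thesis by simp
  qed
  also have "\<dots> = measure std_normal_distribution (space std_normal_distribution - {..x})"
    by (rule arg_cong[where f = "measure std_normal_distribution"]) auto
  also have "\<dots> = 1 - measure std_normal_distribution {..x}" by (subst s.prob_compl) auto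
  finally show ?thesis by (simp add: cdf_def)
qed

lemma isCont_std_normal_cdf: "isCont (cdf std_normal_distribution) x"
proof -
  interpret real_distribution std_normal_distribution by (rule real_dist_normal_dist)
  show ?thesis
    unfolding isCont_cdf by (simp add: measure_def emeasure_density nn_integral_null_set)
qed

lemma std_normal_quantile_half:
  assumes "\<alpha> \<in> {0<..<1}"
  shows "std_normal_quantile (\<alpha> / 2) < 0"
    and "cdf std_normal_distribution (- std_normal_quantile (\<alpha> / 2)) = 1 - \<alpha> / 2"
proof -
  interpret real_distribution std_normal_distribution by (rule real_dist_normal_dist)
  have q: "cdf std_normal_distribution (std_normal_quantile (\<alpha> / 2)) = \<alpha> / 2"
    using assms by (intro std_normal_quantile) auto
  then show "cdf std_normal_distribution (- std_normal_quantile (\<alpha> / 2)) = 1 - \<alpha> / 2"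
    by (simp add: std_normal_cdf_minus)
  have "cdf std_normal_distribution 0 = 1 / 2" using std_normal_cdf_minus[of 0] by simp
  then show "std_normal_quantile (\<alpha> / 2) < 0"
    using cdf_nondecreasing[of 0 "std_normal_quantile (\<alpha> / 2)"] q assms by (force simp: not_le[symmetric])
qed

section \<open>The limit\<close>

lemma standardized_std_normal: "standardized std_normal_distribution"
proof -
  interpret prob_space std_normal_distribution by (rule prob_space_std_normal)
  have d: "distributed std_normal_distribution lborel (\<lambda>x. x) std_normal_density"
    by (auto simp: distributed_def distr_id2)
  show ?thesis
    using standard_normal_distributed_expectation[OF d] standard_normal_distributed_variance[OF d]
      integrable_std_normal_moment[of 1] integrable_std_normal_moment[of 2]
    by (auto simp: standardized_def prob_space_std_normal integrable_density)
qed

text \<open>On the truncation set x^2 is at most x^4/(\<delta>^2 n), and the fourth moment is 3,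
  which gives the rate 1/n.\<close>

lemma lindeberg_laws_std_normal: "lindeberg_laws (\<lambda>_. std_normal_distribution)"
  unfolding lindeberg_laws_def
proof (intro allI impI)
  fix \<delta> :: real assume \<delta>: "\<delta> > 0"
  have x4: "integrable std_normal_distribution (\<lambda>x. x ^ 4)" "(\<integral>x. x ^ 4 \<partial>std_normal_distribution) = 3"
    using integrable_std_normal_moment[of 4] integral_std_normal_moment_even[of 2]
    by (auto simp: integrable_density integral_density fact_numeral)
  have x2: "integrable std_normal_distribution (\<lambda>x. x\<^sup>2)"
    using standardized_std_normal by (simp add: standardized_def)
  let ?L = "\<lambda>n. \<integral>x. x\<^sup>2 * indicator {x. \<bar>x\<bar> > \<delta> * sqrt (real n)} x \<partial>std_normal_distribution"
  have le: "?L n \<le> 3 / \<delta>\<^sup>2 / real n" if "n \<ge> 1" for n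
  proof -
    have "?L n \<le> (\<integral>x. x ^ 4 / (\<delta>\<^sup>2 * real n) \<partial>std_normal_distribution)"
    proof (rule integral_mono)
      show "integrable std_normal_distribution (\<lambda>x. x\<^sup>2 * indicator {x. \<bar>x\<bar> > \<delta> * sqrt (real n)} x)"
        by (rule Bochner_Integration.integrable_bound[OF x2]) (auto simp: indicator_def)
      show "integrable std_normal_distribution (\<lambda>x. x ^ 4 / (\<delta>\<^sup>2 * real n))" using x4 by simp
      fix x :: real
      show "x\<^sup>2 * indicator {x. \<bar>x\<bar> > \<delta> * sqrt (real n)} x \<le> x ^ 4 / (\<delta>\<^sup>2 * real n)"
      proof (cases "\<bar>x\<bar> > \<delta> * sqrt (real n)")
        case True
        then have "(\<delta> * sqrt (real n))\<^sup>2 \<le> \<bar>x\<bar>\<^sup>2" using \<delta> by (intro power_mono) auto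
        then have "\<delta>\<^sup>2 * real n \<le> x\<^sup>2" by (simp add: power_mult_distrib)
        then have "x\<^sup>2 * (\<delta>\<^sup>2 * real n) \<le> x\<^sup>2 * x\<^sup>2" by (intro mult_left_mono) auto
        then show ?thesis using True \<delta> that by (simp add: le_divide_eq power2_eq_square power4_eq_xxxx mult_ac)
      next
        case False
        then show ?thesis using \<delta> by simp
      qed
    qed
    also have "\<dots> = 3 / \<delta>\<^sup>2 / real n" using x4 by simp
    finally show ?thesis .
  qed
  show "?L \<longlonglongrightarrow> 0"
  proof (rule tendsto_sandwich)
    show "\<forall>\<^sub>F n in sequentially. 0 \<le> ?L n" by (intro always_eventually allI integral_nonneg_AE) simp
    show "\<forall>\<^sub>F n in sequentially. ?L n \<le> 3 / \<delta>\<^sup>2 / real n"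
      using eventually_ge_at_top[of 1] by eventually_elim (rule le)
    show "(\<lambda>n. 3 / \<delta>\<^sup>2 / real n) \<longlonglongrightarrow> 0" by (rule lim_const_over_n)
  qed simp
qed

section \<open>From the error array to row laws and product measures\<close>

lemma error_arrayD:
  assumes "prob_space M" "error_array M \<epsilon>" "i \<in> {1..n}"
  shows "prob_space.indep_vars M (\<lambda>_. borel) (\<epsilon> n) {1..n}"
    and "\<epsilon> n i \<in> borel_measurable M" and "distr M borel (\<epsilon> n i) = distr M borel (\<epsilon> n 1)"
    and "integrable M (\<epsilon> n i)" and "(\<integral>\<omega>. \<epsilon> n i \<omega> \<partial>M) = 0"
    and "integrable M (\<lambda>\<omega>. (\<epsilon> n i \<omega>)\<^sup>2)" and "(\<integral>\<omega>. (\<epsilon> n i \<omega>)\<^sup>2 \<partial>M) = 1"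
proof -
  interpret prob_space M by fact
  show i: "indep_vars (\<lambda>_. borel) (\<epsilon> n) {1..n}"
    using assms unfolding error_array_def by blast
  then show "\<epsilon> n i \<in> borel_measurable M" using assms by (auto simp: indep_vars_def)
  have "1 \<in> {1..n}" using assms by auto
  then show "distr M borel (\<epsilon> n i) = distr M borel (\<epsilon> n 1)"
    using assms unfolding error_array_def by blast
  show "integrable M (\<epsilon> n i)" and e: "expectation (\<epsilon> n i) = 0"
    using assms unfolding error_array_def by blast+
  have "variance (\<epsilon> n i) = 1" using assms unfolding error_array_def by blast
  then show 1: "expectation (\<lambda>\<omega>. (\<epsilon> n i \<omega>)\<^sup>2) = 1" using e by simp
  \<comment> \<open>A non-integrable function has Bochner integral 0 by convention, so the value 1
    forces integrability.\<close>
  then show "integrable M (\<lambda>\<omega>. (\<epsilon> n i \<omega>)\<^sup>2)"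
    using not_integrable_integral_eq by fastforce
qed

lemma error_array_standardized:
  assumes "prob_space M" "error_array M \<epsilon>" "n \<ge> 1"
  shows "standardized (distr M borel (\<epsilon> n 1))"
proof -
  have 1: "1 \<in> {1..n}" using assms by simp
  note e = error_arrayD[OF assms(1,2) 1]
  show ?thesis
    using e prob_space.prob_space_distr[OF assms(1) e(2)]
    by (simp add: standardized_def integrable_distr_eq integral_distr)
qed

lemma error_array_lindeberg_laws:
  assumes "prob_space M" "error_array M \<epsilon>" "lindeberg M \<epsilon>"
  shows "lindeberg_laws (\<lambda>n. distr M borel (\<epsilon> n 1))"
  unfolding lindeberg_laws_def
proof (intro allI impI)
  fix \<delta> :: real assume \<delta>: "\<delta> > 0"
  interpret prob_space M by fact
  have lim: "(\<lambda>n. let s = sqrt (\<Sum>i=1..n. variance (\<epsilon> n i)) in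
        (\<Sum>i=1..n. expectation (\<lambda>\<omega>. (\<epsilon> n i \<omega>)\<^sup>2 * indicator {\<omega>. \<bar>\<epsilon> n i \<omega>\<bar> > \<delta> * s} \<omega>)) / s\<^sup>2) \<longlonglongrightarrow> 0"
    using assms(3) \<delta> unfolding lindeberg_def by blast
  have "(let s = sqrt (\<Sum>i=1..n. variance (\<epsilon> n i)) in
        (\<Sum>i=1..n. expectation (\<lambda>\<omega>. (\<epsilon> n i \<omega>)\<^sup>2 * indicator {\<omega>. \<bar>\<epsilon> n i \<omega>\<bar> > \<delta> * s} \<omega>)) / s\<^sup>2)
      = (\<integral>x. x\<^sup>2 * indicator {x. \<bar>x\<bar> > \<delta> * sqrt (real n)} x \<partial>distr M borel (\<epsilon> n 1))" (is "_ = ?L")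
    if "n \<ge> 1" for n
  proof -
    have "expectation (\<lambda>\<omega>. (\<epsilon> n i \<omega>)\<^sup>2 * indicator {\<omega>. \<bar>\<epsilon> n i \<omega>\<bar> > \<delta> * sqrt (real n)} \<omega>) = ?L"
      if i: "i \<in> {1..n}" for i
    proof -
      note e = error_arrayD[OF assms(1,2) i]
      have "expectation (\<lambda>\<omega>. (\<epsilon> n i \<omega>)\<^sup>2 * indicator {\<omega>. \<bar>\<epsilon> n i \<omega>\<bar> > \<delta> * sqrt (real n)} \<omega>)
          = (\<integral>x. x\<^sup>2 * indicator {x. \<bar>x\<bar> > \<delta> * sqrt (real n)} x \<partial>distr M borel (\<epsilon> n i))"
        using e(2) by (subst integral_distr) (auto simp: indicator_def)
      then show ?thesis by (simp only: e(3))
    qed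
    moreover have "variance (\<epsilon> n i) = 1" if "i \<in> {1..n}" for i
      using assms(2) that unfolding error_array_def by blast
    ultimately show ?thesis using that by (simp add: Let_def)
  qed
  then have "\<forall>\<^sub>F n in sequentially. (let s = sqrt (\<Sum>i=1..n. variance (\<epsilon> n i)) in
        (\<Sum>i=1..n. expectation (\<lambda>\<omega>. (\<epsilon> n i \<omega>)\<^sup>2 * indicator {\<omega>. \<bar>\<epsilon> n i \<omega>\<bar> > \<delta> * s} \<omega>)) / s\<^sup>2)
      = (\<integral>x. x\<^sup>2 * indicator {x. \<bar>x\<bar> > \<delta> * sqrt (real n)} x \<partial>distr M borel (\<epsilon> n 1))"
    by (auto intro: eventually_sequentiallyI[of 1])
  from Lim_transform_eventually[OF lim this]
  show "(\<lambda>n. \<integral>x. x\<^sup>2 * indicator {x. \<bar>x\<bar> > \<delta> * sqrt (real n)} x \<partial>distr M borel (\<epsilon> n 1)) \<longlonglongrightarrow> 0" .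
qed

text \<open>Lindeberg replacement takes place on product spaces. Events about finitely many values
  of the walk depend only on the joint law of the row, which is a product of equal factors.\<close>

lemma error_array_resid_walk_law:
  assumes "prob_space M" "error_array M \<epsilon>" "n \<ge> 1" and J: "finite J" "\<And>j. j \<in> J \<Longrightarrow> \<kappa> j + 1 \<le> n"
  defines "P \<equiv> PiM {1..n} (\<lambda>_. distr M borel (\<epsilon> n 1))"
  shows "measure M {\<omega> \<in> space M. \<exists>j\<in>J. resid_walk N (\<lambda>i. \<epsilon> n i \<omega>) (\<kappa> j) > b}
    = measure P {x \<in> space P. \<exists>j\<in>J. resid_walk N x (\<kappa> j) > b}"
proof -
  interpret prob_space M by fact
  have rv: "\<epsilon> n i \<in> borel_measurable M" if "i \<in> {1..n}" for i
    by (rule error_arrayD(2)[OF assms(1,2) that])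
  let ?X = "\<lambda>\<omega>. \<lambda>i\<in>{1..n}. \<epsilon> n i \<omega>"
  have "distr M (PiM {1..n} (\<lambda>_. borel)) ?X = PiM {1..n} (\<lambda>i. distr M borel (\<epsilon> n i))"
    using indep_vars_iff_distr_eq_PiM'[where I = "{1..n}" and M' = "\<lambda>_. borel" and X = "\<epsilon> n"] rv error_arrayD(1)[OF assms(1,2), of 1 n] assms(3)
    by auto
  also have "\<dots> = P"
    unfolding P_def by (rule PiM_cong[OF refl]) (rule error_arrayD(3)[OF assms(1,2)])
  finally have law: "distr M (PiM {1..n} (\<lambda>_. borel)) ?X = P" .
  have X: "?X \<in> measurable M (PiM {1..n} (\<lambda>_. borel))"
    using rv by (intro measurable_restrict) auto
  have spP: "space P = space (PiM {1..n} (\<lambda>_. borel))"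
    by (simp add: law[symmetric])
  have W: "resid_walk N (?X \<omega>) (\<kappa> j) = resid_walk N (\<lambda>i. \<epsilon> n i \<omega>) (\<kappa> j)" if "j \<in> J" for \<omega> j
    using J(2)[OF that] by (simp only: resid_walk_eq_sum[of "\<kappa> j" n N]) (intro sum.cong, auto)
  let ?S = "{x \<in> space (PiM {1..n} (\<lambda>_. borel)). \<exists>j\<in>J. resid_walk N x (\<kappa> j) > b}"
  have S: "?S \<in> sets (PiM {1..n} (\<lambda>_. borel))"
  proof (rule sets.sets_Collect_finite_Ex[OF _ J(1)])
    fix j assume "j \<in> J"
    then have [measurable]: "(\<lambda>x. resid_walk N x (\<kappa> j)) \<in> borel_measurable (PiM {1..n} (\<lambda>_. borel))"
      using J(2) by (intro resid_walk_measurable) auto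
    show "{x \<in> space (PiM {1..n} (\<lambda>_. borel)). resid_walk N x (\<kappa> j) > b} \<in> sets (PiM {1..n} (\<lambda>_. borel))"
      by measurable
  qed
  have "measure P ?S = measure M (?X -` ?S \<inter> space M)"
    unfolding law[symmetric] by (rule measure_distr[OF X S])
  also have "?X -` ?S \<inter> space M = {\<omega> \<in> space M. \<exists>j\<in>J. resid_walk N (\<lambda>i. \<epsilon> n i \<omega>) (\<kappa> j) > b}"
    using measurable_space[OF X] W by auto
  finally show ?thesis by (simp add: spP)
qed

theorem theorem3:
  fixes M :: "'a measure"
    and \<epsilon> :: "nat \<Rightarrow> nat \<Rightarrow> 'a \<Rightarrow> real"
    and t :: "nat \<Rightarrow> nat \<Rightarrow> real"
    and g :: "real \<Rightarrow> real"
    and \<alpha> :: real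
  assumes "prob_space M"
    and "error_array M \<epsilon>"
    and "lindeberg M \<epsilon>"
    and "design_points t"
    and "\<alpha> \<in> {0<..<1}"
    and "constant_on_unit g"
  shows "(\<lambda>n. measure M {\<omega> \<in> space M. rejects \<alpha> n (t n) (\<lambda>j. g (t n j) + \<epsilon> n j \<omega>)}) \<longlonglongrightarrow> \<alpha>"
proof -
  interpret prob_space M by fact
  define b where "b = - std_normal_quantile (\<alpha> / 2)"
  \<comment> \<open>The limiting tail of the maximum; at the critical level \<open>b\<close> it
    equals \<alpha> because \<Phi> b = 1 - \<alpha>/2.\<close>
  define H where "H x = 2 * (1 - cdf std_normal_distribution x)" for x
  have b: "b > 0" and Hb: "H b = \<alpha>"
    using std_normal_quantile_half[OF \<open>\<alpha> \<in> {0<..<1}\<close>] by (simp_all add: b_def H_def)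
  have Hcont: "isCont H x" for x
    unfolding H_def by (intro continuous_intros isCont_std_normal_cdf)
  define p where "p n = measure M {\<omega> \<in> space M. rejects \<alpha> n (t n) (\<lambda>j. g (t n j) + \<epsilon> n j \<omega>)}" for n
  define W where "W n k \<omega> = resid_walk (n - 1) (\<lambda>i. \<epsilon> n i \<omega>) k" for n k \<omega>
  have p: "p n = prob {\<omega> \<in> space M. \<exists>k\<in>{1..n - 1}. W n k \<omega> > b}" if n: "n \<ge> 2" for n
  proof -
    obtain \<beta> where \<beta>: "\<And>x. x \<in> {0..1} \<Longrightarrow> g x = \<beta>"
      using assms(6) unfolding constant_on_unit_def by blast
    have "g (t n j) + \<epsilon> n j \<omega> = \<beta> + \<epsilon> n j \<omega>" if "j \<in> {1..n}" for j \<omega>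
      using assms(4) that \<beta> unfolding design_points_def by simp
    from rejects_iff[OF n _ this] b show ?thesis
      unfolding p_def W_def by (simp add: b_def)
  qed
  have Wm: "W n k \<in> borel_measurable M" if "k \<le> n - 1" "n \<ge> 1" for n k
    unfolding W_def using that error_arrayD(2)[OF assms(1,2), of _ n]
    by (simp only: resid_walk_eq_sum[of k n "n - 1"]) (intro borel_measurable_sum borel_measurable_times; simp)
  have std: "n \<ge> 1 \<Longrightarrow> standardized (distr M borel (\<epsilon> n 1))" for n
    by (rule error_array_standardized[OF assms(1,2)])
  note Lin = error_array_lindeberg_laws[OF assms(1,2,3)]
  define Q where "Q m n c = prob {\<omega> \<in> space M. \<exists>j\<in>{1..m}. W n (grid m (n - 1) j) \<omega> > c}" for m n c
  let ?P = "\<lambda>n. PiM {1..n} (\<lambda>_. distr M borel (\<epsilon> n 1))"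
  have Q: "Q m n c = measure (?P n) {x \<in> space (?P n). \<exists>j\<in>{1..m}. resid_walk (n - 1) x (grid m (n - 1) j) > c}"
    if "m \<ge> 1" "n \<ge> 1" for m n c
    unfolding Q_def W_def using grid_le[OF that(1), of _ "n - 1"] that(2)
    by (intro error_array_resid_walk_law[OF assms(1,2)]) (auto simp: le_diff_conv2)
  define Z where "Z m n c = measure (std_normal_PiM {1..n})
      {x \<in> space (std_normal_PiM {1..n}). \<exists>j\<in>{1..m}. resid_walk (n - 1) x (grid m (n - 1) j) > c}" for m n c
  \<comment> \<open>Actual errors (\<open>Q\<close>) and Gaussian errors (\<open>Z\<close>) are
    compared in both directions on a fixed grid, at the price of shifting the level by
    \<open>d\<close>.\<close>
  have QZ: "\<forall>\<^sub>F n in sequentially. Q m n c \<le> Z m n (c - d) + \<eta>"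
    and ZQ: "\<forall>\<^sub>F n in sequentially. Z m n c \<le> Q m n (c - d) + \<eta>" if m: "m \<ge> 1" and "d > 0" "\<eta> > 0" for m c d \<eta>
  proof -
    have gr: "grid m (n - 1) j \<le> n - 1" if "j \<in> {1..m}" for n j
      using grid_le[OF m] that by simp
    let ?Q = "\<lambda>n c. measure (?P n) {x \<in> space (?P n). \<exists>j\<in>{1..m}. resid_walk (n - 1) x (grid m (n - 1) j) > c}"
    have ge1: "\<forall>\<^sub>F n in sequentially. n \<ge> (1::nat)" by (rule eventually_ge_at_top)
    have "\<forall>\<^sub>F n in sequentially. ?Q n c \<le> Z m n (c - d) + \<eta>"
      unfolding Z_def by (rule grid_comparison[OF std standardized_std_normal Lin lindeberg_laws_std_normal
            finite_atLeastAtMost gr that(2,3)])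
    then show "\<forall>\<^sub>F n in sequentially. Q m n c \<le> Z m n (c - d) + \<eta>"
      using ge1 by eventually_elim (simp only: Q[OF m])
    have "\<forall>\<^sub>F n in sequentially. Z m n c \<le> ?Q n (c - d) + \<eta>"
      unfolding Z_def by (rule grid_comparison[OF standardized_std_normal std lindeberg_laws_std_normal Lin
            finite_atLeastAtMost gr that(2,3)])
    then show "\<forall>\<^sub>F n in sequentially. Z m n c \<le> Q m n (c - d) + \<eta>"
      using ge1 by eventually_elim (simp only: Q[OF m])
  qed
  have "p \<longlonglongrightarrow> \<alpha>"
  proof (rule order_tendstoI)
    fix a assume "a < \<alpha>"
    define e where "e = \<alpha> - a"
    have e: "e > 0" using \<open>a < \<alpha>\<close> by (simp add: e_def)
    obtain r where r: "r > 0" "\<And>x. \<bar>x - b\<bar> < r \<Longrightarrow> \<bar>H x - H b\<bar> < e / 4"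
      using Hcont[of b] e unfolding continuous_at_eps_delta dist_real_def by (metis zero_less_divide_iff zero_less_numeral)
    \<comment> \<open>Replacement and the overshoot in Levy's lower bound each shift the level by
      \<delta>; the total of 2 \<delta> stays within the continuity radius \<open>r\<close>.\<close>
    define \<delta> where "\<delta> = r / 4"
    have \<delta>: "\<delta> > 0" using r by (simp add: \<delta>_def)
    have "(\<lambda>m. 24 / \<delta> ^ 4 / real m) \<longlonglongrightarrow> 0" by (rule lim_const_over_n)
    then have "\<forall>\<^sub>F m in sequentially. 24 / \<delta> ^ 4 / real m < e / 4"
      using e by (intro order_tendstoD(2)) auto
    then have "\<forall>\<^sub>F m in sequentially. 24 / \<delta> ^ 4 / real m < e / 4 \<and> m \<ge> 1"
      using eventually_ge_at_top by (rule eventually_conj)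
    then obtain m where m: "24 / \<delta> ^ 4 / real m < e / 4" "m \<ge> 1"
      by (auto dest: eventually_happens)
    have "\<forall>\<^sub>F n in sequentially. Z m n (b + \<delta>) \<le> Q m n (b + \<delta> - \<delta>) + e / 4"
      using e \<delta> m by (intro ZQ) auto
    then show "\<forall>\<^sub>F n in sequentially. a < p n"
      using eventually_ge_at_top[of "m + 1"]
    proof eventually_elim
      case (elim n)
      define N where "N = n - 1"
      have N: "n = N + 1" "N \<ge> m" using elim by (simp_all add: N_def)
      have "H (b + \<delta> + \<delta>) \<le> Z m n (b + \<delta>) + 24 / (real m * \<delta> ^ 4)"
        unfolding H_def Z_def N_def[symmetric] unfolding N(1) using b \<delta> by (intro std_normal_grid_lower m N) auto
      moreover have "24 / (real m * \<delta> ^ 4) < e / 4" using m by (simp add: mult.commute)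
      moreover have "\<bar>H (b + \<delta> + \<delta>) - H b\<bar> < e / 4"
        using r(1) by (intro r(2)) (simp add: \<delta>_def)
      \<comment> \<open>Here the maximum over all times simply dominates the one over the grid; n
        \<ge> m + 1 keeps the grid points away from time 0.\<close>
      moreover have "Q m n b \<le> p n"
      proof -
        have n2: "n \<ge> 2" using N m by simp
        have "{\<omega> \<in> space M. \<exists>k\<in>{1..n - 1}. W n k \<omega> > b} \<in> events"
          using Wm[of _ n] n2 by (intro sets.sets_Collect_finite_Ex) auto
        moreover have "grid m (n - 1) j \<in> {1..n - 1}" if "j \<in> {1..m}" for j
          using grid_step(1)[OF m(2) N(2), of "j - 1"] grid_le[OF m(2), of j N] that N by simp
        ultimately show ?thesis
          unfolding p[OF n2] Q_def by (intro finite_measure_mono) auto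
      qed
      moreover have "Z m n (b + \<delta>) \<le> Q m n b + e / 4" using elim(1) by simp
      ultimately show ?case using Hb e_def by linarith
    qed
  next
    fix a assume "a > \<alpha>"
    define e where "e = a - \<alpha>"
    have e: "e > 0" using \<open>a > \<alpha>\<close> by (simp add: e_def)
    obtain r where r: "r > 0" "\<And>x. \<bar>x - b\<bar> < r \<Longrightarrow> \<bar>H x - H b\<bar> < e / 4"
      using Hcont[of b] e unfolding continuous_at_eps_delta dist_real_def by (metis zero_less_divide_iff zero_less_numeral)
    \<comment> \<open>Ottaviani's argument lowers the level by 2 \<delta> and replacement by another
      \<delta>; the total of 3 \<delta> is still below \<open>r\<close>.\<close>
    define \<delta> where "\<delta> = r / 4"
    have \<delta>: "\<delta> > 0" using r by (simp add: \<delta>_def)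
    \<comment> \<open>The two terms are the defect of the Ottaviani factor and the probability of a
      large drift. Both vanish as \<open>m\<close> grows and neither depends on n, so
      \<open>m\<close> can be fixed before n.\<close>
    have "(\<lambda>m. 2 / \<delta>\<^sup>2 / real m + 4 / \<delta>\<^sup>2 * sqrt (2 / real m)) \<longlonglongrightarrow> 0 + 4 / \<delta>\<^sup>2 * sqrt 0"
      by (intro tendsto_add tendsto_mult tendsto_real_sqrt tendsto_const lim_const_over_n)
    then have "\<forall>\<^sub>F m in sequentially. 2 / \<delta>\<^sup>2 / real m + 4 / \<delta>\<^sup>2 * sqrt (2 / real m) < e / 4"
      using e by (intro order_tendstoD(2)) auto
    then have "\<forall>\<^sub>F m in sequentially. 2 / \<delta>\<^sup>2 / real m + 4 / \<delta>\<^sup>2 * sqrt (2 / real m) < e / 4 \<and> m \<ge> 1"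
      using eventually_ge_at_top by (rule eventually_conj)
    then obtain m where m: "2 / \<delta>\<^sup>2 / real m + 4 / \<delta>\<^sup>2 * sqrt (2 / real m) < e / 4" "m \<ge> 1"
      by (auto dest: eventually_happens)
    have "\<forall>\<^sub>F n in sequentially. Q m n (b - 2 * \<delta>) \<le> Z m n (b - 2 * \<delta> - \<delta>) + e / 4"
      using e \<delta> m by (intro QZ) auto
    then show "\<forall>\<^sub>F n in sequentially. p n < a"
      using eventually_ge_at_top[of "m + 1"]
    proof eventually_elim
      case (elim n)
      define N where "N = n - 1"
      have N: "n = N + 1" "N \<ge> m" using elim by (simp_all add: N_def)
      have n2: "n \<ge> 2" using N m by simp
      note E = error_arrayD[OF assms(1,2)]
      have 1: "1 \<in> {1..n}" using n2 by simp
      have "(1 - 2 / (real m * \<delta>\<^sup>2)) * p n \<le> Q m n (b - 2 * \<delta>) + 4 * sqrt (2 / real m) / \<delta>\<^sup>2"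
        using prob_max_le_grid[OF E(1)[OF 1] E(6) E(5) E(7) m(2) N(2) N(1) \<delta>, of "b - 2 * \<delta>"]
        unfolding p[OF n2] Q_def W_def N_def[symmetric] by simp
      \<comment> \<open>Since a probability is at most 1, the Ottaviani factor becomes an additive
        error and no division by it is required.\<close>
      moreover have "2 / (real m * \<delta>\<^sup>2) * p n \<le> 2 / (real m * \<delta>\<^sup>2) * 1"
        by (intro mult_left_mono) (auto simp: p_def)
      moreover have "Z m n (b - 2 * \<delta> - \<delta>) \<le> H (b - 2 * \<delta> - \<delta>)"
        unfolding H_def Z_def N_def[symmetric] unfolding N(1) by (intro std_normal_grid_upper m N)
      moreover have "\<bar>H (b - 2 * \<delta> - \<delta>) - H b\<bar> < e / 4"
        using r(1) by (intro r(2)) (simp add: \<delta>_def)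
      moreover have "2 / (real m * \<delta>\<^sup>2) + 4 * sqrt (2 / real m) / \<delta>\<^sup>2 < e / 4"
        using m(1) by (simp add: mult.commute)
      moreover have "(1 - 2 / (real m * \<delta>\<^sup>2)) * p n = p n - 2 / (real m * \<delta>\<^sup>2) * p n"
        by (simp only: left_diff_distrib mult_1_left)
      ultimately show ?case using elim(1) Hb e_def by linarith
    qed
  qed
  then show ?thesis by (simp add: p_def[abs_def])
qed

end
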